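(* Let $\alpha>0$. (i) Assume that a generator $\mathcal{G}\in\mathcal{C}(\alpha)$ has stable $\mathbb{Z}$-shifts. If a separated set $\Lambda\subset\mathbb{R}$ satisfies $D^-(\Lambda)>q(\mathcal{G})+1$, then $\Lambda$ is a sampling set for $V^p_{\mathbb{Z}}(\mathcal{G})$ for every $p\in[1,\infty]$. (ii) For every $N\in\mathbb{N}$ there exist a generator $\mathcal{G}\in\mathcal{C}(\alpha)$ with stable $\mathbb{Z}$-shifts and $q(\mathcal{G})=N$, and a separated set $\Lambda\subset\mathbb{R}$ satisfying $D^-(\Lambda)=q(\mathcal{G})+1$, such that $\Lambda$ is not a uniqueness set for $V^\infty_{\mathbb{Z}}(\mathcal{G})$.
   Context: A countable set $\Lambda\subset\mathbb{R}$ is separated if $\inf_{\lambda\ne\lambda'}|\lambda-\lambda'|>0$; $D^-(\Lambda)=\lim_{R\to\infty}\inf_{x\in\mathbb{R}}\frac{\#(\Lambda\cap[x-R,x+R])}{2R}$. Here $\mathbb{N}=\{1,2,\dots\}$. Class $\mathcal{C}(\alpha)$: all functions $\mathcal{G}(z)=e^{-\alpha z^2/2}\frac{P(e^{\alpha z})}{Q(e^{\alpha z})}$, where $P,Q$ are non-trivial complex polynomials without common zeros and $Q(x)\ne0$ for all real $x\ge0$. For such $\mathcal{G}$, $q(\mathcal{G}):=\deg Q$. $V^p_{\mathbb{Z}}(\mathcal{G})$ is the space of all functions $f(x)=\sum_{n\in\mathbb{Z}}c_n\mathcal{G}(x-n)$, $x\in\mathbb{R}$, with $\{c_n\}\in l^p(\mathbb{Z})$.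 The $\mathbb{Z}$-shifts of $\mathcal{G}$ are stable if for every $p\in[1,\infty]$ there are constants $C_1,C_2>0$ with $C_1\|\mathbf{c}\|_p\le\|\sum_{n\in\mathbb{Z}}c_n\mathcal{G}(\cdot-n)\|_{L^p(\mathbb{R})}\le C_2\|\mathbf{c}\|_p$ for all $\mathbf{c}=\{c_n\}\in l^p(\mathbb{Z})$. A separated set $\Lambda$ is a sampling set for $V^p_{\mathbb{Z}}(\mathcal{G})$ if there are positive constants $A,B$ such that $A\|f\|_p^p\le\sum_{\lambda\in\Lambda}|f(\lambda)|^p\le B\|f\|_p^p$ for all $f\in V^p_{\mathbb{Z}}(\mathcal{G})$ (when $1\le p<\infty$), respectively a constant $K>0$ such that $\|f\|_\infty\le K\sup_{\lambda\in\Lambda}|f(\lambda)|$ for all $f\in V^\infty_{\mathbb{Z}}(\mathcal{G})$ (when $p=\infty$). $\Lambda$ is not a uniqueness set for $V^\infty_{\mathbb{Z}}(\mathcal{G})$ if there is a non-trivial (not identically zero) $f\in V^\infty_{\mathbb{Z}}(\mathcal{G})$ that vanishes on $\Lambda$. *)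

theory Defs
  imports
    "HOL-Analysis.Analysis"
    "HOL-Probability.Essential_Supremum"
    "HOL-Computational_Algebra.Computational_Algebra"
    "HOL-Computational_Algebra.Field_as_Ring"
begin

(* uniform_discrete: the distances of distinct points are bounded below by a positive constant. *)
definition separated :: "real set \<Rightarrow> bool" where
  "separated \<Lambda> \<longleftrightarrow> countable \<Lambda> \<and> uniform_discrete \<Lambda>"

(* Only used for separated sets: they meet each bounded interval in a finite set, so card is the
   true number of points, and the limit exists. *)
definition lower_density :: "real set \<Rightarrow> real" where
  "lower_density \<Lambda> =
     Lim at_top (\<lambda>R. INF x::real. real (card (\<Lambda> \<inter> {x - R..x + R})) / (2 * R))"

definition represents ::
  "real \<Rightarrow> (complex \<Rightarrow> complex) \<Rightarrow> complex poly \<Rightarrow> complex poly \<Rightarrow> bool" where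
  "represents \<alpha> G P Q \<longleftrightarrow>
     P \<noteq> 0 \<and> Q \<noteq> 0 \<and> \<not> (\<exists>w. poly P w = 0 \<and> poly Q w = 0) \<and>
     (\<forall>x::real. x \<ge> 0 \<longrightarrow> poly Q (of_real x) \<noteq> 0) \<and>
     G = (\<lambda>z. exp (- of_real \<alpha> * z ^ 2 / 2) *
               (poly P (exp (of_real \<alpha> * z)) / poly Q (exp (of_real \<alpha> * z))))"

(* A member takes the value 0 at its (non-real) poles, by the convention w / 0 = 0. *)
definition gen_class :: "real \<Rightarrow> (complex \<Rightarrow> complex) set" where
  "gen_class \<alpha> = {G. \<exists>P Q. represents \<alpha> G P Q}"

(* Well defined by denom_degree_eq below. *)
definition denom_degree :: "real \<Rightarrow> (complex \<Rightarrow> complex) \<Rightarrow> nat" where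
  "denom_degree \<alpha> G = (THE n. \<exists>P Q. represents \<alpha> G P Q \<and> n = degree Q)"

(* For M = lborel this is the L^p norm on the real line, for M = count_space UNIV the l^p norm
   (the essential supremum is then the supremum).  The value is infinite if f is not in the space. *)
definition Lp_norm :: "'a measure \<Rightarrow> ennreal \<Rightarrow> ('a \<Rightarrow> complex) \<Rightarrow> ennreal" where
  "Lp_norm M p f =
     (if p = \<infinity> then esssup M (\<lambda>x. ennreal (cmod (f x)))
      else let I = (\<integral>\<^sup>+x. ennreal (cmod (f x) powr enn2real p) \<partial>M)
           in if I = \<infinity> then \<infinity> else ennreal (enn2real I powr (1 / enn2real p)))"

abbreviation lp_norm :: "ennreal \<Rightarrow> (int \<Rightarrow> complex) \<Rightarrow> ennreal" where
  "lp_norm p c \<equiv> Lp_norm (count_space UNIV) p c"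

definition lp_space :: "ennreal \<Rightarrow> (int \<Rightarrow> complex) set" where
  "lp_space p = {c. lp_norm p c < \<infinity>}"

(* For G in gen_class and bounded c the series converges absolutely at each real x. *)
definition shift_series :: "(complex \<Rightarrow> complex) \<Rightarrow> (int \<Rightarrow> complex) \<Rightarrow> real \<Rightarrow> complex" where
  "shift_series G c x = (\<Sum>\<^sub>\<infinity>n. c n * G (of_real (x - of_int n)))"

definition shift_space :: "ennreal \<Rightarrow> (complex \<Rightarrow> complex) \<Rightarrow> (real \<Rightarrow> complex) set" where
  "shift_space p G = shift_series G ` lp_space p"

definition stable_shifts :: "(complex \<Rightarrow> complex) \<Rightarrow> bool" where
  "stable_shifts G \<longleftrightarrow>
     (\<forall>p\<ge>1. \<exists>C1 C2 :: real. C1 > 0 \<and> C2 > 0 \<and>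
        (\<forall>c\<in>lp_space p.
           ennreal C1 * lp_norm p c \<le> Lp_norm lborel p (shift_series G c) \<and>
           Lp_norm lborel p (shift_series G c) \<le> ennreal C2 * lp_norm p c))"

definition sampling_set :: "real set \<Rightarrow> ennreal \<Rightarrow> (complex \<Rightarrow> complex) \<Rightarrow> bool" where
  "sampling_set \<Lambda> p G \<longleftrightarrow> separated \<Lambda> \<and>
     (if p = \<infinity> then
        \<exists>K::real. K > 0 \<and>
          (\<forall>f\<in>shift_space \<infinity> G.
             Lp_norm lborel \<infinity> f \<le> ennreal K * (SUP l\<in>\<Lambda>. ennreal (cmod (f l))))
      else
        \<exists>A B :: real. A > 0 \<and> B > 0 \<and>
          (\<forall>f\<in>shift_space p G.
             let I = (\<integral>\<^sup>+x. ennreal (cmod (f x) powr enn2real p) \<partial>lborel);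
                 S = (\<Sum>\<^sub>\<infinity>l\<in>\<Lambda>. ennreal (cmod (f l) powr enn2real p))
             in ennreal A * I \<le> S \<and> S \<le> ennreal B * I))"

definition uniqueness_set :: "real set \<Rightarrow> ennreal \<Rightarrow> (complex \<Rightarrow> complex) \<Rightarrow> bool" where
  "uniqueness_set \<Lambda> p G \<longleftrightarrow>
     \<not> (\<exists>f\<in>shift_space p G. (\<exists>x. f x \<noteq> 0) \<and> (\<forall>l\<in>\<Lambda>. f l = 0))"

lemma no_common_zero_imp_coprime:
  fixes P Q :: "complex poly"
  assumes "P \<noteq> 0" "\<not> (\<exists>w. poly P w = 0 \<and> poly Q w = 0)"
  shows "coprime P Q"
proof (rule coprimeI)
  fix d assume d: "d dvd P" "d dvd Q"
  then have "d \<noteq> 0" using assms(1) by auto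
  have "\<not> (\<exists>w. poly d w = 0)"
    using d assms(2) by (meson dvd_trans poly_eq_0_iff_dvd)
  then have "constant (poly d)"
    using fundamental_theorem_of_algebra by blast
  then have "degree d = 0" by (simp add: constant_degree)
  then show "is_unit d" using \<open>d \<noteq> 0\<close> by (simp add: is_unit_iff_degree)
qed

lemma represents_degree_unique:
  assumes "\<alpha> > 0" and r1: "represents \<alpha> G P1 Q1" and r2: "represents \<alpha> G P2 Q2"
  shows "degree Q1 = degree Q2"
proof -
  have eq: "poly (P1 * Q2) (of_real x) = poly (P2 * Q1) (of_real x)" if "x > 0" for x :: real
  proof -
    have nz: "poly Q1 (of_real x) \<noteq> 0" "poly Q2 (of_real x) \<noteq> 0"
      using r1 r2 that by (auto simp: represents_def)
    define z :: complex where "z = of_real (ln x / \<alpha>)"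
    have "of_real \<alpha> * z = of_real (ln x)" using \<open>\<alpha> > 0\<close> by (simp add: z_def)
    then have e: "exp (of_real \<alpha> * z) = of_real x"
      using that by (metis exp_of_real exp_ln)
    have "G z = exp (- of_real \<alpha> * z ^ 2 / 2) * (poly P1 (of_real x) / poly Q1 (of_real x))"
      using r1 e by (simp add: represents_def)
    moreover have "G z = exp (- of_real \<alpha> * z ^ 2 / 2) * (poly P2 (of_real x) / poly Q2 (of_real x))"
      using r2 e by (simp add: represents_def)
    ultimately have "poly P1 (of_real x) / poly Q1 (of_real x) = poly P2 (of_real x) / poly Q2 (of_real x)"
      using exp_not_eq_zero mult_left_cancel by metis
    then show ?thesis using nz by (simp add: field_simps)
  qed
  have "P1 * Q2 = P2 * Q1"
  proof (rule ccontr)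
    assume "P1 * Q2 \<noteq> P2 * Q1"
    then have "finite {w. poly (P1 * Q2 - P2 * Q1) w = 0}"
      by (intro poly_roots_finite) simp
    moreover have "(of_real :: real \<Rightarrow> complex) ` {0<..} \<subseteq> {w. poly (P1 * Q2 - P2 * Q1) w = 0}"
      using eq by (auto simp del: poly_mult)
    ultimately have "finite ((of_real :: real \<Rightarrow> complex) ` {0<..})"
      using finite_subset by blast
    then show False by (simp add: finite_image_iff inj_on_def infinite_Ioi)
  qed
  then have "Q1 dvd P1 * Q2" "Q2 dvd P2 * Q1"
    by (metis dvd_triv_right)+
  moreover have "coprime Q1 P1" "coprime Q2 P2"
    using r1 r2 no_common_zero_imp_coprime by (auto simp: represents_def coprime_commute)
  ultimately have "Q1 dvd Q2" "Q2 dvd Q1"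
    by (simp_all add: coprime_dvd_mult_right_iff)
  moreover have "Q1 \<noteq> 0" "Q2 \<noteq> 0"
    using r1 r2 by (simp_all add: represents_def)
  ultimately show ?thesis
    by (simp add: dvd_imp_degree_le antisym)
qed

lemma denom_degree_eq:
  assumes "\<alpha> > 0" "represents \<alpha> G P Q"
  shows "denom_degree \<alpha> G = degree Q"
  unfolding denom_degree_def
proof (rule the_equality)
  show "\<exists>P' Q'. represents \<alpha> G P' Q' \<and> degree Q = degree Q'"
    using assms(2) by blast
next
  fix n assume "\<exists>P' Q'. represents \<alpha> G P' Q' \<and> n = degree Q'"
  then show "n = degree Q"
    using represents_degree_unique[OF assms(1) _ assms(2)] by blast
qed

end

theory Submission
  imports Defs "HOL-Complex_Analysis.Complex_Analysis" "HOL-Real_Asymp.Real_Asymp"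
begin

text \<open>
Put \<open>R = P / Q\<close>, \<open>q = deg Q\<close> and \<open>w = e^(\<alpha> x)\<close>.  The factor \<open>e^(\<alpha> x^2 / 2)\<close> turns the shift
\<open>G (x - n)\<close> into \<open>\<tau>\<^sub>n w = e^(-\<alpha> n^2 / 2) w^n R (w e^(-\<alpha> n))\<close>, a rational function of \<open>w\<close>.  On the
circle \<open>|w| = e^(\<alpha> L)\<close> these functions sum up to size \<open>e^(\<alpha> L^2 / 2)\<close>, and in an annulus
\<open>e^(-\<alpha> L) \<le> |w| \<le> e^(\<alpha> L)\<close> they have about \<open>2 q L\<close> poles; clearing these costs another factor
\<open>e^(\<alpha> q L^2 / 2)\<close>.  If \<open>\<Lambda>\<close> has more than \<open>q + 1\<close> points per unit length, dividing by the product
over the nodes \<open>e^(\<alpha> \<lambda>)\<close>, \<open>\<bar>\<lambda>\<bar> < L\<close>, gains more than \<open>e^(\<alpha> (q + 1) L^2 / 2)\<close>.  This is Jensen's formula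
in disguise, and it is used quantitatively: the residue theorem on the two boundary circles of the
annulus (\<open>annulus_lagrange_bound\<close>) writes the value at a point \<open>w\<^sub>0\<close> as a combination of the values at
the nodes plus an error.  The coefficients do not depend on \<open>n\<close>, and the errors, summed over all
\<open>n\<close>, tend to \<open>0\<close> as \<open>L\<close> grows, uniformly in the node set (\<open>quadrature\<close>).

Two choices of \<open>w\<^sub>0\<close> are made.  For \<open>w\<^sub>0 = e^(\<alpha> x)\<close> with \<open>x\<close> real, \<open>point_quadrature\<close> bounds \<open>f x\<close> by
\<open>\<epsilon> \<parallel>c\<parallel>\<close> plus a multiple of the samples of \<open>f\<close> near \<open>x\<close>.  For \<open>w\<^sub>0 = -1\<close> a pole of \<open>R\<close> whose multiples
\<open>-e^(\<alpha> n)\<close>, \<open>n \<noteq> 0\<close>, are not poles, all terms except \<open>n = 0\<close> vanish after clearing, so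
\<open>pole_quadrature\<close> bounds the coefficient \<open>c 0\<close> by \<open>\<epsilon> \<parallel>c\<parallel>\<close> plus values of \<open>f\<close>.  Both estimates are local,
hence Schur's test converts them into \<open>L^p\<close> estimates for every \<open>p\<close> at once.  The first, together
with the stability of the shifts, is the sampling inequality; the second proves stability.

For the second part take \<open>Q = (1 + u)^N\<close>, \<open>\<chi> = -(-1)^N\<close>, \<open>c n = \<chi>^n\<close> and look for \<open>P\<close> of degree at most
\<open>N\<close> with \<open>G (-x) = (-1)^N G x\<close>.  Then \<open>f (x + 1) = \<chi> f x\<close> and \<open>f (1 - x) = - f x\<close>, which forces some
zeros of \<open>f\<close> on \<open>\<Lambda> = 1/2 + \<int> / (N + 1)\<close> and leaves only \<open>N div 2\<close> linear conditions for \<open>f = 0\<close> on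
\<open>\<Lambda>\<close>.  The symmetric numerators form a space of dimension \<open>N div 2 + 1\<close>, so a nonzero \<open>P\<close> exists.  If
\<open>P (-1)\<close> were zero, the fraction could be reduced, \<open>\<Lambda>\<close> would be too dense for the smaller
denominator, and \<open>f\<close> would vanish identically, which is impossible.
\<close>

section \<open>Lagrange interpolation in an annulus\<close>

text \<open>
The residue theorem for \<open>g z / ((z - w) (\<Prod>b\<in>A. z - b))\<close> on both circles: only the singularities at
\<open>w\<close> and at the nodes lie between them, and multiplication by \<open>\<Prod>b\<in>A. w - b\<close> turns their residues into
the interpolation error at \<open>w\<close>.  The same product stands on the left of the two boundary bounds, so
that a point \<open>w\<close> which happens to be a node, where the error is \<open>0\<close>, is covered as well.
\<close>

lemma annulus_lagrange_bound:
  fixes g :: "complex \<Rightarrow> complex" and r R E1 E2 :: real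
  assumes r: "0 < r" "r < R" and X: "finite X" "\<And>z. z \<in> X \<Longrightarrow> cmod z < r \<or> R < cmod z"
    and g: "g holomorphic_on - X"
    and A: "finite A" "\<And>z. z \<in> A \<Longrightarrow> r < cmod z \<and> cmod z < R"
    and w: "r < cmod w" "cmod w < R"
    and out: "\<And>z. cmod z = R \<Longrightarrow> R * cmod (g z) * (\<Prod>b\<in>A. cmod (w - b)) \<le> E1 * (cmod (z - w) * (\<Prod>b\<in>A. cmod (z - b)))"
    and inn: "\<And>z. cmod z = r \<Longrightarrow> r * cmod (g z) * (\<Prod>b\<in>A. cmod (w - b)) \<le> E2 * (cmod (z - w) * (\<Prod>b\<in>A. cmod (z - b)))"
    and E: "0 \<le> E1" "0 \<le> E2"
  shows "cmod (g w - (\<Sum>a\<in>A. g a * (\<Prod>b\<in>A-{a}. (w - b) / (a - b))))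
           \<le> E1 + E2"
proof (cases "w \<in> A")
  case True
  have "(\<Prod>b\<in>A-{a}. (w - b) / (a - b)) = (if a = w then 1 else 0)" if "a \<in> A" for a
  proof (cases "a = w")
    case True
    have "(\<Prod>b\<in>A-{a}. (w - b) / (a - b)) = 1"
      by (rule prod.neutral) (use True in auto)
    with True show ?thesis by simp
  next
    case False
    with \<open>w \<in> A\<close> A(1) show ?thesis
      by (auto intro!: prod_zero)
  qed
  then have "(\<Sum>a\<in>A. g a * (\<Prod>b\<in>A-{a}. (w - b) / (a - b))) = (\<Sum>a\<in>A. if a = w then g a else 0)"
    by (intro sum.cong) auto
  also have "\<dots> = g w"
    using True A(1) by (simp add: sum.delta)
  finally show ?thesis
    using E by (simp add: prod_nonneg)
next
  case False
  define B where "B = insert w A"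
  define p where "p = (\<Prod>b\<in>A. cmod (w - b))"
  have p: "p > 0" unfolding p_def using False by (intro prod_pos) auto
  define h where "h z = g z / (\<Prod>b\<in>B. z - b)" for z
  have fB: "finite B" using A by (simp add: B_def)
  have Bann: "r < cmod z \<and> cmod z < R" if "z \<in> B" for z
    using that A w by (auto simp: B_def)
  have XB: "X \<inter> B = {}" using X Bann by force
  have opn: "open (- X)" using X(1) by (simp add: finite_imp_closed open_Compl)
  have nz: "(\<Prod>b\<in>B. z - b) \<noteq> 0" if "z \<notin> B" for z
    using that fB by auto
  have h_holo: "h holomorphic_on UNIV - (X \<union> B)"
    unfolding h_def using nz by (intro holomorphic_intros holomorphic_on_subset[OF g]) auto
  have prodB: "(\<Prod>b\<in>B. cmod (z - b)) = cmod (z - w) * (\<Prod>b\<in>A. cmod (z - b))" for z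
    using False A(1) by (simp add: B_def)
  have on_circle: "cmod (contour_integral (circlepath 0 \<rho>) h) \<le> 2 * pi * E"
    if \<rho>: "0 < \<rho>" "\<rho> = r \<or> \<rho> = R" and E: "0 \<le> E"
      and bd: "\<And>z. cmod z = \<rho> \<Longrightarrow> \<rho> * cmod (g z) \<le> E * (cmod (z - w) * (\<Prod>b\<in>A. cmod (z - b)))"
    for \<rho> E
  proof -
    have sub: "path_image (circlepath 0 \<rho>) \<subseteq> UNIV - (X \<union> B)"
      using X Bann \<rho> r by (force simp: path_image_circlepath)
    have "h contour_integrable_on circlepath 0 \<rho>"
      by (rule contour_integrable_holomorphic_simple[OF h_holo _ _ sub])
         (use X(1) fB in \<open>auto intro!: finite_imp_closed open_Diff\<close>)
    moreover have "cmod (h z) \<le> E / \<rho>" if z: "cmod (z - 0) = \<rho>" for z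
    proof -
      have "z \<notin> B" using z \<rho> Bann[of z] by auto
      then have pos: "(\<Prod>b\<in>B. cmod (z - b)) > 0"
        by (intro prod_pos) auto
      have "\<rho> * cmod (g z) \<le> E * (\<Prod>b\<in>B. cmod (z - b))"
        using bd z by (simp add: prodB)
      then show ?thesis
        using pos \<rho>(1) by (simp add: h_def norm_divide field_simps flip: prod_norm)
    qed
    ultimately have "cmod (contour_integral (circlepath 0 \<rho>) h) \<le> E / \<rho> * (2 * pi * \<rho>)"
      using has_contour_integral_bound_circlepath[OF has_contour_integral_integral, of h 0 \<rho> "E/\<rho>"] E \<rho>(1)
      by simp
    then show ?thesis using \<rho>(1) by (simp add: field_simps)
  qed
  have res: "contour_integral (circlepath 0 \<rho>) h =
      2 * pi * \<i> * (\<Sum>p\<in>X \<union> B. winding_number (circlepath 0 \<rho>) p * residue h p)"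
    if "\<rho> = r \<or> \<rho> = R" for \<rho>
  proof (rule Residue_theorem[where S = UNIV])
    show "path_image (circlepath 0 \<rho>) \<subseteq> UNIV - (X \<union> B)"
      using X Bann that r by (force simp: path_image_circlepath)
  qed (use X(1) fB h_holo in auto)
  have wind: "winding_number (circlepath 0 \<rho>) p = (if cmod p < \<rho> then 1 else 0)"
    if "0 < \<rho>" "cmod p \<noteq> \<rho>" for \<rho> p
    using that winding_number_circlepath[of p 0 \<rho>] winding_number_zero_outside[of "circlepath 0 \<rho>" "cball 0 \<rho>" p]
    by (auto simp: path_image_circlepath sphere_cball)
  have resB: "residue h p = g p / (\<Prod>b\<in>B-{p}. p - b)" if p: "p \<in> B" for p
  proof -
    let ?S = "- (X \<union> (B - {p}))"
    let ?f = "\<lambda>z. g z / (\<Prod>b\<in>B-{p}. z - b)"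
    have "h = (\<lambda>z. ?f z / (z - p))"
      by (simp add: h_def prod.remove[OF fB p] mult.commute fun_eq_iff)
    moreover have "residue (\<lambda>z. ?f z / (z - p)) p = ?f p"
    proof (rule residue_simple)
      show "open ?S" using X(1) fB by (intro open_Compl finite_imp_closed) auto
      show "p \<in> ?S" using p XB by auto
      show "?f holomorphic_on ?S"
        by (intro holomorphic_intros holomorphic_on_subset[OF g]) (use fB in auto)
    qed
    ultimately show ?thesis by simp
  qed
  have diff: "contour_integral (circlepath 0 R) h - contour_integral (circlepath 0 r) h
      = 2 * pi * \<i> * (\<Sum>p\<in>B. g p / (\<Prod>b\<in>B-{p}. p - b))" (is "?I = _ * ?S")
  proof -
    have "?I = 2 * pi * \<i> * (\<Sum>p\<in>X \<union> B. (winding_number (circlepath 0 R) p - winding_number (circlepath 0 r) p) * residue h p)"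
      using res[of R] res[of r] by (simp add: sum_subtractf algebra_simps)
    also have "(\<Sum>p\<in>X \<union> B. (winding_number (circlepath 0 R) p - winding_number (circlepath 0 r) p) * residue h p)
        = (\<Sum>p\<in>X \<union> B. if p \<in> B then residue h p else 0)"
    proof (rule sum.cong[OF refl])
      fix p assume p: "p \<in> X \<union> B"
      then consider "p \<in> B" "r < cmod p" "cmod p < R" | "p \<notin> B" "cmod p < r" | "p \<notin> B" "cmod p > R"
        using X Bann XB by blast
      then show "(winding_number (circlepath 0 R) p - winding_number (circlepath 0 r) p) * residue h p
          = (if p \<in> B then residue h p else 0)"
        by cases (use r in \<open>auto simp: wind\<close>)
    qed
    also have "\<dots> = (\<Sum>p\<in>B. residue h p)"
      using X(1) fB by (simp add: sum.If_cases Int_absorb1)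
    also have "\<dots> = ?S" by (intro sum.cong refl resB)
    finally show ?thesis .
  qed
  have "R * cmod (g z) \<le> E1 / p * (cmod (z - w) * (\<Prod>b\<in>A. cmod (z - b)))" if "cmod z = R" for z
    using out[OF that] p by (simp add: p_def[symmetric] field_simps)
  moreover have "r * cmod (g z) \<le> E2 / p * (cmod (z - w) * (\<Prod>b\<in>A. cmod (z - b)))" if "cmod z = r" for z
    using inn[OF that] p by (simp add: p_def[symmetric] field_simps)
  ultimately have "cmod ?I \<le> 2 * pi * (E1 / p) + 2 * pi * (E2 / p)"
    using on_circle[of R "E1 / p"] on_circle[of r "E2 / p"] r E p
    by (intro order_trans[OF norm_triangle_ineq4] add_mono) auto
  then have S: "cmod ?S \<le> E1 / p + E2 / p"
    by (simp add: diff norm_mult flip: distrib_left times_divide_eq_right)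
  have "(\<Prod>b\<in>A. w - b) * ?S = g w - (\<Sum>a\<in>A. g a * (\<Prod>b\<in>A-{a}. (w - b) / (a - b)))"
  proof -
    have Anz: "(\<Prod>b\<in>A. w - b) \<noteq> 0" using False A by auto
    have S_split: "?S = g w / (\<Prod>b\<in>A. w - b) + (\<Sum>a\<in>A. g a / ((a - w) * (\<Prod>b\<in>A-{a}. a - b)))"
    proof -
      have "(\<Prod>b\<in>B-{a}. a - b) = (a - w) * (\<Prod>b\<in>A-{a}. a - b)" if "a \<in> A" for a
      proof -
        have "B - {a} = insert w (A - {a})" "w \<notin> A - {a}" using that False by (auto simp: B_def)
        then show ?thesis using A(1) by simp
      qed
      moreover have "B - {w} = A" using False by (auto simp: B_def)
      ultimately show ?thesis using False A(1) by (simp add: B_def)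
    qed
    have "(\<Prod>b\<in>A. w - b) * (g a / ((a - w) * (\<Prod>b\<in>A-{a}. a - b)))
        = - (g a * (\<Prod>b\<in>A-{a}. (w - b) / (a - b)))" if a: "a \<in> A" for a
    proof -
      have "(\<Prod>b\<in>A. w - b) = (w - a) * (\<Prod>b\<in>A-{a}. w - b)"
        by (rule prod.remove[OF A(1) a])
      moreover have "a - w \<noteq> 0" using a False by auto
      moreover have "w - a = - (a - w)" by simp
      moreover have "- x * c * (t / (x * y)) = - (t * (c / y))" if "x \<noteq> 0" for x c t y :: complex
        using that by (cases "y = 0") (auto simp: field_simps)
      ultimately show ?thesis
        by (simp only: prod_dividef)
    qed
    then have "(\<Prod>b\<in>A. w - b) * (\<Sum>a\<in>A. g a / ((a - w) * (\<Prod>b\<in>A-{a}. a - b)))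
        = - (\<Sum>a\<in>A. g a * (\<Prod>b\<in>A-{a}. (w - b) / (a - b)))"
      unfolding sum_distrib_left sum_negf[symmetric] by (intro sum.cong refl)
    moreover have "(\<Prod>b\<in>A. w - b) * (g w / (\<Prod>b\<in>A. w - b)) = g w"
      using Anz by simp
    ultimately show ?thesis
      using S_split by (simp only: distrib_left) simp
  qed
  then have "cmod (g w - (\<Sum>a\<in>A. g a * (\<Prod>b\<in>A-{a}. (w - b) / (a - b)))) = (\<Prod>b\<in>A. cmod (w - b)) * cmod ?S"
    by (simp only: norm_mult[symmetric] prod_norm)
  also have "\<dots> \<le> p * (E1 / p + E2 / p)"
    unfolding p_def[symmetric] using p by (intro mult_left_mono S) auto
  finally show ?thesis using p by (simp add: distrib_left)
qed

section \<open>Shifts with their poles cleared\<close>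

text \<open>
The denominator is given through its zeros \<open>om 0, \<dots>, om (q - 1)\<close>, repeated according to
multiplicity.
\<close>

locale gauss_rational =
  fixes \<alpha> :: real and G :: "complex \<Rightarrow> complex" and P Q :: "complex poly"
    and l :: complex and q :: nat and om :: "nat \<Rightarrow> complex"
  assumes \<alpha>: "\<alpha> > 0"
    and G: "G = (\<lambda>z. exp (- of_real \<alpha> * z ^ 2 / 2) *
               (poly P (exp (of_real \<alpha> * z)) / poly Q (exp (of_real \<alpha> * z))))"
    and Q: "Q = smult l (\<Prod>j<q. [:- om j, 1:])" and l: "l \<noteq> 0"
    and om: "\<And>j x. j < q \<Longrightarrow> 0 \<le> x \<Longrightarrow> om j \<noteq> complex_of_real x"
begin

lemma om_nz: "j < q \<Longrightarrow> om j \<noteq> 0"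
  using om[of j 0] by auto

text \<open>
A shift of \<open>z\<close> by \<open>n\<close> divides \<open>e^(\<alpha> z)\<close> by this number.
\<close>

definition exp_step :: "int \<Rightarrow> complex" where
  "exp_step n = of_real (exp (\<alpha> * real_of_int n))"

lemma exp_step_nz [simp]: "exp_step n \<noteq> 0" by (simp add: exp_step_def)
lemma norm_exp_step: "cmod (exp_step n) = exp (\<alpha> * real_of_int n)" by (simp add: exp_step_def)

text \<open>
A factor that vanishes at \<open>w = p e^(\<alpha> k)\<close>.  The two normalisations keep it bounded away from the bulk
of these zeros: near \<open>0\<close> for \<open>k \<ge> 0\<close>, near infinity for \<open>k < 0\<close>.  With them the pole factors cost the
same power on the inner and on the outer circle.
\<close>

definition pole_factor :: "complex \<Rightarrow> int \<Rightarrow> complex \<Rightarrow> complex" where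
  "pole_factor p k w = (if k \<ge> 0 then 1 - w / (p * exp_step k) else 1 - p * exp_step k / w)"

text \<open>
The product of the pole factors with \<open>\<bar>k\<bar> \<le> M\<close> over \<open>w e^(-\<alpha> n) - p\<close>, with the common zero cancelled
when \<open>\<bar>n\<bar> \<le> M\<close>.
\<close>

definition cleared_factor :: "int \<Rightarrow> complex \<Rightarrow> int \<Rightarrow> complex \<Rightarrow> complex" where
  "cleared_factor M p n w =
     (if \<bar>n\<bar> \<le> M
      then (\<Prod>k\<in>{-M..M}-{n}. pole_factor p k w) * (if n \<ge> 0 then - 1 / p else exp_step n / w)
      else (\<Prod>k\<in>{-M..M}. pole_factor p k w) / (w / exp_step n - p))"

lemma cleared_factor_eq:
  assumes "w \<noteq> 0" "p \<noteq> 0" "w / exp_step n \<noteq> p"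
  shows "cleared_factor M p n w * (w / exp_step n - p) = (\<Prod>k\<in>{-M..M}. pole_factor p k w)"
proof (cases "\<bar>n\<bar> \<le> M")
  case True
  then have "n \<in> {-M..M}" by auto
  then have "(\<Prod>k\<in>{-M..M}. pole_factor p k w) = pole_factor p n w * (\<Prod>k\<in>{-M..M}-{n}. pole_factor p k w)"
    by (intro prod.remove) auto
  moreover have "(if n \<ge> 0 then - 1 / p else exp_step n / w) * (w / exp_step n - p) = pole_factor p n w"
    using assms by (auto simp: pole_factor_def field_simps)
  ultimately show ?thesis using True by (simp add: cleared_factor_def mult_ac)
next
  case False
  then show ?thesis using assms by (simp add: cleared_factor_def)
qed

text \<open>
The function \<open>\<tau>\<^sub>n\<close>, that is, \<open>e^(\<alpha> x^2 / 2) G (x - n)\<close> in the variable \<open>w = e^(\<alpha> x)\<close>, multiplied by all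
pole factors and by \<open>w^s\<close>.  The power \<open>w^s\<close> balances the inner against the outer circle.
\<close>

definition cleared_term :: "nat \<Rightarrow> int \<Rightarrow> int \<Rightarrow> complex \<Rightarrow> complex" where
  "cleared_term s M n w = w ^ s * (of_real (exp (- \<alpha> * (real_of_int n)\<^sup>2 / 2)) * w powi n)
                * (poly P (w / exp_step n) / l) * (\<Prod>j<q. cleared_factor M (om j) n w)"

text \<open>
The factor between the cleared term and the shift of the generator at a real point.  It does not
depend on the shift, which is why the quadrature weights do not depend on it either.
\<close>

definition node_factor :: "nat \<Rightarrow> int \<Rightarrow> real \<Rightarrow> complex" where
  "node_factor s M x = exp (of_real (\<alpha> * x)) ^ s * (\<Prod>j<q. \<Prod>k\<in>{-M..M}. pole_factor (om j) k (exp (of_real (\<alpha> * x))))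
      * of_real (exp (\<alpha> * x\<^sup>2 / 2))"

lemma exp_quotient_step: "exp (complex_of_real (\<alpha> * x)) / exp_step n = exp (of_real \<alpha> * of_real (x - of_int n))"
proof -
  have "exp (complex_of_real (\<alpha> * x)) / exp_step n = exp (complex_of_real (\<alpha> * x) - complex_of_real (\<alpha> * of_int n))"
    by (simp only: exp_step_def exp_of_real[symmetric] exp_diff)
  then show ?thesis
    by (simp only: of_real_mult of_real_diff of_real_of_int_eq right_diff_distrib)
qed

lemma cleared_term_real:
  "cleared_term s M n (exp (of_real (\<alpha> * x))) = node_factor s M x * G (of_real (x - of_int n))"
proof -
  define w where "w = exp (complex_of_real (\<alpha> * x))"
  define u where "u = exp (of_real \<alpha> * complex_of_real (x - of_int n))"
  have u: "w / exp_step n = u" unfolding w_def u_def by (rule exp_quotient_step)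
  have ur: "u = of_real (exp (\<alpha> * (x - of_int n)))"
    by (simp only: u_def exp_of_real[symmetric] of_real_mult)
  have une: "u - om j \<noteq> 0" if "j < q" for j
    using om[OF that, of "exp (\<alpha> * (x - of_int n))"] by (auto simp: ur)
  have Qu: "poly Q u = l * (\<Prod>j<q. u - om j)"
    by (simp add: Q poly_prod)
  have "cleared_factor M (om j) n w = (\<Prod>k\<in>{-M..M}. pole_factor (om j) k w) / (u - om j)" if "j < q" for j
  proof -
    have "cleared_factor M (om j) n w * (u - om j) = (\<Prod>k\<in>{-M..M}. pole_factor (om j) k w)"
      using cleared_factor_eq[of w "om j" n M] om_nz[OF that] une[OF that] unfolding u by (simp add: w_def)
    then show ?thesis using une[OF that] by (simp add: eq_divide_eq)
  qed
  then have ph: "(\<Prod>j<q. cleared_factor M (om j) n w) = (\<Prod>j<q. \<Prod>k\<in>{-M..M}. pole_factor (om j) k w) / (\<Prod>j<q. u - om j)"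
    by (simp add: prod_dividef)
  have "w powi n = of_real (exp (\<alpha> * x * of_int n))"
  proof -
    have "w = of_real (exp (\<alpha> * x))" by (simp only: w_def exp_of_real)
    then have "w powi n = of_real (exp (of_int n * (\<alpha> * x)))"
      by (simp only: of_real_power_int[symmetric] exp_power_int)
    then show ?thesis by (simp only: mult_ac)
  qed
  then have "of_real (exp (- \<alpha> * (real_of_int n)\<^sup>2 / 2)) * w powi n
     = complex_of_real (exp (- \<alpha> * (real_of_int n)\<^sup>2 / 2 + \<alpha> * x * of_int n))"
    by (simp flip: of_real_mult exp_add)
  also have "\<dots> = complex_of_real (exp (\<alpha> * x\<^sup>2 / 2 + (- \<alpha> * (x - of_int n)\<^sup>2 / 2)))"
    by (simp add: power2_eq_square field_simps)
  also have "\<dots> = complex_of_real (exp (\<alpha> * x\<^sup>2 / 2)) * exp (- of_real \<alpha> * of_real (x - of_int n) ^ 2 / 2)"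
  proof -
    have "complex_of_real (exp (- \<alpha> * (x - of_int n)\<^sup>2 / 2)) = exp (- of_real \<alpha> * of_real (x - of_int n) ^ 2 / 2)"
      unfolding exp_of_real[symmetric] by simp
    then show ?thesis by (simp only: exp_add of_real_mult)
  qed
  finally have ga: "of_real (exp (- \<alpha> * (real_of_int n)\<^sup>2 / 2)) * w powi n = \<dots>" .
  show ?thesis
    unfolding cleared_term_def node_factor_def w_def[symmetric] u ga ph G u_def[symmetric] Qu
    by simp
qed

lemma pole_factor_holomorphic: "p \<noteq> 0 \<Longrightarrow> pole_factor p k holomorphic_on - {0}"
  unfolding pole_factor_def[abs_def] by (cases "k \<ge> 0") (auto intro!: holomorphic_intros)

text \<open>
What clearing leaves: for \<open>\<bar>n\<bar> > M\<close> the poles of the \<open>n\<close>th shift are too far out to be in the annulus.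
\<close>

definition residual_poles :: "int \<Rightarrow> int \<Rightarrow> complex set" where
  "residual_poles M n = insert 0 (if \<bar>n\<bar> \<le> M then {} else (\<lambda>j. om j * exp_step n) ` {..<q})"

lemma finite_residual_poles [simp]: "finite (residual_poles M n)"
  by (simp add: residual_poles_def)

lemma cleared_term_holomorphic: "cleared_term s M n holomorphic_on - residual_poles M n"
proof -
  have "cleared_factor M (om j) n holomorphic_on - residual_poles M n" if j: "j < q" for j
  proof (cases "\<bar>n\<bar> \<le> M")
    case True
    have "(\<lambda>w. (\<Prod>k\<in>{-M..M}-{n}. pole_factor (om j) k w) * (if n \<ge> 0 then - 1 / om j else exp_step n / w)) holomorphic_on - {0}"
      using om_nz[OF j] by (cases "n \<ge> 0") (auto intro!: holomorphic_intros pole_factor_holomorphic)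
    moreover have "residual_poles M n = {0}" using True by (simp add: residual_poles_def)
    ultimately show ?thesis using True by (simp add: cleared_factor_def[abs_def])
  next
    case False
    have "w / exp_step n - om j \<noteq> 0" if "w \<in> - residual_poles M n" for w
      using that j False by (auto simp: residual_poles_def field_simps)
    moreover have "(\<lambda>w. (\<Prod>k\<in>{-M..M}. pole_factor (om j) k w)) holomorphic_on - residual_poles M n"
      using om_nz[OF j]
      by (intro holomorphic_intros holomorphic_on_subset[OF pole_factor_holomorphic]) (auto simp: residual_poles_def)
    ultimately show ?thesis using False by (auto simp: cleared_factor_def[abs_def] intro!: holomorphic_intros)
  qed
  then have c: "(\<lambda>w. \<Prod>j<q. cleared_factor M (om j) n w) holomorphic_on - residual_poles M n"
    by (intro holomorphic_on_prod) auto
  have b: "(\<lambda>w. poly P (w / exp_step n) / l) holomorphic_on - residual_poles M n"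
    unfolding poly_altdef using l by (intro holomorphic_intros) auto
  have "(\<lambda>w. w powi n) holomorphic_on - residual_poles M n"
    by (rule holomorphic_on_power_int) (auto simp: residual_poles_def)
  then have a: "(\<lambda>w. w ^ s * (of_real (exp (- \<alpha> * (real_of_int n)\<^sup>2 / 2)) * w powi n)) holomorphic_on - residual_poles M n"
    by (intro holomorphic_on_mult holomorphic_on_power holomorphic_on_ident holomorphic_on_const)
  show ?thesis
    unfolding cleared_term_def[abs_def] by (intro holomorphic_on_mult[OF holomorphic_on_mult] a b c)
qed

text \<open>
The size of the \<open>n\<close>th shift on the circle \<open>|w| = e^(\<alpha> t)\<close>, relative to \<open>e^(\<alpha> t^2 / 2)\<close>, is at most a
multiple of \<open>gauss_weight (t - n)\<close> once the poles are cleared.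
\<close>

definition gauss_weight :: "real \<Rightarrow> real" where
  "gauss_weight y = exp (- \<alpha> * y\<^sup>2 / 2 + \<alpha> * real (degree P) * \<bar>y\<bar>)"

definition coeff_norm :: real where "coeff_norm = (\<Sum>i\<le>degree P. cmod (coeff P i))"

lemma poly_P_bound:
  assumes "cmod u = exp (\<alpha> * y)"
  shows "cmod (poly P u) \<le> coeff_norm * exp (\<alpha> * real (degree P) * \<bar>y\<bar>)"
proof -
  have "cmod u ^ i \<le> exp (\<alpha> * real (degree P) * \<bar>y\<bar>)" if "i \<le> degree P" for i
  proof -
    have "real i * y \<le> real (degree P) * \<bar>y\<bar>"
      using that by (meson abs_ge_self abs_ge_zero mult_left_mono mult_right_mono of_nat_0_le_iff of_nat_mono order_trans)
    then have "\<alpha> * (real i * y) \<le> \<alpha> * (real (degree P) * \<bar>y\<bar>)"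
      using \<alpha> by simp
    then show ?thesis
      by (simp add: assms mult_ac flip: exp_of_nat_mult)
  qed
  then show ?thesis
    unfolding poly_altdef coeff_norm_def sum_distrib_right
    by (intro sum_norm_le) (simp add: norm_mult norm_power mult_left_mono)
qed

lemma coeff_norm_nonneg: "coeff_norm \<ge> 0" unfolding coeff_norm_def by (intro sum_nonneg) auto


text \<open>
Up to the factor \<open>\<alpha>\<close> and a bounded summand, this bounds the logarithm of the pole factor with index
\<open>k\<close> on the outer circle; on the inner circle the same function appears at \<open>-k\<close>.  Its sum \<open>L (L + 1) / 2\<close> over \<open>k\<close> is the price of
clearing one zero of \<open>Q\<close>.
\<close>

definition log_excess :: "nat \<Rightarrow> int \<Rightarrow> real" where
  "log_excess L k = (if k \<ge> 0 then max 0 (real L - real_of_int k) else 0)"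

lemma log_excess_nonneg [simp]: "log_excess L k \<ge> 0" by (simp add: log_excess_def)

lemma sum_log_excess:
  assumes "L \<le> M"
  shows "(\<Sum>k\<in>{-int M..int M}. log_excess L k) = real L * (real L + 1) / 2"
proof -
  have "(\<Sum>k\<in>{-int M..int M}. log_excess L k) = (\<Sum>k\<in>int ` {..L}. log_excess L k)"
  proof (rule sum.mono_neutral_right)
    have "i \<in> int ` {..L}" if "0 \<le> i" "i \<le> int L" for i
      using that by (intro image_eqI[of _ _ "nat i"]) auto
    then have "log_excess L i = 0" if "i \<notin> int ` {..L}" for i
      using that by (cases "i \<le> int L") (auto simp: log_excess_def)
    then show "\<forall>i\<in>{- int M..int M} - int ` {..L}. log_excess L i = 0" by blast
  qed (use assms in auto)
  also have "\<dots> = (\<Sum>k\<le>L. real L - real k)"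
    by (subst sum.reindex) (auto simp: log_excess_def)
  also have "\<dots> = real L * (real L + 1) / 2"
    by (induction L) (auto simp: sum.distrib sum_subtractf field_simps)
  finally show ?thesis .
qed

lemma sum_log_excess_minus:
  assumes "L \<le> M"
  shows "(\<Sum>k\<in>{-int M..int M}. log_excess L (- k)) = real L * (real L + 1) / 2"
proof -
  have "(\<Sum>k\<in>{-int M..int M}. log_excess L (- k)) = (\<Sum>k\<in>{-int M..int M}. log_excess L k)"
    by (rule sum.reindex_bij_witness[of _ uminus uminus]) auto
  then show ?thesis using sum_log_excess[OF assms] by simp
qed

end

section \<open>Size of the cleared shifts on two circles\<close>

text \<open>
The constant \<open>D\<close> compares all zeros of \<open>Q\<close> with \<open>1\<close>, and \<open>c0\<close> is the width of a collar: zeros whose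
index exceeds \<open>L\<close> by more than \<open>c0\<close> stay away from the annulus of logarithmic radius \<open>L\<close>.
\<close>

locale gauss_rational_const = gauss_rational +
  fixes D :: real and c0 :: nat
  assumes D: "\<And>j. j < q \<Longrightarrow> 1 + cmod (om j) \<le> D" "\<And>j. j < q \<Longrightarrow> 1 + 1 / cmod (om j) \<le> D" "1 \<le> D"
    and c0: "2 * D \<le> exp (\<alpha> * real c0)"
begin

lemma pole_factor_outer:
  assumes "j < q" "cmod w = exp (\<alpha> * real L)"
  shows "cmod (pole_factor (om j) k w) \<le> D * exp (\<alpha> * log_excess L k)"
proof (cases "k \<ge> 0")
  case True
  have "cmod (w / (om j * exp_step k)) = exp (\<alpha> * (real L - real_of_int k)) * (1 / cmod (om j))"
    using assms(2) by (simp add: norm_divide norm_mult norm_exp_step exp_diff right_diff_distrib)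
  also have "\<dots> \<le> exp (\<alpha> * log_excess L k) * (D - 1)"
    using D(2)[OF assms(1)] \<alpha> by (intro mult_mono) (auto simp: log_excess_def True)
  finally have "cmod (pole_factor (om j) k w) \<le> 1 + exp (\<alpha> * log_excess L k) * (D - 1)"
    using True norm_triangle_ineq4[of 1 "w / (om j * exp_step k)"] by (simp add: pole_factor_def)
  moreover have "1 \<le> exp (\<alpha> * log_excess L k)" using \<alpha> by simp
  ultimately show ?thesis by (simp add: algebra_simps del: one_le_exp_iff)
next
  case False
  have "\<alpha> * real_of_int k \<le> \<alpha> * real L" using \<alpha> False by (intro mult_left_mono) auto
  then have "exp (\<alpha> * real_of_int k) / exp (\<alpha> * real L) \<le> 1" by simp
  then have "cmod (om j) * (exp (\<alpha> * real_of_int k) / exp (\<alpha> * real L)) \<le> cmod (om j) * 1"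
    by (intro mult_left_mono) auto
  then have "cmod (om j * exp_step k / w) \<le> D - 1"
    using D(1)[OF assms(1)] assms(2) by (simp add: norm_divide norm_mult norm_exp_step)
  then show ?thesis
    using False norm_triangle_ineq4[of 1 "om j * exp_step k / w"] by (simp add: pole_factor_def log_excess_def)
qed

lemma pole_factor_inner:
  assumes "j < q" "cmod w = exp (- \<alpha> * real L)"
  shows "cmod (pole_factor (om j) k w) \<le> D * exp (\<alpha> * log_excess L (- k))"
proof (cases "k \<ge> 0")
  case False
  have "cmod (om j * exp_step k / w) = cmod (om j) * exp (\<alpha> * (real L + real_of_int k))"
  proof -
    have "cmod (om j * exp_step k / w) = cmod (om j) * (exp (\<alpha> * real_of_int k) / exp (- \<alpha> * real L))"
      by (simp only: norm_divide norm_mult norm_exp_step assms(2) times_divide_eq_right)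
    then show ?thesis by (simp add: distrib_left add.commute flip: exp_diff)
  qed
  also have "\<dots> \<le> (D - 1) * exp (\<alpha> * log_excess L (- k))"
    using D(1)[OF assms(1)] D(3) \<alpha> False by (intro mult_mono) (auto simp: log_excess_def)
  finally have "cmod (pole_factor (om j) k w) \<le> 1 + exp (\<alpha> * log_excess L (- k)) * (D - 1)"
    using False norm_triangle_ineq4[of 1 "om j * exp_step k / w"] by (simp add: pole_factor_def mult.commute)
  moreover have "1 \<le> exp (\<alpha> * log_excess L (- k))" using \<alpha> by simp
  ultimately show ?thesis by (simp add: algebra_simps del: one_le_exp_iff)
next
  case True
  have "- \<alpha> * real L \<le> \<alpha> * real_of_int k" using \<alpha> True
    by (metis minus_mult_left mult_nonneg_nonneg neg_le_0_iff_le of_int_0_le_iff of_nat_0_le_iff order_less_imp_le order_trans)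
  then have "exp (- \<alpha> * real L) / exp (\<alpha> * real_of_int k) \<le> 1" by simp
  then have "exp (- \<alpha> * real L) / exp (\<alpha> * real_of_int k) * (1 / cmod (om j)) \<le> 1 * (1 / cmod (om j))"
    by (intro mult_right_mono) auto
  then have "cmod (w / (om j * exp_step k)) \<le> D - 1"
    using D(2)[OF assms(1)] assms(2) by (simp add: norm_divide norm_mult norm_exp_step mult.commute)
  moreover have "D \<le> D * exp (\<alpha> * log_excess L (- k))" using D(3) \<alpha> by simp
  ultimately show ?thesis
    using True norm_triangle_ineq4[of 1 "w / (om j * exp_step k)"] by (simp add: pole_factor_def)
qed

lemma scaled_off_pole:
  assumes j: "j < q" and w: "exp (- \<alpha> * real L) \<le> cmod w" "cmod w \<le> exp (\<alpha> * real L)"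
    and n: "\<bar>n\<bar> > int (L + c0)"
  shows "1 / (2 * D) \<le> cmod (w / exp_step n - om j)"
proof (cases "n > 0")
  case True
  have "cmod (w / exp_step n) \<le> exp (\<alpha> * real L) / exp (\<alpha> * real_of_int n)"
    using w by (simp add: norm_divide norm_exp_step divide_right_mono)
  also have "\<dots> = exp (\<alpha> * (real L - real_of_int n))" by (simp add: exp_diff right_diff_distrib)
  also have "\<dots> \<le> exp (- (\<alpha> * real c0))"
  proof -
    have "real L - real_of_int n \<le> - real c0" using n True by linarith
    then have "\<alpha> * (real L - real_of_int n) \<le> \<alpha> * - real c0" using \<alpha> by (intro mult_left_mono) auto
    then show ?thesis by simp
  qed
  also have "\<dots> \<le> 1 / (2 * D)"
    using c0 D(3) by (simp add: exp_minus inverse_eq_divide frac_le)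
  finally have 1: "cmod (w / exp_step n) \<le> 1 / (2 * D)" .
  have "1 / D \<le> cmod (om j)"
  proof -
    have "1 / cmod (om j) \<le> D" using D(2)[OF j] by simp
    moreover have "0 < cmod (om j)" using om_nz[OF j] by simp
    ultimately show ?thesis using D(3) by (simp add: field_simps)
  qed
  then have "1 / (2 * D) + 1 / (2 * D) \<le> cmod (om j)" by simp
  then show ?thesis
    using 1 norm_triangle_ineq3[of "w / exp_step n" "om j"] by linarith
next
  case False
  have "2 * D \<le> exp (\<alpha> * real c0)" by (rule c0)
  also have "\<dots> \<le> exp (- \<alpha> * real L - \<alpha> * real_of_int n)"
  proof -
    have "real c0 \<le> - real L - real_of_int n" using n False by linarith
    then have "\<alpha> * real c0 \<le> \<alpha> * (- real L - real_of_int n)" using \<alpha> by (intro mult_left_mono) auto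
    then show ?thesis by (simp add: right_diff_distrib)
  qed
  also have "\<dots> = exp (- \<alpha> * real L) / exp (\<alpha> * real_of_int n)" by (simp add: exp_diff)
  also have "\<dots> \<le> cmod (w / exp_step n)"
    using w by (simp add: norm_divide norm_exp_step divide_right_mono)
  finally have 1: "2 * D \<le> cmod (w / exp_step n)" .
  have "1 / (2 * D) \<le> 1" using D(3) by simp
  then show ?thesis
    using 1 D(1)[OF j] D(3) norm_triangle_ineq3[of "w / exp_step n" "om j"] by linarith
qed

lemma prod_pole_factor_bound:
  assumes bd: "\<And>k. cmod (pole_factor p k w) \<le> D * exp (\<alpha> * f k)" "\<And>k. f k \<ge> (0::real)"
    and f: "(\<Sum>k\<in>{-M..M}. f k) = F" and K: "K \<subseteq> {-M..M}" and M: "M \<ge> 0"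
  shows "cmod (\<Prod>k\<in>K. pole_factor p k w) \<le> D ^ nat (2 * M + 1) * exp (\<alpha> * F)"
proof -
  have "cmod (\<Prod>k\<in>K. pole_factor p k w) \<le> (\<Prod>k\<in>K. D * exp (\<alpha> * f k))"
    unfolding prod_norm[symmetric] by (intro prod_mono) (use bd in auto)
  also have "\<dots> \<le> (\<Prod>k\<in>{-M..M}. D * exp (\<alpha> * f k))"
  proof (rule prod_mono2)
    show "1 \<le> D * exp (\<alpha> * f k)" for k
      using D(3) \<alpha> bd(2)[of k] mult_mono[of 1 D 1 "exp (\<alpha> * f k)"] by simp
    show "0 \<le> D * exp (\<alpha> * f k)" for k using D(3) by simp
  qed (use K in auto)
  also have "\<dots> = D ^ nat (2 * M + 1) * exp (\<alpha> * F)"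
    using M by (simp add: prod.distrib exp_sum[symmetric] sum_distrib_left[symmetric] f algebra_simps)
  finally show ?thesis .
qed

definition circle_bound :: "nat \<Rightarrow> real" where
  "circle_bound L = 2 * D * exp (\<alpha> * real L) * (D ^ (2 * (L + c0) + 1) * exp (\<alpha> * (real L * (real L + 1) / 2)))"

text \<open>
Since every bound on a pole factor is at least \<open>1\<close>, the bound on the full product also bounds the
product with one factor left out.
\<close>

lemma cleared_factor_bound:
  assumes j: "j < q" and t: "\<bar>t\<bar> = real L" and w: "cmod w = exp (\<alpha> * t)"
  shows "cmod (cleared_factor (int (L + c0)) (om j) n w) \<le> circle_bound L"
proof -
  let ?M = "int (L + c0)"
  define B where "B = D ^ (2 * (L + c0) + 1) * exp (\<alpha> * (real L * (real L + 1) / 2))"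
  \<comment> \<open>a bound for all partial products, hence for those with one factor cancelled\<close>
  have pr: "cmod (\<Prod>k\<in>K. pole_factor (om j) k w) \<le> B" if "K \<subseteq> {-?M..?M}" for K
  proof -
    have nat: "nat (2 * ?M + 1) = 2 * (L + c0) + 1" by simp
    from t consider "t = real L" | "t = - real L" by linarith
    then show ?thesis
    proof cases
      case 1
      show ?thesis
        using prod_pole_factor_bound[where f = "log_excess L", OF pole_factor_outer[OF j] log_excess_nonneg sum_log_excess that] w 1
        unfolding nat B_def by simp
    next
      case 2
      show ?thesis
        using prod_pole_factor_bound[where f = "\<lambda>k. log_excess L (- k)", OF pole_factor_inner[OF j] log_excess_nonneg sum_log_excess_minus that] w 2
        unfolding nat B_def by simp
    qed
  qed
  have B0: "B \<ge> 0" unfolding B_def using D(3) by simp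
  have e1: "1 \<le> exp (\<alpha> * real L)" using \<alpha> by simp
  have tL: "exp (- (\<alpha> * t)) \<le> exp (\<alpha> * real L)" "exp (- (\<alpha> * real L)) \<le> exp (\<alpha> * t)" "exp (\<alpha> * t) \<le> exp (\<alpha> * real L)"
  proof -
    have "\<alpha> * - t \<le> \<alpha> * real L" "\<alpha> * - real L \<le> \<alpha> * t" "\<alpha> * t \<le> \<alpha> * real L"
      using \<alpha> t by (intro mult_left_mono; linarith)+
    then show "exp (- (\<alpha> * t)) \<le> exp (\<alpha> * real L)" "exp (- (\<alpha> * real L)) \<le> exp (\<alpha> * t)" "exp (\<alpha> * t) \<le> exp (\<alpha> * real L)"
      by simp_all
  qed
  have one: "1 \<le> 2 * D * exp (\<alpha> * real L)" "exp (\<alpha> * real L) \<le> 2 * D * exp (\<alpha> * real L)" "2 * D \<le> 2 * D * exp (\<alpha> * real L)"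
    using mult_mono[of 1 "2 * D" 1 "exp (\<alpha> * real L)"] e1 D(3) by auto
  have "cmod (cleared_factor ?M (om j) n w) \<le> B * (2 * D * exp (\<alpha> * real L))"
  proof (cases "\<bar>n\<bar> \<le> ?M")
    case True
    have "cmod (if n \<ge> 0 then - 1 / om j else exp_step n / w) \<le> 2 * D * exp (\<alpha> * real L)"
    proof (cases "n \<ge> 0")
      case True
      have "1 / cmod (om j) \<le> 2 * D * exp (\<alpha> * real L)" using D(2)[OF j] one(3) D(3) by linarith
      then show ?thesis using True by (simp add: norm_divide)
    next
      case False
      have "cmod (exp_step n / w) = exp (\<alpha> * of_int n) * exp (- (\<alpha> * t))"
        by (simp add: norm_divide norm_exp_step w exp_minus field_simps)
      also have "\<dots> \<le> 1 * exp (\<alpha> * real L)"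
        using \<alpha> False tL by (intro mult_mono) (auto simp: mult_le_0_iff)
      finally have "cmod (exp_step n / w) \<le> 2 * D * exp (\<alpha> * real L)" using one(2) by linarith
      then show ?thesis using False by simp
    qed
    then have "cmod (\<Prod>k\<in>{- ?M..?M} - {n}. pole_factor (om j) k w) * cmod (if n \<ge> 0 then - 1 / om j else exp_step n / w)
        \<le> B * (2 * D * exp (\<alpha> * real L))"
      by (intro mult_mono pr B0) auto
    then show ?thesis using True by (simp only: cleared_factor_def if_True norm_mult)
  next
    case False
    have "1 / (2 * D) \<le> cmod (w / exp_step n - om j)"
      by (rule scaled_off_pole[OF j]) (use False tL w in auto)
    then have "cmod (\<Prod>k\<in>{- ?M..?M}. pole_factor (om j) k w) / cmod (w / exp_step n - om j) \<le> B / (1 / (2 * D))"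
      using D(3) by (intro frac_le pr B0) auto
    also have "\<dots> = B * (2 * D)" by simp
    also have "\<dots> \<le> B * (2 * D * exp (\<alpha> * real L))"
      by (intro mult_left_mono one B0)
    finally show ?thesis using False by (simp only: cleared_factor_def if_False norm_divide)
  qed
  then show ?thesis by (simp add: circle_bound_def B_def mult_ac)
qed

lemma circle_bound_nonneg: "circle_bound L \<ge> 0" using D(3) by (simp add: circle_bound_def)

text \<open>
The Gaussian factor is \<open>|e^(-\<alpha> n^2 / 2) w^n| = e^(\<alpha> t^2 / 2) e^(-\<alpha> (t - n)^2 / 2)\<close>, by completing the
square; the numerator and the cleared denominators follow from the previous estimates.
\<close>

lemma cleared_term_bound:
  assumes t: "\<bar>t\<bar> = real L" and w: "cmod w = exp (\<alpha> * t)"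
  shows "cmod (cleared_term s (int (L + c0)) n w)
    \<le> exp (\<alpha> * t * real s) * exp (\<alpha> * (real L)\<^sup>2 / 2) * gauss_weight (t - real_of_int n) * (coeff_norm / cmod l) * circle_bound L ^ q"
proof -
  have w0: "w \<noteq> 0" using w by auto
  have "cmod (w powi n) = exp (\<alpha> * t * real_of_int n)"
    by (simp add: norm_power_int w exp_power_int mult_ac)
  then have 1: "cmod (of_real (exp (- \<alpha> * (real_of_int n)\<^sup>2 / 2)) * w powi n)
      = exp (\<alpha> * (real L)\<^sup>2 / 2) * exp (- \<alpha> * (t - real_of_int n)\<^sup>2 / 2)"
  proof -
    have "t\<^sup>2 = (real L)\<^sup>2" using t by (metis power2_abs)
    then have "- \<alpha> * (real_of_int n)\<^sup>2 / 2 + \<alpha> * t * real_of_int n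
        = \<alpha> * (real L)\<^sup>2 / 2 + - \<alpha> * (t - real_of_int n)\<^sup>2 / 2"
      by (simp add: power2_eq_square field_simps)
    then show ?thesis
      using \<open>cmod (w powi n) = _\<close> by (simp add: norm_mult flip: exp_add)
  qed
  have "cmod (w / exp_step n) = exp (\<alpha> * (t - real_of_int n))"
    by (simp add: norm_divide w norm_exp_step right_diff_distrib exp_diff)
  then have 2: "cmod (poly P (w / exp_step n)) \<le> coeff_norm * exp (\<alpha> * real (degree P) * \<bar>t - real_of_int n\<bar>)"
    by (rule poly_P_bound)
  have 3: "cmod (\<Prod>j<q. cleared_factor (int (L + c0)) (om j) n w) \<le> circle_bound L ^ q"
  proof -
    have "cmod (\<Prod>j<q. cleared_factor (int (L + c0)) (om j) n w) \<le> (\<Prod>j<q. circle_bound L)"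
      unfolding prod_norm[symmetric] by (intro prod_mono conjI norm_ge_zero cleared_factor_bound[OF _ t w]) simp
    then show ?thesis by simp
  qed
  have "cmod (cleared_term s (int (L + c0)) n w) = exp (\<alpha> * t * real s) * (exp (\<alpha> * (real L)\<^sup>2 / 2) * exp (- \<alpha> * (t - real_of_int n)\<^sup>2 / 2))
      * (cmod (poly P (w / exp_step n)) / cmod l) * cmod (\<Prod>j<q. cleared_factor (int (L + c0)) (om j) n w)"
    unfolding cleared_term_def norm_mult[of "_ * _" "prod _ _"] norm_mult[of _ "_ / _"] norm_mult[of "w ^ s"] 1
    by (simp add: norm_divide norm_power w mult_ac flip: exp_of_nat_mult)
  also have "\<dots> \<le> exp (\<alpha> * t * real s) * (exp (\<alpha> * (real L)\<^sup>2 / 2) * exp (- \<alpha> * (t - real_of_int n)\<^sup>2 / 2))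
      * (coeff_norm * exp (\<alpha> * real (degree P) * \<bar>t - real_of_int n\<bar>) / cmod l) * circle_bound L ^ q"
    by (intro mult_mono divide_right_mono 2 3 order_refl mult_nonneg_nonneg divide_nonneg_nonneg coeff_norm_nonneg) auto
  also have "\<dots> = exp (\<alpha> * t * real s) * exp (\<alpha> * (real L)\<^sup>2 / 2) * gauss_weight (t - real_of_int n) * (coeff_norm / cmod l) * circle_bound L ^ q"
  proof -
    have "gauss_weight y = exp (- \<alpha> * y\<^sup>2 / 2) * exp (\<alpha> * real (degree P) * \<bar>y\<bar>)" for y
      by (simp only: gauss_weight_def exp_add)
    then show ?thesis by (simp add: mult_ac)
  qed
  finally show ?thesis .
qed

end

section \<open>Gain from the nodes\<close>

context gauss_rational_const
begin

definition kappa :: real where "kappa = 1 - exp (- \<alpha>)"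
definition rho :: real where "rho = 2 * exp \<alpha> / kappa"

lemma kappa: "0 < kappa" "kappa \<le> 1" using \<alpha> by (auto simp: kappa_def)
lemma rho: "rho > 0" using kappa by (simp add: rho_def)

text \<open>
With \<open>N\<close> nodes in each of the \<open>2 K\<close> cells of length \<open>T\<close>, the sum of \<open>L - \<bar>x\<bar>\<close> over the nodes on either
side of the origin is, up to a linear term, \<open>N\<close> times this number.
\<close>

definition node_exp :: "nat \<Rightarrow> nat \<Rightarrow> real" where
  "node_exp T K = real T * real K * (real K + 1) / 2"

lemma sum_Suc_real: "(\<Sum>m<n. real m + 1) = real n * (real n + 1) / 2"
  by (induction n) (simp_all add: field_simps)

lemma sum_int_half:
  fixes f :: "int \<Rightarrow> real"
  shows "(\<Sum>k\<in>{-int K..<int K}. f k) = (\<Sum>m<K. f (int m)) + (\<Sum>m<K. f (- int m - 1))"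
proof -
  have "{-int K..<int K} = {0..<int K} \<union> {-int K..<0}" by auto
  then have "(\<Sum>k\<in>{-int K..<int K}. f k) = (\<Sum>k\<in>{0..<int K}. f k) + (\<Sum>k\<in>{-int K..<0}. f k)"
    by (simp add: sum.union_disjoint)
  moreover have "(\<Sum>k\<in>{0..<int K}. f k) = (\<Sum>m<K. f (int m))"
    by (rule sum.reindex_bij_witness[of _ int nat]) auto
  moreover have "(\<Sum>k\<in>{-int K..<0}. f k) = (\<Sum>m<K. f (- int m - 1))"
    by (rule sum.reindex_bij_witness[of _ "\<lambda>m. - int m - 1" "\<lambda>k. nat (- k - 1)"]) auto
  ultimately show ?thesis by simp
qed

lemma prod_cells_le:
  fixes X :: "real set" and A :: "int \<Rightarrow> real set" and f g :: "real \<Rightarrow> real"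
  assumes X: "X = (\<Union>k\<in>{-int K..<int K}. A k)" and card: "\<And>k. k \<in> {-int K..<int K} \<Longrightarrow> card (A k) = N"
    and fin: "\<And>k. k \<in> {-int K..<int K} \<Longrightarrow> finite (A k)"
    and disj: "\<And>k k'. k \<noteq> k' \<Longrightarrow> A k \<inter> A k' = {}"
    and le: "\<And>k x. k \<in> {-int K..<int K} \<Longrightarrow> x \<in> A k \<Longrightarrow> 0 \<le> f x \<and> f x \<le> c * exp (h k) * g x"
    and c: "c \<ge> 0" and g: "\<And>x. x \<in> X \<Longrightarrow> 0 \<le> g x"
  shows "(\<Prod>x\<in>X. f x) \<le> c ^ (2 * K * N) * exp (real N * (\<Sum>k\<in>{-int K..<int K}. h k)) * (\<Prod>x\<in>X. g x)"
proof -
  have split: "(\<Prod>x\<in>X. F x) = (\<Prod>k\<in>{-int K..<int K}. \<Prod>x\<in>A k. F x)" for F :: "real \<Rightarrow> real"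
    unfolding X using fin disj by (intro prod.UNION_disjoint) auto
  have "(\<Prod>x\<in>X. f x) \<le> (\<Prod>k\<in>{-int K..<int K}. \<Prod>x\<in>A k. c * exp (h k) * g x)"
    unfolding split using le by (intro prod_mono conjI prod_nonneg) auto
  also have "\<dots> = (\<Prod>k\<in>{-int K..<int K}. (c ^ N * exp (real N * h k)) * (\<Prod>x\<in>A k. g x))"
    by (intro prod.cong refl) (simp add: prod.distrib card power_mult_distrib exp_of_nat_mult)
  also have "\<dots> = c ^ (2 * K * N) * exp (real N * (\<Sum>k\<in>{-int K..<int K}. h k)) * (\<Prod>x\<in>X. g x)"
  proof -
    have "card {-int K..<int K} = 2 * K" by simp
    then have "(\<Prod>k\<in>{-int K..<int K}. c ^ N) = c ^ (2 * K * N)"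
      by (simp only: prod_constant power_mult[symmetric] mult.commute mult.left_commute)
    moreover have "(\<Prod>k\<in>{-int K..<int K}. exp (real N * h k)) = exp (real N * (\<Sum>k\<in>{-int K..<int K}. h k))"
      by (simp add: exp_sum sum_distrib_left)
    ultimately show ?thesis unfolding split by (simp only: prod.distrib)
  qed
  finally show ?thesis .
qed

lemma real_cell_bounds:
  assumes "x \<in> {real_of_int k * real T..<(real_of_int k + 1) * real T}"
  shows "k \<ge> 0 \<Longrightarrow> 0 \<le> x" "k < 0 \<Longrightarrow> x < 0"
proof -
  show "0 \<le> x" if "k \<ge> 0"
    using assms that by (auto intro: order_trans[of 0 "real_of_int k * real T"])
  show "x < 0" if "k < 0"
  proof -
    have "(real_of_int k + 1) * real T \<le> 0" using that by (intro mult_nonpos_nonneg) auto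
    then show ?thesis using assms by auto
  qed
qed

text \<open>
Product of the growth of the cleared shifts and of the gain from the nodes, with \<open>L = (K + 1) T\<close>.
\<close>

definition error_amplitude :: "nat \<Rightarrow> nat \<Rightarrow> nat \<Rightarrow> real" where
  "error_amplitude T N K = 1 / kappa * exp (\<alpha> * (real ((K + 1) * T))\<^sup>2 / 2) * (coeff_norm / cmod l) * circle_bound ((K + 1) * T) ^ q
     * (rho ^ (2 * K * N) * exp (- \<alpha> * real N * node_exp T K))"

lemma error_amplitude_nonneg: "error_amplitude T N K \<ge> 0"
  using kappa rho coeff_norm_nonneg circle_bound_nonneg by (simp add: error_amplitude_def)

text \<open>
A crude bound for the quadrature weights; it matters only that it does not involve the node set.
\<close>

definition weight_cap :: "real \<Rightarrow> nat \<Rightarrow> nat \<Rightarrow> nat \<Rightarrow> real" where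
  "weight_cap \<delta> T N K = (let L = (K + 1) * T in
     exp (\<alpha> * real L) ^ (K * N) * ((D * exp (\<alpha> * real L)) ^ (2 * (L + c0) + 1)) ^ q * exp (\<alpha> * (real L)\<^sup>2 / 2)
      * max 1 (2 * exp \<alpha> * exp (\<alpha> * real L) / (\<alpha> * \<delta> * exp (- \<alpha> * real L))) ^ (2 * K * N))"

lemma weight_cap_nonneg: "weight_cap \<delta> T N K \<ge> 0"
  using D(3) by (simp add: weight_cap_def Let_def)

text \<open>
The logarithm is a quadratic polynomial in \<open>K\<close>.  The growth contributes the leading coefficient
\<open>\<alpha> (q + 1) T^2 / 2\<close> and the nodes contribute \<open>-\<alpha> N T / 2\<close>, so more than \<open>q + 1\<close> nodes per unit length
make it negative.  The factor \<open>Z ^ \<dots>\<close> has only linear logarithm; it absorbs the normalisation at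
the evaluation point.
\<close>

lemma error_amplitude_small:
  assumes T: "T \<ge> 1" and N: "N \<ge> (q + 1) * T + 1" and Z: "Z > 0" and \<eta>: "\<eta> > 0"
  shows "\<exists>K\<ge>1. error_amplitude T N K * Z ^ (2 * ((K + 1) * T + c0) + 1) \<le> \<eta>"
proof -
  define t where "t = real T"
  define Lx where "Lx x = (x + 1) * t" for x :: real
  define pol where "pol x = \<alpha> * (Lx x)\<^sup>2 / 2
      + real q * (ln (2 * D) + \<alpha> * Lx x + (2 * (Lx x + real c0) + 1) * ln D + \<alpha> * (Lx x * (Lx x + 1) / 2))
      + 2 * x * real N * ln rho - \<alpha> * real N * (t * x * (x + 1) / 2)
      + (2 * (Lx x + real c0) + 1) * ln Z" for x :: real
  \<comment> \<open>the leading coefficient; its sign is where the number of nodes enters\<close>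
  define c2 where "c2 = \<alpha> * t * (t * (1 + real q) - real N) / 2"
  define c1 where "c1 = pol 1 - pol 0 - c2"
  define c where "c = pol 0"
  have "real N \<ge> real ((q + 1) * T + 1)" using N by (simp only: of_nat_le_iff)
  then have "t * (1 + real q) - real N < 0" by (simp add: t_def algebra_simps)
  then have c2: "c2 < 0" using \<alpha> T by (simp add: c2_def t_def mult_pos_neg divide_neg_pos)
  have pol: "pol x = c2 * x\<^sup>2 + c1 * x + c" for x
    unfolding c1_def c_def pol_def c2_def Lx_def by (simp add: power2_eq_square) (simp add: field_simps)
  have Dp: "D > 0" using D(3) by simp
  have powln: "y ^ n = exp (real n * ln y)" if "y > 0" for y :: real and n
    using that by (simp add: exp_of_nat_mult)
  have eq: "error_amplitude T N K * Z ^ (2 * ((K + 1) * T + c0) + 1) = 1 / kappa * (coeff_norm / cmod l) * exp (pol (real K))" for K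
  proof -
    define L where "L = (K + 1) * T"
    have Lr: "Lx (real K) = real L" by (simp add: Lx_def L_def t_def algebra_simps)
    have "circle_bound L = exp (ln (2 * D) + \<alpha> * real L + (2 * (real L + real c0) + 1) * ln D + \<alpha> * (real L * (real L + 1) / 2))"
      unfolding circle_bound_def powln[OF Dp] using Dp by (simp add: exp_add)
    then have "circle_bound L ^ q = exp (real q * (ln (2 * D) + \<alpha> * real L + (2 * (real L + real c0) + 1) * ln D + \<alpha> * (real L * (real L + 1) / 2)))"
      by (simp only: exp_of_nat_mult)
    moreover have "rho ^ (2 * K * N) = exp (2 * real K * real N * ln rho)"
      unfolding powln[OF rho] by simp
    moreover have "Z ^ (2 * (L + c0) + 1) = exp ((2 * (real L + real c0) + 1) * ln Z)"
      unfolding powln[OF Z] by (simp add: algebra_simps)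
    moreover have "exp (- \<alpha> * real N * node_exp T K) = exp (- (\<alpha> * real N * (t * real K * (real K + 1) / 2)))"
      by (simp add: node_exp_def t_def)
    ultimately show ?thesis
      unfolding error_amplitude_def L_def[symmetric] pol_def Lr
      by (simp only: exp_add exp_diff exp_minus divide_inverse mult_ac)
  qed
  have "(\<lambda>K::nat. 1 / kappa * (coeff_norm / cmod l) * exp (c2 * (real K)\<^sup>2 + c1 * real K + c)) \<longlonglongrightarrow> 0"
  proof (rule tendsto_mult_right_zero)
    show "(\<lambda>K::nat. exp (c2 * (real K)\<^sup>2 + c1 * real K + c)) \<longlonglongrightarrow> 0"
      using c2 by real_asymp
  qed
  then have "\<forall>\<^sub>F K in sequentially. 1 / kappa * (coeff_norm / cmod l) * exp (c2 * (real K)\<^sup>2 + c1 * real K + c) < \<eta>"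
    using \<eta> by (rule order_tendstoD)
  then have "\<forall>\<^sub>F K in sequentially. K \<ge> 1 \<and> error_amplitude T N K * Z ^ (2 * ((K + 1) * T + c0) + 1) \<le> \<eta>"
    using eventually_ge_at_top[of 1] unfolding eq pol by eventually_elim auto
  then show ?thesis
    by (auto dest!: eventually_happens)
qed

context
  fixes T K N L :: nat and A :: "int \<Rightarrow> real set" and X :: "real set" and w0 :: complex
  assumes T: "T \<ge> 1" and K: "K \<ge> 1" and L: "L = (K + 1) * T"
    and A: "\<And>k. A k \<subseteq> {real_of_int k * real T..<(real_of_int k + 1) * real T}"
    and card: "\<And>k. card (A k) = N" and finA: "\<And>k. finite (A k)"
    and X: "X = (\<Union>k\<in>{-int K..<int K}. A k)"
    and w0: "1 \<le> cmod w0" "cmod w0 \<le> exp \<alpha>"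
begin

lemma A_disj: "k \<noteq> k' \<Longrightarrow> A k \<inter> A k' = {}"
proof -
  have *: "False" if "x \<in> A k" "x \<in> A k'" "k < k'" for x k k'
  proof -
    have "(real_of_int k + 1) * real T \<le> real_of_int k' * real T"
      using that(3) by (intro mult_right_mono) auto
    then show False using that A[of k] A[of k'] by fastforce
  qed
  show "k \<noteq> k' \<Longrightarrow> A k \<inter> A k' = {}"
    using *[of _ k k'] *[of _ k' k] by (auto simp: neq_iff)
qed

lemma X_bounds: assumes "x \<in> X" shows "- (real K * real T) \<le> x" "x < real K * real T"
proof -
  obtain k where k: "k \<in> {-int K..<int K}" "x \<in> A k" using assms X by auto
  have "- real K * real T \<le> real_of_int k * real T" "(real_of_int k + 1) * real T \<le> real K * real T"
    using k(1) mult_right_mono[of "- real K" "real_of_int k" "real T"] mult_right_mono[of "real_of_int k + 1" "real K" "real T"]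
    by auto
  then show "- (real K * real T) \<le> x" "x < real K * real T" using k(2) A[of k] by auto
qed

lemma L_real: "real L = real K * real T + real T" by (simp add: L algebra_simps)

lemma X_abs: "x \<in> X \<Longrightarrow> \<bar>x\<bar> \<le> real L - 1"
  using X_bounds[of x] T L_real by linarith

lemma w0_node:
  assumes "b = exp (\<alpha> * x)"
  shows "cmod (w0 - of_real b) \<le> 2 * exp \<alpha> * exp (\<alpha> * max 0 x)"
proof -
  have "cmod (w0 - of_real b) \<le> exp \<alpha> + exp (\<alpha> * x)"
    using norm_triangle_ineq4[of w0 "of_real b"] w0 assms by simp
  moreover have "exp \<alpha> \<le> exp \<alpha> * exp (\<alpha> * max 0 x)" using \<alpha> by simp
  moreover have "exp (\<alpha> * x) \<le> exp (\<alpha> * max 0 x)" using \<alpha> by simp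
  moreover have "exp (\<alpha> * max 0 x) \<le> exp \<alpha> * exp (\<alpha> * max 0 x)" using \<alpha> by simp
  ultimately show ?thesis by linarith
qed

text \<open>
Cell by cell comparison of \<open>|w0 - b|\<close> with \<open>|z - b|\<close> for the nodes \<open>b\<close>.  The hypotheses isolate what
differs between the two circles.
\<close>

lemma circle_ratio:
  assumes h: "\<And>k x. k \<in> {-int K..<int K} \<Longrightarrow> x \<in> A k \<Longrightarrow>
      kappa * exp (\<alpha> * max 0 x) \<le> exp (h k) * cmod (z - of_real (exp (\<alpha> * x)))"
    and sum: "cmod z ^ (K * N) * exp (real N * (\<Sum>k\<in>{-int K..<int K}. h k)) = exp (- \<alpha> * real N * node_exp T K)"
  shows "cmod z ^ (K * N) * (\<Prod>x\<in>X. cmod (w0 - of_real (exp (\<alpha> * x))))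
    \<le> rho ^ (2 * K * N) * exp (- \<alpha> * real N * node_exp T K) * (\<Prod>x\<in>X. cmod (z - of_real (exp (\<alpha> * x))))"
proof -
  have "(\<Prod>x\<in>X. cmod (w0 - of_real (exp (\<alpha> * x))))
     \<le> rho ^ (2 * K * N) * exp (real N * (\<Sum>k\<in>{-int K..<int K}. h k)) * (\<Prod>x\<in>X. cmod (z - of_real (exp (\<alpha> * x))))"
  proof (rule prod_cells_le[OF X card finA A_disj])
    fix k x assume k: "k \<in> {-int K..<int K}" and x: "x \<in> A k"
    have "cmod (w0 - of_real (exp (\<alpha> * x))) \<le> 2 * exp \<alpha> * exp (\<alpha> * max 0 x)"
      by (rule w0_node) simp
    also have "\<dots> = rho * (kappa * exp (\<alpha> * max 0 x))"
      using kappa by (simp add: rho_def)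
    also have "\<dots> \<le> rho * (exp (h k) * cmod (z - of_real (exp (\<alpha> * x))))"
      using rho by (intro mult_left_mono h k x) auto
    finally show "0 \<le> cmod (w0 - of_real (exp (\<alpha> * x))) \<and>
       cmod (w0 - of_real (exp (\<alpha> * x))) \<le> rho * exp (h k) * cmod (z - of_real (exp (\<alpha> * x)))"
      by (simp add: mult.assoc)
  qed (use rho in auto)
  then have "cmod z ^ (K * N) * (\<Prod>x\<in>X. cmod (w0 - of_real (exp (\<alpha> * x))))
     \<le> cmod z ^ (K * N) * (rho ^ (2 * K * N) * exp (real N * (\<Sum>k\<in>{-int K..<int K}. h k)) * (\<Prod>x\<in>X. cmod (z - of_real (exp (\<alpha> * x)))))"
    by (intro mult_left_mono) auto
  also have "\<dots> = rho ^ (2 * K * N) * (cmod z ^ (K * N) * exp (real N * (\<Sum>k\<in>{-int K..<int K}. h k))) * (\<Prod>x\<in>X. cmod (z - of_real (exp (\<alpha> * x))))"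
    by (simp only: mult_ac)
  finally show ?thesis unfolding sum .
qed

text \<open>
On the outer circle \<open>|z - b|\<close> has size \<open>e^(\<alpha> L)\<close> for every node.  The power \<open>|z|^(K N)\<close> compensates for
the nodes to the left of the origin, and the nodes to the right produce the gain.
\<close>

lemma outer_ratio:
  assumes z: "cmod z = exp (\<alpha> * real L)"
  shows "cmod z ^ (K * N) * (\<Prod>x\<in>X. cmod (w0 - of_real (exp (\<alpha> * x))))
    \<le> rho ^ (2 * K * N) * exp (- \<alpha> * real N * node_exp T K) * (\<Prod>x\<in>X. cmod (z - of_real (exp (\<alpha> * x))))"
proof -
  define h where "h k = (if k \<ge> 0 then \<alpha> * ((real_of_int k + 1) * real T - real L) else - \<alpha> * real L)" for k
  show ?thesis
  proof (rule circle_ratio[where h = h])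
    fix k x assume k: "k \<in> {-int K..<int K}" and x: "x \<in> A k"
    have xX: "x \<in> X" using k x X by auto
    have "\<alpha> * x \<le> \<alpha> * (real L - 1)" using X_abs[OF xX] \<alpha> by (intro mult_left_mono) auto
    then have "exp (\<alpha> * x) \<le> exp (\<alpha> * real L) * exp (- \<alpha>)"
      by (simp add: right_diff_distrib flip: exp_add)
    moreover have "cmod z - exp (\<alpha> * x) \<le> cmod (z - of_real (exp (\<alpha> * x)))"
      using norm_triangle_ineq2[of z "of_real (exp (\<alpha> * x))"] by simp
    ultimately have 1: "kappa * exp (\<alpha> * real L) \<le> cmod (z - of_real (exp (\<alpha> * x)))"
      using z by (simp add: kappa_def algebra_simps)
    have "max 0 x - real L \<le> (if k \<ge> 0 then (real_of_int k + 1) * real T - real L else - real L)"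
      using real_cell_bounds[of x k T] x A[of k] by auto
    then have "\<alpha> * (max 0 x - real L) \<le> \<alpha> * (if k \<ge> 0 then (real_of_int k + 1) * real T - real L else - real L)"
      using \<alpha> by (intro mult_left_mono) auto
    also have "\<dots> = h k" by (simp add: h_def)
    finally have "exp (\<alpha> * max 0 x) \<le> exp (h k) * exp (\<alpha> * real L)"
      by (simp add: right_diff_distrib flip: exp_add)
    then have "kappa * exp (\<alpha> * max 0 x) \<le> kappa * (exp (h k) * exp (\<alpha> * real L))"
      using kappa by (intro mult_left_mono) auto
    also have "\<dots> = exp (h k) * (kappa * exp (\<alpha> * real L))" by (simp only: mult.left_commute)
    also have "\<dots> \<le> exp (h k) * cmod (z - of_real (exp (\<alpha> * x)))" by (intro mult_left_mono 1) simp
    finally show "kappa * exp (\<alpha> * max 0 x) \<le> exp (h k) * cmod (z - of_real (exp (\<alpha> * x)))" .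
  next
    have "(\<Sum>k\<in>{-int K..<int K}. h k) = (\<Sum>m<K. \<alpha> * ((real m + 1) * real T - real L)) + (\<Sum>m<K. - \<alpha> * real L)"
      unfolding sum_int_half by (simp add: h_def)
    also have "(\<Sum>m<K. \<alpha> * ((real m + 1) * real T - real L)) = \<alpha> * (real T * real K * (real K + 1) / 2 - real K * real L)"
    proof -
      have "(\<Sum>m<K. \<alpha> * ((real m + 1) * real T - real L)) = \<alpha> * ((\<Sum>m<K. real m + 1) * real T - real K * real L)"
        unfolding sum_distrib_left[symmetric] sum_subtractf sum_distrib_right[symmetric] by simp
      then show ?thesis unfolding sum_Suc_real by (simp add: mult_ac)
    qed
    finally have "(\<Sum>k\<in>{-int K..<int K}. h k) = \<alpha> * (real T * real K * (real K + 1) / 2) - 2 * \<alpha> * real K * real L"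
      by (simp add: algebra_simps)
    also have "\<dots> = - \<alpha> * node_exp T K - \<alpha> * real K * real L"
      unfolding L_real node_exp_def by (simp add: field_simps)
    finally have "real N * (\<Sum>k\<in>{-int K..<int K}. h k) = real N * (- \<alpha> * node_exp T K - \<alpha> * real K * real L)"
      by simp
    moreover have "cmod z ^ (K * N) = exp (\<alpha> * real K * real N * real L)"
      by (simp add: z mult_ac flip: exp_of_nat_mult)
    ultimately show "cmod z ^ (K * N) * exp (real N * (\<Sum>k\<in>{-int K..<int K}. h k)) = exp (- \<alpha> * real N * node_exp T K)"
      by (simp add: algebra_simps flip: exp_add)
  qed
qed

text \<open>
On the inner circle \<open>|z - b|\<close> has size \<open>|b|\<close>.  Only the nodes to the left of the origin lose, and the
power \<open>|z|^(K N)\<close> makes up for twice this loss.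
\<close>

lemma inner_ratio:
  assumes z: "cmod z = exp (- \<alpha> * real L)"
  shows "cmod z ^ (K * N) * (\<Prod>x\<in>X. cmod (w0 - of_real (exp (\<alpha> * x))))
    \<le> rho ^ (2 * K * N) * exp (- \<alpha> * real N * node_exp T K) * (\<Prod>x\<in>X. cmod (z - of_real (exp (\<alpha> * x))))"
proof -
  define h where "h k = (if k \<ge> 0 then 0 else \<alpha> * (- real_of_int k * real T))" for k
  show ?thesis
  proof (rule circle_ratio[where h = h])
    fix k x assume k: "k \<in> {-int K..<int K}" and x: "x \<in> A k"
    have xX: "x \<in> X" using k x X by auto
    have "\<alpha> * (- real L) \<le> \<alpha> * (x - 1)" using X_abs[OF xX] \<alpha> by (intro mult_left_mono) auto
    then have "exp (- \<alpha> * real L) \<le> exp (\<alpha> * x) * exp (- \<alpha>)"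
      by (simp add: right_diff_distrib flip: exp_add)
    moreover have "exp (\<alpha> * x) - cmod z \<le> cmod (z - of_real (exp (\<alpha> * x)))"
      using norm_triangle_ineq2[of "of_real (exp (\<alpha> * x))" z] by (simp add: norm_minus_commute)
    ultimately have 1: "kappa * exp (\<alpha> * x) \<le> cmod (z - of_real (exp (\<alpha> * x)))"
      using z by (simp add: kappa_def algebra_simps)
    have "max 0 x - x \<le> (if k \<ge> 0 then 0 else - real_of_int k * real T)"
    proof -
      have xk: "x \<in> {real_of_int k * real T..<(real_of_int k + 1) * real T}" using x A[of k] by auto
      show ?thesis
        using real_cell_bounds[OF xk] xk by (cases "k \<ge> 0") (simp_all add: max_def)
    qed
    then have "\<alpha> * (max 0 x - x) \<le> \<alpha> * (if k \<ge> 0 then 0 else - real_of_int k * real T)"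
      using \<alpha> by (intro mult_left_mono) auto
    also have "\<dots> = h k" by (simp add: h_def)
    finally have "exp (\<alpha> * max 0 x) \<le> exp (h k) * exp (\<alpha> * x)"
      by (simp add: right_diff_distrib flip: exp_add)
    then have "kappa * exp (\<alpha> * max 0 x) \<le> kappa * (exp (h k) * exp (\<alpha> * x))"
      using kappa by (intro mult_left_mono) auto
    also have "\<dots> = exp (h k) * (kappa * exp (\<alpha> * x))" by (simp only: mult.left_commute)
    also have "\<dots> \<le> exp (h k) * cmod (z - of_real (exp (\<alpha> * x)))" by (intro mult_left_mono 1) simp
    finally show "kappa * exp (\<alpha> * max 0 x) \<le> exp (h k) * cmod (z - of_real (exp (\<alpha> * x)))" .
  next
    have "(\<Sum>k\<in>{-int K..<int K}. h k) = (\<Sum>m<K. \<alpha> * ((real m + 1) * real T))"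
      unfolding sum_int_half by (simp add: h_def algebra_simps)
    also have "\<dots> = \<alpha> * (real T * real K * (real K + 1) / 2)"
      unfolding sum_distrib_left[symmetric] sum_distrib_right[symmetric] sum_Suc_real by (simp add: mult_ac)
    also have "\<dots> = - \<alpha> * node_exp T K + \<alpha> * real K * real L"
      unfolding L_real node_exp_def by (simp add: field_simps)
    finally have "real N * (\<Sum>k\<in>{-int K..<int K}. h k) = real N * (- \<alpha> * node_exp T K + \<alpha> * real K * real L)"
      by simp
    moreover have "cmod z ^ (K * N) = exp (- \<alpha> * real K * real N * real L)"
      by (simp add: z mult_ac flip: exp_of_nat_mult)
    ultimately show "cmod z ^ (K * N) * exp (real N * (\<Sum>k\<in>{-int K..<int K}. h k)) = exp (- \<alpha> * real N * node_exp T K)"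
      by (simp add: algebra_simps flip: exp_add)
  qed
qed

definition weight :: "real \<Rightarrow> complex" where
  "weight x = node_factor (K * N) (int (L + c0)) x
     * (\<Prod>y\<in>X-{x}. (w0 - of_real (exp (\<alpha> * y))) / (of_real (exp (\<alpha> * x)) - of_real (exp (\<alpha> * y))))"

lemma finite_X: "finite X" using X finA by simp

lemma card_X: "card X \<le> 2 * K * N"
proof -
  have "card X \<le> (\<Sum>k\<in>{-int K..<int K}. card (A k))"
    unfolding X by (rule card_UN_le) simp
  also have "\<dots> = card {-int K..<int K} * N" by (simp only: card sum_constant of_nat_id)
  also have "card {-int K..<int K} = 2 * K" by simp
  finally show ?thesis .
qed

lemma L_ge_2: "real L \<ge> 2"
proof -
  have "2 * 1 \<le> (K + 1) * T" using T K by (intro mult_le_mono) auto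
  then have "2 \<le> L" by (simp add: L)
  then show ?thesis by simp
qed

text \<open>
Lagrange interpolation of the cleared term at the nodes, with its error estimated on the circles
\<open>|w| = e^(\<alpha> L)\<close> and \<open>|w| = e^(-\<alpha> L)\<close>.
\<close>

lemma core_approx:
  "cmod (cleared_term (K * N) (int (L + c0)) n w0 - (\<Sum>x\<in>X. weight x * G (of_real (x - of_int n))))
    \<le> error_amplitude T N K * (gauss_weight (real L - real_of_int n) + gauss_weight (- real L - real_of_int n))"
proof -
  define b where "b x = complex_of_real (exp (\<alpha> * x))" for x
  define U where "U = exp (\<alpha> * (real L)\<^sup>2 / 2) * (coeff_norm / cmod l) * circle_bound L ^ q"
  define V where "V = rho ^ (2 * K * N) * exp (- \<alpha> * real N * node_exp T K)"
  have error_amplitude: "error_amplitude T N K = 1 / kappa * U * V" by (simp add: error_amplitude_def U_def V_def L)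
  have U0: "U \<ge> 0" unfolding U_def using coeff_norm_nonneg circle_bound_nonneg by simp
  have kap0: "gauss_weight y \<ge> 0" for y by (simp add: gauss_weight_def)
  have inj: "inj_on b X" using \<alpha> by (auto simp: b_def inj_on_def)
  have reind: "(\<Prod>a\<in>b ` X. cmod (z - a)) = (\<Prod>x\<in>X. cmod (z - b x))" for z
    by (subst prod.reindex[OF inj]) simp
  let ?g = "cleared_term (K * N) (int (L + c0)) n"
  let ?r = "exp (- \<alpha> * real L)" and ?R = "exp (\<alpha> * real L)"
  have aL: "\<alpha> * 2 \<le> \<alpha> * real L" using L_ge_2 \<alpha> by (intro mult_left_mono) auto
  have step: "\<rho> * cmod (?g z) * (\<Prod>a\<in>b ` X. cmod (w0 - a)) \<le> (error_amplitude T N K * gauss_weight (t - real_of_int n)) * (cmod (z - w0) * (\<Prod>a\<in>b ` X. cmod (z - a)))"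
    if \<rho>: "0 \<le> \<rho>" "\<rho> * kappa \<le> cmod (z - w0)" and t: "\<bar>t\<bar> = real L" "cmod z = exp (\<alpha> * t)"
      and ratio: "cmod z ^ (K * N) * (\<Prod>x\<in>X. cmod (w0 - b x)) \<le> V * (\<Prod>x\<in>X. cmod (z - b x))"
    for \<rho> z t
  proof -
    have "cmod (?g z) \<le> cmod z ^ (K * N) * (U * gauss_weight (t - real_of_int n))"
      using cleared_term_bound[OF t, of "K * N" n] t(2) by (simp add: U_def mult_ac flip: exp_of_nat_mult)
    then have "\<rho> * cmod (?g z) * (\<Prod>x\<in>X. cmod (w0 - b x))
        \<le> \<rho> * (cmod z ^ (K * N) * (U * gauss_weight (t - real_of_int n))) * (\<Prod>x\<in>X. cmod (w0 - b x))"
      using \<rho> by (intro mult_right_mono mult_left_mono prod_nonneg) auto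
    also have "\<dots> = \<rho> * (U * gauss_weight (t - real_of_int n)) * (cmod z ^ (K * N) * (\<Prod>x\<in>X. cmod (w0 - b x)))"
      by (simp add: mult_ac)
    also have "\<dots> \<le> (cmod (z - w0) / kappa) * (U * gauss_weight (t - real_of_int n)) * (V * (\<Prod>x\<in>X. cmod (z - b x)))"
    proof (rule mult_mono[OF mult_right_mono ratio])
      show "\<rho> \<le> cmod (z - w0) / kappa" using \<rho>(2) kappa(1) by (simp add: field_simps)
    qed (use U0 kap0 kappa in \<open>auto intro!: mult_nonneg_nonneg prod_nonneg\<close>)
    finally show ?thesis unfolding reind error_amplitude by (simp add: mult_ac)
  qed
  have "cmod (?g w0 - (\<Sum>a\<in>b ` X. ?g a * (\<Prod>c\<in>b ` X-{a}. (w0 - c) / (a - c))))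
     \<le> error_amplitude T N K * gauss_weight (real L - real_of_int n) + error_amplitude T N K * gauss_weight (- real L - real_of_int n)"
  proof (rule annulus_lagrange_bound[where r = ?r and R = ?R and X = "residual_poles (int (L + c0)) n"])
    show "0 < ?r" by simp
    show "?r < ?R" using aL \<alpha> by simp
    show "cmod z < ?r \<or> ?R < cmod z" if z: "z \<in> residual_poles (int (L + c0)) n" for z
    proof (cases "z = 0")
      case False
      then obtain j where j: "j < q" "z = om j * exp_step n" "\<bar>n\<bar> > int (L + c0)"
        using z by (auto simp: residual_poles_def split: if_splits)
      show ?thesis
      proof (rule ccontr)
        assume "\<not> ?thesis"
        then have "1 / (2 * D) \<le> cmod (z / exp_step n - om j)"
          by (intro scaled_off_pole[OF j(1) _ _ j(3)]) auto
        then show False using j(2) D(3) by simp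
      qed
    qed simp
    show "?g holomorphic_on - residual_poles (int (L + c0)) n" by (rule cleared_term_holomorphic)
    show "finite (b ` X)" using finite_X by simp
    show "?r < cmod z \<and> cmod z < ?R" if "z \<in> b ` X" for z
    proof -
      obtain x where x: "x \<in> X" "z = b x" using \<open>z \<in> b ` X\<close> by auto
      have "\<alpha> * x < \<alpha> * real L" "\<alpha> * - real L < \<alpha> * x"
        using X_abs[OF x(1)] \<alpha> by (intro mult_strict_left_mono; linarith)+
      then show ?thesis using x by (simp add: b_def)
    qed
    have "?r < 1" using aL \<alpha> by simp
    then show "?r < cmod w0" using w0 by linarith
    have "exp \<alpha> < ?R" using aL \<alpha> by simp
    then show "cmod w0 < ?R" using w0 by linarith
    have ea: "exp \<alpha> \<le> ?R * exp (- \<alpha>)" "?r \<le> exp (- \<alpha>)" "?r \<le> 1"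
      using aL \<alpha> by (simp_all flip: exp_add)
    show "?R * cmod (?g z) * (\<Prod>a\<in>b ` X. cmod (w0 - a)) \<le> (error_amplitude T N K * gauss_weight (real L - real_of_int n)) * (cmod (z - w0) * (\<Prod>a\<in>b ` X. cmod (z - a)))"
      if z: "cmod z = ?R" for z
    proof (rule step)
      have "cmod z - cmod w0 \<le> cmod (z - w0)" by (rule norm_triangle_ineq2)
      then show "?R * kappa \<le> cmod (z - w0)"
        using z w0 ea(1) by (simp add: kappa_def right_diff_distrib)
      show "cmod z ^ (K * N) * (\<Prod>x\<in>X. cmod (w0 - b x)) \<le> V * (\<Prod>x\<in>X. cmod (z - b x))"
        using outer_ratio[OF z] by (simp add: V_def b_def)
    qed (use z in auto)
    show "?r * cmod (?g z) * (\<Prod>a\<in>b ` X. cmod (w0 - a)) \<le> (error_amplitude T N K * gauss_weight (- real L - real_of_int n)) * (cmod (z - w0) * (\<Prod>a\<in>b ` X. cmod (z - a)))"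
      if z: "cmod z = ?r" for z
    proof (rule step)
      have "cmod w0 - cmod z \<le> cmod (z - w0)" by (metis norm_minus_commute norm_triangle_ineq2)
      moreover have "?r * kappa \<le> kappa" using ea(3) kappa by (simp add: mult_left_le_one_le)
      moreover have "kappa \<le> cmod w0 - cmod z"
        using w0 ea(2) unfolding z kappa_def by linarith
      ultimately show "?r * kappa \<le> cmod (z - w0)" by linarith
      show "cmod z ^ (K * N) * (\<Prod>x\<in>X. cmod (w0 - b x)) \<le> V * (\<Prod>x\<in>X. cmod (z - b x))"
        using inner_ratio[OF z] by (simp add: V_def b_def)
    qed (use z in auto)
  qed (use error_amplitude_nonneg kap0 in auto)
  also have "(\<Sum>a\<in>b ` X. ?g a * (\<Prod>c\<in>b ` X-{a}. (w0 - c) / (a - c)))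
      = (\<Sum>x\<in>X. weight x * G (of_real (x - of_int n)))"
    unfolding sum.reindex[OF inj] comp_def
  proof (rule sum.cong[OF refl])
    fix x assume x: "x \<in> X"
    have "b ` X - {b x} = b ` (X - {x})" using inj x by (auto simp: inj_on_def)
    then have "(\<Prod>c\<in>b ` X-{b x}. (w0 - c) / (b x - c)) = (\<Prod>y\<in>X-{x}. (w0 - b y) / (b x - b y))"
      using prod.reindex[OF inj_on_subset[OF inj, of "X - {x}"], of "\<lambda>c. (w0 - c) / (b x - c)"] by simp
    moreover have "?g (b x) = node_factor (K * N) (int (L + c0)) x * G (of_real (x - of_int n))"
      unfolding b_def exp_of_real[symmetric] by (rule cleared_term_real)
    ultimately show "?g (b x) * (\<Prod>c\<in>b ` X-{b x}. (w0 - c) / (b x - c)) = weight x * G (of_real (x - of_int n))"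
      by (simp only: weight_def b_def mult_ac)
  qed
  finally show ?thesis by (simp only: distrib_left)
qed

text \<open>
Separation of the nodes bounds the denominators \<open>e^(\<alpha> x) - e^(\<alpha> y)\<close> from below.
\<close>

lemma weight_bound:
  assumes \<delta>: "\<delta> > 0" and sep: "\<And>x y. x \<in> X \<Longrightarrow> y \<in> X \<Longrightarrow> x \<noteq> y \<Longrightarrow> \<delta> \<le> \<bar>x - y\<bar>" and x: "x \<in> X"
  shows "cmod (weight x) \<le> weight_cap \<delta> T N K"
proof -
  let ?eL = "exp (\<alpha> * real L)"
  have eL: "1 \<le> ?eL" using \<alpha> by simp
  have xL: "\<bar>x\<bar> \<le> real L" if "x \<in> X" for x using X_abs[OF that] by simp
  have ex: "exp (\<alpha> * x) \<le> ?eL" "exp (- \<alpha> * real L) \<le> exp (\<alpha> * x)" if "x \<in> X" for x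
  proof -
    have "\<alpha> * x \<le> \<alpha> * real L" "\<alpha> * - real L \<le> \<alpha> * x"
      using xL[OF that] \<alpha> by (intro mult_left_mono; linarith)+
    then show "exp (\<alpha> * x) \<le> ?eL" "exp (- \<alpha> * real L) \<le> exp (\<alpha> * x)" by simp_all
  qed
  have pole_factor: "cmod (pole_factor (om j) k (exp (of_real (\<alpha> * x)))) \<le> D * ?eL" if j: "j < q" for j k
  proof (cases "k \<ge> 0")
    case True
    have "cmod (exp (of_real (\<alpha> * x)) / (om j * exp_step k)) = exp (\<alpha> * x) * (1 / exp (\<alpha> * real_of_int k)) * (1 / cmod (om j))"
      by (simp add: norm_divide norm_mult norm_exp_step)
    also have "\<dots> \<le> ?eL * 1 * (D - 1)"
      using ex(1)[OF x] D(2)[OF j] \<alpha> True by (intro mult_mono) auto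
    finally have "cmod (pole_factor (om j) k (exp (of_real (\<alpha> * x)))) \<le> 1 + ?eL * (D - 1)"
      using True norm_triangle_ineq4[of 1 "exp (of_real (\<alpha> * x)) / (om j * exp_step k)"] by (simp add: pole_factor_def)
    then show ?thesis using eL by (simp add: algebra_simps del: one_le_exp_iff)
  next
    case False
    have "1 / exp (\<alpha> * x) \<le> 1 / exp (- \<alpha> * real L)"
      using ex(2)[OF x] by (intro divide_left_mono) auto
    then have 1: "1 / exp (\<alpha> * x) \<le> ?eL" by (simp add: exp_minus inverse_eq_divide)
    have "cmod (om j * exp_step k / exp (of_real (\<alpha> * x))) = cmod (om j) * exp (\<alpha> * real_of_int k) * (1 / exp (\<alpha> * x))"
      by (simp add: norm_divide norm_mult norm_exp_step)
    also have "\<dots> \<le> (D - 1) * 1 * ?eL"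
      using 1 D(1)[OF j] D(3) \<alpha> False by (intro mult_mono) (auto simp: mult_le_0_iff)
    finally have "cmod (pole_factor (om j) k (exp (of_real (\<alpha> * x)))) \<le> 1 + ?eL * (D - 1)"
      using False norm_triangle_ineq4[of 1 "om j * exp_step k / exp (of_real (\<alpha> * x))"] by (simp add: pole_factor_def mult.commute)
    then show ?thesis using eL by (simp add: algebra_simps del: one_le_exp_iff)
  qed
  have pp: "cmod (\<Prod>j<q. \<Prod>k\<in>{-int (L + c0)..int (L + c0)}. pole_factor (om j) k (exp (of_real (\<alpha> * x))))
      \<le> ((D * ?eL) ^ (2 * (L + c0) + 1)) ^ q"
  proof -
    have card: "card {-int (L + c0)..int (L + c0)} = 2 * (L + c0) + 1" by simp
    have "cmod (\<Prod>j<q. \<Prod>k\<in>{-int (L + c0)..int (L + c0)}. pole_factor (om j) k (exp (of_real (\<alpha> * x))))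
       \<le> (\<Prod>j<q. \<Prod>k\<in>{-int (L + c0)..int (L + c0)}. D * ?eL)"
      unfolding prod_norm[symmetric]
      by (intro prod_mono conjI prod_nonneg pole_factor norm_ge_zero) auto
    then show ?thesis by (simp only: prod_constant card card_lessThan)
  qed
  have "x\<^sup>2 \<le> (real L)\<^sup>2" using xL[OF x] by (metis abs_le_square_iff abs_of_nat)
  then have sq: "exp (\<alpha> * x\<^sup>2 / 2) \<le> exp (\<alpha> * (real L)\<^sup>2 / 2)" using \<alpha> by simp
  have nf: "cmod (node_factor (K * N) (int (L + c0)) x)
     \<le> ?eL ^ (K * N) * ((D * ?eL) ^ (2 * (L + c0) + 1)) ^ q * exp (\<alpha> * (real L)\<^sup>2 / 2)"
    unfolding node_factor_def norm_mult norm_power norm_exp_eq_Re norm_of_real abs_exp_cancel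
    by (intro mult_mono power_mono pp sq mult_nonneg_nonneg) (use ex(1)[OF x] D(3) in auto)
  define H where "H = max 1 (2 * exp \<alpha> * ?eL / (\<alpha> * \<delta> * exp (- \<alpha> * real L)))"
  have fac: "cmod ((w0 - of_real (exp (\<alpha> * y))) / (of_real (exp (\<alpha> * x)) - of_real (exp (\<alpha> * y)))) \<le> H"
    if y: "y \<in> X - {x}" for y
  proof -
    have gap: "\<alpha> * \<delta> * exp (- \<alpha> * real L) \<le> exp (\<alpha> * u) - exp (\<alpha> * v)" if "u \<in> X" "v \<in> X" "v < u" for u v
    proof -
      have "\<alpha> * \<delta> \<le> \<alpha> * (u - v)" using sep[of u v] that \<alpha> by (intro mult_left_mono) auto
      also have "\<dots> \<le> exp (\<alpha> * (u - v)) - 1" using exp_ge_add_one_self[of "\<alpha> * (u - v)"] by linarith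
      finally have "\<alpha> * \<delta> * exp (- \<alpha> * real L) \<le> (exp (\<alpha> * (u - v)) - 1) * exp (\<alpha> * v)"
        using ex(2)[OF that(2)] \<alpha> \<delta> that(3) by (intro mult_mono) auto
      also have "\<dots> = exp (\<alpha> * u) - exp (\<alpha> * v)"
        by (simp add: left_diff_distrib right_diff_distrib flip: exp_add)
      finally show ?thesis .
    qed
    have den: "\<alpha> * \<delta> * exp (- \<alpha> * real L) \<le> cmod (of_real (exp (\<alpha> * x)) - of_real (exp (\<alpha> * y)))"
      using gap[of x y] gap[of y x] y x by (cases "y < x") (auto simp flip: of_real_diff)
    have "cmod (w0 - of_real (exp (\<alpha> * y))) \<le> 2 * exp \<alpha> * exp (\<alpha> * max 0 y)"
      by (rule w0_node) simp
    also have "exp (\<alpha> * max 0 y) \<le> ?eL"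
      using y xL[of y] \<alpha> by (auto simp: max_def)
    finally have "cmod (w0 - of_real (exp (\<alpha> * y))) \<le> 2 * exp \<alpha> * ?eL" by simp
    then have "cmod ((w0 - of_real (exp (\<alpha> * y))) / (of_real (exp (\<alpha> * x)) - of_real (exp (\<alpha> * y))))
        \<le> 2 * exp \<alpha> * ?eL / (\<alpha> * \<delta> * exp (- \<alpha> * real L))"
      unfolding norm_divide using \<alpha> \<delta> by (intro frac_le den) auto
    then show ?thesis by (simp add: H_def)
  qed
  have "cmod (\<Prod>y\<in>X-{x}. (w0 - of_real (exp (\<alpha> * y))) / (of_real (exp (\<alpha> * x)) - of_real (exp (\<alpha> * y)))) \<le> (\<Prod>y\<in>X-{x}. H)"
    unfolding prod_norm[symmetric] by (intro prod_mono conjI norm_ge_zero fac)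
  also have "\<dots> \<le> H ^ (2 * K * N)"
  proof -
    have "card (X - {x}) \<le> 2 * K * N" using card_X card_Diff1_le[of X x] by linarith
    then show ?thesis by (simp add: H_def power_increasing)
  qed
  finally have "cmod (weight x) \<le> (?eL ^ (K * N) * ((D * ?eL) ^ (2 * (L + c0) + 1)) ^ q * exp (\<alpha> * (real L)\<^sup>2 / 2)) * H ^ (2 * K * N)"
    unfolding weight_def norm_mult using D(3) by (intro mult_mono nf) auto
  then show ?thesis unfolding weight_cap_def L[symmetric] Let_def H_def .
qed

end

end

section \<open>Quadrature rules\<close>

lemma summable_on_int_exp_neg_abs:
  assumes "a > (0::real)"
  shows "(\<lambda>n::int. exp (- a * \<bar>real_of_int n\<bar>)) summable_on UNIV"
proof -
  have nat: "(\<lambda>n::nat. exp (- a * real n)) summable_on UNIV"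
  proof -
    have "(\<lambda>n::nat. exp (- a * real n)) = (\<lambda>n. exp (- a) ^ n)"
      by (simp add: mult.commute flip: exp_of_nat_mult)
    moreover have "summable (\<lambda>n. exp (- a) ^ n)" using assms by (intro summable_geometric) simp
    ultimately show ?thesis by (simp add: summable_on_UNIV_nonneg_real_iff)
  qed
  have "(\<lambda>n::int. exp (- a * \<bar>real_of_int n\<bar>)) summable_on range int"
    using nat by (subst summable_on_reindex) (auto simp: comp_def)
  moreover have "(\<lambda>n::int. exp (- a * \<bar>real_of_int n\<bar>)) summable_on range (\<lambda>n. - int n)"
    using nat by (subst summable_on_reindex) (auto simp: comp_def inj_on_def)
  ultimately have "(\<lambda>n::int. exp (- a * \<bar>real_of_int n\<bar>)) summable_on range int \<union> range (\<lambda>n. - int n)"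
    by (rule summable_on_union)
  moreover have "range int \<union> range (\<lambda>n. - int n) = UNIV"
  proof -
    have "x \<in> range int \<union> range (\<lambda>n. - int n)" for x :: int
    proof (cases "x \<ge> 0")
      case True
      then have "x = int (nat x)" by simp
      then show ?thesis by blast
    next
      case False
      then have "x = - int (nat (- x))" by simp
      then show ?thesis by blast
    qed
    then show ?thesis by auto
  qed
  ultimately show ?thesis by simp
qed

definition dense_separated :: "real \<Rightarrow> nat \<Rightarrow> nat \<Rightarrow> real set \<Rightarrow> bool" where
  "dense_separated \<delta> T N \<Lambda> \<longleftrightarrow>
     (\<forall>k::int. N \<le> card (\<Lambda> \<inter> {real_of_int k * real T..<(real_of_int k + 1) * real T})) \<and>
     (\<forall>x\<in>\<Lambda>. \<forall>y\<in>\<Lambda>. x \<noteq> y \<longrightarrow> \<delta> \<le> \<bar>x - y\<bar>)"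

text \<open>
The error of a rule is allowed to depend on the shift; its sum controls the effect on a series.
\<close>

definition small_error :: "real \<Rightarrow> (int \<Rightarrow> real) \<Rightarrow> bool" where
  "small_error \<eta> e \<longleftrightarrow> (\<forall>n. 0 \<le> e n) \<and> e summable_on UNIV \<and> infsum e UNIV \<le> \<eta>"

text \<open>
The target value \<open>t n\<close> prescribed for the \<open>n\<close>th shift is approximated by one and the same combination
of the values of that shift at nodes from \<open>\<Lambda>\<close>.
\<close>

definition quadrature_rule ::
  "(complex \<Rightarrow> complex) \<Rightarrow> real \<Rightarrow> real \<Rightarrow> (int \<Rightarrow> real) \<Rightarrow> real set \<Rightarrow> (int \<Rightarrow> complex) \<Rightarrow> bool" where
  "quadrature_rule G C rad e \<Lambda> t \<longleftrightarrow>
     (\<exists>X v. finite X \<and> X \<subseteq> \<Lambda> \<inter> {-rad..rad} \<and> (\<forall>x\<in>X. cmod (v x) \<le> C) \<and>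
        (\<forall>n. cmod (t n - (\<Sum>x\<in>X. v x * G (of_real (x - of_int n)))) \<le> e n))"

context gauss_rational_const
begin

lemma gauss_weight_le_exp: "gauss_weight y \<le> exp ((\<alpha> * real (degree P) + 1)\<^sup>2 / (2 * \<alpha>)) * exp (- \<bar>y\<bar>)"
proof -
  define b where "b = \<alpha> * real (degree P) + 1"
  have "0 \<le> (\<alpha> * \<bar>y\<bar> - b)\<^sup>2 / (2 * \<alpha>)" using \<alpha> by simp
  also have "\<dots> = \<alpha> * y\<^sup>2 / 2 - b * \<bar>y\<bar> + b\<^sup>2 / (2 * \<alpha>)"
  proof -
    have "(\<alpha> * \<bar>y\<bar> - b)\<^sup>2 = \<alpha>\<^sup>2 * y\<^sup>2 - 2 * \<alpha> * (b * \<bar>y\<bar>) + b\<^sup>2"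
      by (simp add: power2_diff power_mult_distrib)
    then show ?thesis using \<alpha> by (simp add: add_divide_distrib diff_divide_distrib power2_eq_square)
  qed
  finally have "- \<alpha> * y\<^sup>2 / 2 + \<alpha> * real (degree P) * \<bar>y\<bar> \<le> b\<^sup>2 / (2 * \<alpha>) + - \<bar>y\<bar>"
    by (simp add: b_def algebra_simps)
  then show ?thesis unfolding gauss_weight_def b_def exp_add[symmetric] by simp
qed

lemma gauss_weight_nonneg: "gauss_weight y \<ge> 0" by (simp add: gauss_weight_def)

lemma gauss_weight_summable: "(\<lambda>n::int. gauss_weight (real_of_int n)) summable_on UNIV"
proof -
  have "(\<lambda>n::int. exp ((\<alpha> * real (degree P) + 1)\<^sup>2 / (2 * \<alpha>)) * exp (- \<bar>real_of_int n\<bar>)) summable_on UNIV"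
    using summable_on_int_exp_neg_abs[of 1] by (intro summable_on_cmult_right) simp
  then show ?thesis
    by (rule summable_on_comparison_test) (use gauss_weight_le_exp gauss_weight_nonneg in auto)
qed

lemma gauss_weight_shift:
  "(\<lambda>n::int. gauss_weight (real_of_int m - real_of_int n)) summable_on UNIV"
  "infsum (\<lambda>n::int. gauss_weight (real_of_int m - real_of_int n)) UNIV = infsum (\<lambda>n::int. gauss_weight (real_of_int n)) UNIV"
proof -
  have bij: "bij (\<lambda>n::int. m - n)"
    by (rule bij_betw_byWitness[of _ "\<lambda>n. m - n"]) auto
  show "(\<lambda>n::int. gauss_weight (real_of_int m - real_of_int n)) summable_on UNIV"
    using summable_on_reindex_bij_betw[OF bij, of "\<lambda>n. gauss_weight (real_of_int n)"] gauss_weight_summable by simp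
  show "infsum (\<lambda>n::int. gauss_weight (real_of_int m - real_of_int n)) UNIV = infsum (\<lambda>n::int. gauss_weight (real_of_int n)) UNIV"
    using infsum_reindex_bij_betw[OF bij, of "\<lambda>n. gauss_weight (real_of_int n)"] by simp
qed

text \<open>
The number \<open>\<nu>\<close> is the value that will be normalised to \<open>1\<close>.  It may be exponentially small in \<open>M\<close>,
because the error decays faster than any exponential.
\<close>

lemma quadrature:
  fixes Z :: real
  assumes T: "T \<ge> 1" and N: "N \<ge> (q + 1) * T + 1" and \<delta>: "\<delta> > 0" and \<eta>: "\<eta> > 0" and Z: "Z > 0" and c: "c > 0"
  obtains s M C rad e where "C \<ge> 1" "rad \<ge> 1" "small_error \<eta> e" "M \<ge> 0"
    "\<And>\<Lambda> w0 \<nu>. dense_separated \<delta> T N \<Lambda> \<Longrightarrow> 1 \<le> cmod w0 \<Longrightarrow> cmod w0 \<le> exp \<alpha> \<Longrightarrow>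
       c \<le> cmod \<nu> * Z ^ nat (2 * M + 1) \<Longrightarrow> quadrature_rule G C rad e \<Lambda> (\<lambda>n. cleared_term s M n w0 / \<nu>)"
proof -
  define Th where "Th = infsum (\<lambda>n::int. gauss_weight (real_of_int n)) UNIV"
  have Th: "Th \<ge> 0" unfolding Th_def by (intro infsum_nonneg gauss_weight_nonneg)
  \<comment> \<open>each of the two shifts by L and by -L contributes the total mass Th to the error\<close>
  define \<eta>' where "\<eta>' = \<eta> * c / (2 * Th + 1)"
  have \<eta>': "\<eta>' > 0" using \<eta> c Th by (simp add: \<eta>'_def)
  obtain K where K: "K \<ge> 1" and small: "error_amplitude T N K * Z ^ (2 * ((K + 1) * T + c0) + 1) \<le> \<eta>'"
    using error_amplitude_small[OF T N Z \<eta>'] by blast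
  define L where "L = (K + 1) * T"
  define M where "M = int (L + c0)"
  define B where "B = Z ^ nat (2 * M + 1) / c"
  have natM: "nat (2 * M + 1) = 2 * (L + c0) + 1" by (simp add: M_def)
  have B: "B > 0" using Z c by (simp add: B_def)
  have AB: "error_amplitude T N K * B * (2 * Th) \<le> \<eta>"
  proof -
    have "error_amplitude T N K * B \<le> \<eta> / (2 * Th + 1)"
      using small c Th unfolding B_def natM L_def \<eta>'_def by (simp add: field_simps)
    then have "error_amplitude T N K * B * (2 * Th) \<le> \<eta> / (2 * Th + 1) * (2 * Th)"
      using Th by (intro mult_right_mono) auto
    also have "\<dots> \<le> \<eta>" using Th \<eta> by (simp add: field_simps)
    finally show ?thesis .
  qed
  define e where "e n = error_amplitude T N K * B * (gauss_weight (real L - real_of_int n) + gauss_weight (- real L - real_of_int n))" for n :: int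
  define C where "C = max 1 (weight_cap \<delta> T N K * B)"
  have e0: "e n \<ge> 0" for n
    using error_amplitude_nonneg[of T N K] B gauss_weight_nonneg by (simp add: e_def)
  have es: "(\<lambda>n::int. gauss_weight (real L - real_of_int n)) summable_on UNIV" "(\<lambda>n::int. gauss_weight (- real L - real_of_int n)) summable_on UNIV"
    "infsum (\<lambda>n::int. gauss_weight (real L - real_of_int n)) UNIV = Th" "infsum (\<lambda>n::int. gauss_weight (- real L - real_of_int n)) UNIV = Th"
    using gauss_weight_shift[of "int L"] gauss_weight_shift[of "- int L"] by (simp_all add: Th_def)
  have e_sum: "e summable_on UNIV"
    unfolding e_def[abs_def] by (intro summable_on_cmult_right summable_on_add es)
  have e_inf: "infsum e UNIV \<le> \<eta>"
  proof -
    have "infsum e UNIV = error_amplitude T N K * B * (Th + Th)"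
      unfolding e_def[abs_def] by (subst infsum_cmult_right) (auto simp: infsum_add summable_on_add es)
    then show ?thesis using AB by simp
  qed
  have main: "quadrature_rule G C (real L) e \<Lambda> (\<lambda>n. cleared_term (K * N) M n w0 / \<nu>)"
    if dense: "dense_separated \<delta> T N \<Lambda>"
      and w0: "1 \<le> cmod w0" "cmod w0 \<le> exp \<alpha>" and nu: "c \<le> cmod \<nu> * Z ^ nat (2 * M + 1)" for \<Lambda> w0 \<nu>
  proof -
    have "\<exists>A. \<forall>k::int. A k \<subseteq> \<Lambda> \<inter> {real_of_int k * real T..<(real_of_int k + 1) * real T} \<and> card (A k) = N \<and> finite (A k)"
    proof (rule choice, rule allI)
      fix k :: int
      have "N \<le> card (\<Lambda> \<inter> {real_of_int k * real T..<(real_of_int k + 1) * real T})"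
        using dense by (simp add: dense_separated_def)
      then obtain S where "S \<subseteq> \<Lambda> \<inter> {real_of_int k * real T..<(real_of_int k + 1) * real T}" "card S = N" "finite S"
        by (rule obtain_subset_with_card_n)
      then show "\<exists>S. S \<subseteq> \<Lambda> \<inter> {real_of_int k * real T..<(real_of_int k + 1) * real T} \<and> card S = N \<and> finite S"
        by blast
    qed
    then obtain A where A: "\<And>k::int. A k \<subseteq> \<Lambda> \<inter> {real_of_int k * real T..<(real_of_int k + 1) * real T}"
      and cardA: "\<And>k. card (A k) = N" and finA: "\<And>k. finite (A k)" by blast
    have A': "\<And>k. A k \<subseteq> {real_of_int k * real T..<(real_of_int k + 1) * real T}" using A by blast
    define X where "X = (\<Union>k\<in>{-int K..<int K}. A k)"
    note facts = T K L_def A' cardA finA X_def w0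
    let ?w = "weight K N L X w0"
    have X\<Lambda>: "X \<subseteq> \<Lambda>" using A by (auto simp: X_def)
    have nu0: "cmod \<nu> > 0" using nu c by (metis less_le_trans mult_zero_left norm_ge_zero order_le_less)
    have nuB: "1 / cmod \<nu> \<le> B"
      using nu nu0 c by (simp add: B_def field_simps)
    show ?thesis
      unfolding quadrature_rule_def
    proof (intro exI conjI ballI allI)
      show "finite X" by (rule finite_X[OF facts])
      have "\<bar>x\<bar> \<le> real L - 1" if "x \<in> X" for x by (rule X_abs[OF facts that])
      then have "X \<subseteq> {-real L..real L}" by fastforce
      with X\<Lambda> show "X \<subseteq> \<Lambda> \<inter> {-real L..real L}" by blast
      fix x assume x: "x \<in> X"
      have "cmod (?w x) \<le> weight_cap \<delta> T N K"
        by (rule weight_bound[OF facts \<delta> _ x]) (use dense X\<Lambda> in \<open>auto simp: dense_separated_def\<close>)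
      then have "cmod (?w x) * (1 / cmod \<nu>) \<le> weight_cap \<delta> T N K * B"
        using weight_cap_nonneg[of \<delta> T N K] by (intro mult_mono nuB) auto
      then show "cmod (?w x / \<nu>) \<le> C" by (simp add: norm_divide C_def)
    next
      fix n
      have "cmod (cleared_term (K * N) M n w0 / \<nu> - (\<Sum>x\<in>X. ?w x / \<nu> * G (of_real (x - of_int n))))
         = cmod (cleared_term (K * N) M n w0 - (\<Sum>x\<in>X. ?w x * G (of_real (x - of_int n)))) * (1 / cmod \<nu>)"
        by (simp add: diff_divide_distrib sum_divide_distrib flip: norm_divide)
      also have "\<dots> \<le> error_amplitude T N K * (gauss_weight (real L - real_of_int n) + gauss_weight (- real L - real_of_int n)) * B"
        unfolding M_def
        by (intro mult_mono nuB core_approx[OF facts]) (use error_amplitude_nonneg gauss_weight_nonneg in auto)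
      also have "\<dots> = e n" by (simp add: e_def mult_ac)
      finally show "cmod (cleared_term (K * N) M n w0 / \<nu> - (\<Sum>x\<in>X. ?w x / \<nu> * G (of_real (x - of_int n)))) \<le> e n" .
    qed
  qed
  have "L \<ge> 1" using T by (simp add: L_def)
  then have "real L \<ge> 1" by simp
  moreover have "C \<ge> 1" "M \<ge> 0" by (simp_all add: C_def M_def)
  moreover have "small_error \<eta> e" using e0 e_sum e_inf by (simp add: small_error_def)
  ultimately show ?thesis using main by (intro that[of C "real L" e M "K * N"])
qed

text \<open>
The zeros of \<open>Q\<close> keep a positive distance from the half line \<open>u \<ge> 0\<close>, and so do their inverses; the
values \<open>w e^(-\<alpha> k)\<close> and their inverses stay on this half line.
\<close>

lemma pole_factor_lower_on_reals:
  "\<exists>c>0. c \<le> 1 \<and> (\<forall>j<q. \<forall>k. \<forall>x::real. c \<le> cmod (pole_factor (om j) k (exp (of_real x))))"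
proof -
  have one: "\<exists>c>0. \<forall>y\<ge>0. c \<le> cmod (1 - of_real y / p)" if p: "\<And>x. 0 \<le> x \<Longrightarrow> p \<noteq> complex_of_real x" for p :: complex
  proof -
    have cl: "closed (complex_of_real ` {0..})"
      by (intro closed_injective_linear_image injI) (auto simp: linear_of_real)
    have "p \<notin> complex_of_real ` {0..}" using p by auto
    from separate_point_closed[OF cl this]
    obtain d where d: "d > 0" "\<And>z. z \<in> complex_of_real ` {0..} \<Longrightarrow> d \<le> dist p z"
      by auto
    have p0: "p \<noteq> 0" using p[of 0] by simp
    have "d / cmod p \<le> cmod (1 - of_real y / p)" if "y \<ge> 0" for y
    proof -
      have "1 - of_real y / p = (p - of_real y) / p" using p0 by (simp add: field_simps)
      moreover have "d \<le> cmod (p - of_real y)" using d(2)[of "of_real y"] that by (auto simp: dist_norm)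
      ultimately show ?thesis by (simp add: norm_divide divide_right_mono)
    qed
    then show ?thesis using d(1) p0 by (intro exI[of _ "d / cmod p"]) auto
  qed
  have "\<exists>c>0. \<forall>k. \<forall>x::real. c \<le> cmod (pole_factor (om j) k (exp (of_real x)))" if j: "j < q" for j
  proof -
    obtain c1 where c1: "c1 > 0" "\<And>y. y \<ge> 0 \<Longrightarrow> c1 \<le> cmod (1 - of_real y / om j)"
      using one[of "om j"] om[OF j] by blast
    have "1 / om j \<noteq> complex_of_real x" if "x \<ge> 0" for x
    proof
      assume "1 / om j = complex_of_real x"
      have "om j = 1 / (1 / om j)" by simp
      also have "\<dots> = complex_of_real (1 / x)" by (simp only: \<open>1 / om j = complex_of_real x\<close> of_real_divide of_real_1)
      finally have "om j = complex_of_real (1 / x)" .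
      then show False using om[OF j, of "1 / x"] that by simp
    qed
    then obtain c2 where c2: "c2 > 0" "\<And>y. y \<ge> 0 \<Longrightarrow> c2 \<le> cmod (1 - of_real y / (1 / om j))"
      using one[of "1 / om j"] by blast
    have "min c1 c2 \<le> cmod (pole_factor (om j) k (exp (of_real x)))" for k and x :: real
    proof (cases "k \<ge> 0")
      case True
      have "exp (of_real x) / (om j * exp_step k) = of_real (exp (x - \<alpha> * of_int k)) / om j"
        by (simp add: exp_step_def exp_of_real exp_diff)
      then show ?thesis using True c1(2)[of "exp (x - \<alpha> * of_int k)"] by (simp add: pole_factor_def)
    next
      case False
      have "om j * exp_step k / exp (of_real x) = of_real (exp (\<alpha> * of_int k - x)) / (1 / om j)"
        by (simp add: exp_step_def exp_of_real exp_diff)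
      then show ?thesis using False c2(2)[of "exp (\<alpha> * of_int k - x)"] by (simp add: pole_factor_def)
    qed
    then show ?thesis using c1 c2 by (intro exI[of _ "min c1 c2"]) auto
  qed
  then obtain c where c: "\<And>j. j < q \<Longrightarrow> c j > 0" "\<And>j k x. j < q \<Longrightarrow> c j \<le> cmod (pole_factor (om j) k (exp (of_real (x::real))))"
    by metis
  define m where "m = Min (insert 1 (c ` {..<q}))"
  have "m > 0" unfolding m_def using c(1) by (subst Min_gr_iff) auto
  moreover have "m \<le> 1" "\<And>j. j < q \<Longrightarrow> m \<le> c j" unfolding m_def by auto
  ultimately show ?thesis using c(2) by (meson order_trans)
qed

text \<open>
Evaluation at \<open>w0 = e^(\<alpha> x0)\<close>, normalised by the node factor there.
\<close>

lemma point_quadrature: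
  assumes T: "T \<ge> 1" and N: "N \<ge> (q + 1) * T + 1" and \<delta>: "\<delta> > 0" and \<eta>: "\<eta> > 0"
  obtains C rad e where "C \<ge> 1" "rad \<ge> 1" "small_error \<eta> e"
    "\<And>\<Lambda> x0. dense_separated \<delta> T N \<Lambda> \<Longrightarrow> 0 \<le> x0 \<Longrightarrow> x0 \<le> 1 \<Longrightarrow>
       quadrature_rule G C rad e \<Lambda> (\<lambda>n. G (of_real (x0 - of_int n)))"
proof -
  obtain c where c: "c > 0" "c \<le> 1" "\<And>j k x. j < q \<Longrightarrow> c \<le> cmod (pole_factor (om j) k (exp (of_real (x::real))))"
    using pole_factor_lower_on_reals by blast
  \<comment> \<open>one factor for each of the zeros of the denominator\<close>
  define Z where "Z = (1 / c) ^ q"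
  have Z: "Z > 0" using c by (simp add: Z_def)
  obtain s M C rad e where C: "C \<ge> 1" "rad \<ge> 1" "small_error \<eta> e" "M \<ge> 0"
    and main: "\<And>\<Lambda> w0 \<nu>. dense_separated \<delta> T N \<Lambda> \<Longrightarrow> 1 \<le> cmod w0 \<Longrightarrow> cmod w0 \<le> exp \<alpha> \<Longrightarrow>
       1 \<le> cmod \<nu> * Z ^ nat (2 * M + 1) \<Longrightarrow> quadrature_rule G C rad e \<Lambda> (\<lambda>n. cleared_term s M n w0 / \<nu>)"
    by (rule quadrature[OF T N \<delta> \<eta> Z zero_less_one]) (rule that, assumption+)
  have "quadrature_rule G C rad e \<Lambda> (\<lambda>n. G (of_real (x0 - of_int n)))"
    if dense: "dense_separated \<delta> T N \<Lambda>" and x0: "0 \<le> x0" "x0 \<le> 1" for \<Lambda> x0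
  proof -
    let ?w0 = "exp (of_real (\<alpha> * x0)) :: complex"
    let ?\<nu> = "node_factor s M x0"
    have w0: "1 \<le> cmod ?w0" "cmod ?w0 \<le> exp \<alpha>"
      using x0 \<alpha> by (simp_all add: mult_left_le)
    have card: "card {-M..M} = nat (2 * M + 1)" using C(4) by simp
    have "(c ^ nat (2 * M + 1)) ^ q \<le> cmod (\<Prod>j<q. \<Prod>k\<in>{-M..M}. pole_factor (om j) k ?w0)"
    proof -
      have "(\<Prod>j<q. \<Prod>k\<in>{-M..M}. c) \<le> (\<Prod>j<q. \<Prod>k\<in>{-M..M}. cmod (pole_factor (om j) k ?w0))"
        by (intro prod_mono conjI prod_nonneg c(3)) (use c in auto)
      then show ?thesis by (simp only: prod_norm prod_constant card card_lessThan)
    qed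
    moreover have "1 \<le> cmod (?w0 ^ s)" unfolding norm_power using w0(1) by (rule one_le_power)
    moreover have "1 \<le> cmod (of_real (exp (\<alpha> * x0\<^sup>2 / 2)))" using \<alpha> by simp
    ultimately have "1 * (c ^ nat (2 * M + 1)) ^ q * 1 \<le> cmod ?\<nu>"
      unfolding node_factor_def norm_mult by (intro mult_mono mult_nonneg_nonneg) (use c in auto)
    then have nu: "(c ^ nat (2 * M + 1)) ^ q \<le> cmod ?\<nu>" by simp
    have "1 = (c ^ nat (2 * M + 1)) ^ q * Z ^ nat (2 * M + 1)"
      using c(1) by (simp add: Z_def power_mult[symmetric] power_one_over mult.commute)
    also have "\<dots> \<le> cmod ?\<nu> * Z ^ nat (2 * M + 1)"
      using Z by (intro mult_right_mono nu) auto
    finally have nu1: "1 \<le> cmod ?\<nu> * Z ^ nat (2 * M + 1)" .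
    have nu0: "?\<nu> \<noteq> 0" using nu1 by auto
    have "cleared_term s M n ?w0 / ?\<nu> = G (of_real (x0 - of_int n))" for n
      unfolding cleared_term_real using nu0 by simp
    then show ?thesis using main[OF dense w0 nu1] by simp
  qed
  then show ?thesis using that[OF C(1-3)] by blast
qed

text \<open>
Evaluation at the pole \<open>w0 = -1\<close>.  All zeros of \<open>Q\<close> being \<open>-1\<close>, the pole factor with index \<open>0\<close> vanishes
at \<open>w0\<close>.  It survives in every cleared term except the one with \<open>n = 0\<close>, where it has been cancelled
against the pole and leaves a nonzero value.  The resulting rule recovers a single coefficient.
\<close>

lemma pole_quadrature:
  assumes T: "T \<ge> 1" and N: "N \<ge> (q + 1) * T + 1" and \<delta>: "\<delta> > 0" and \<eta>: "\<eta> > 0"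
    and q: "q \<ge> 1" and om1: "\<And>j. j < q \<Longrightarrow> om j = -1" and P: "poly P (-1) \<noteq> 0"
  obtains C rad e where "C \<ge> 1" "rad \<ge> 1" "small_error \<eta> e"
    "\<And>\<Lambda>. dense_separated \<delta> T N \<Lambda> \<Longrightarrow> quadrature_rule G C rad e \<Lambda> (\<lambda>n. if n = 0 then 1 else 0)"
proof -
  define Z where "Z = (1 / kappa) ^ q"
  have Z: "Z > 0" using kappa by (simp add: Z_def)
  define c where "c = cmod (poly P (-1) / l)"
  have c: "c > 0" using P l by (simp add: c_def)
  obtain s M C rad e where C: "C \<ge> 1" "rad \<ge> 1" "small_error \<eta> e" "M \<ge> 0"
    and main: "\<And>\<Lambda> w0 \<nu>. dense_separated \<delta> T N \<Lambda> \<Longrightarrow> 1 \<le> cmod w0 \<Longrightarrow> cmod w0 \<le> exp \<alpha> \<Longrightarrow>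
       c \<le> cmod \<nu> * Z ^ nat (2 * M + 1) \<Longrightarrow> quadrature_rule G C rad e \<Lambda> (\<lambda>n. cleared_term s M n w0 / \<nu>)"
    by (rule quadrature[OF T N \<delta> \<eta> Z c]) (rule that, assumption+)
  let ?\<nu> = "cleared_term s M 0 (-1)"
  \<comment> \<open>the zero that makes all terms with nonzero index vanish\<close>
  have psi1: "pole_factor (-1) 0 (-1) = 0" by (simp add: pole_factor_def exp_step_def)
  have off: "cleared_term s M n (-1) = 0" if n: "n \<noteq> 0" for n
  proof -
    have "cleared_factor M (om 0) n (-1) = 0"
      using om1[of 0] q n C(4) psi1 by (auto simp: cleared_factor_def intro!: prod_zero)
    then have "(\<Prod>j<q. cleared_factor M (om j) n (-1)) = 0" using q by (intro prod_zero) auto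
    then show ?thesis by (simp add: cleared_term_def)
  qed
  have ph: "kappa ^ nat (2 * M + 1) \<le> cmod (cleared_factor M (om j) 0 (-1))" if j: "j < q" for j
  proof -
    have fac: "kappa \<le> cmod (pole_factor (-1) k (-1))" if k: "k \<noteq> 0" for k
    proof -
      have "pole_factor (-1) k (-1) = of_real (1 - exp (- \<alpha> * \<bar>real_of_int k\<bar>))"
        by (simp add: pole_factor_def exp_step_def exp_minus inverse_eq_divide)
      moreover have "exp (- \<alpha> * \<bar>real_of_int k\<bar>) \<le> exp (- \<alpha>)" using k \<alpha> by simp
      moreover have "exp (- \<alpha>) < 1" using \<alpha> by simp
      ultimately show ?thesis by (simp add: kappa_def del: of_real_diff)
    qed
    have "kappa ^ nat (2 * M + 1) \<le> kappa ^ card ({-M..M} - {0})"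
      using kappa C(4) by (intro power_decreasing) (auto simp: card_Diff_singleton)
    also have "\<dots> = (\<Prod>k\<in>{-M..M} - {0}. kappa)" by simp
    also have "\<dots> \<le> (\<Prod>k\<in>{-M..M} - {0}. cmod (pole_factor (-1) k (-1)))"
      using fac kappa by (intro prod_mono) auto
    also have "\<dots> = cmod (cleared_factor M (om j) 0 (-1))"
      using om1[OF j] C(4) by (simp add: cleared_factor_def prod_norm)
    finally show ?thesis .
  qed
  have "(kappa ^ nat (2 * M + 1)) ^ q \<le> cmod (\<Prod>j<q. cleared_factor M (om j) 0 (-1))"
  proof -
    have "(\<Prod>j<q. kappa ^ nat (2 * M + 1)) \<le> (\<Prod>j<q. cmod (cleared_factor M (om j) 0 (-1)))"
      using kappa ph by (intro prod_mono) auto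
    then show ?thesis by (simp add: prod_norm)
  qed
  moreover have "cmod ?\<nu> = c * cmod (\<Prod>j<q. cleared_factor M (om j) 0 (-1))"
    by (simp add: cleared_term_def norm_mult norm_power norm_divide c_def exp_step_def)
  ultimately have nu: "c * (kappa ^ nat (2 * M + 1)) ^ q \<le> cmod ?\<nu>" using c by simp
  have "c = c * (kappa ^ nat (2 * M + 1)) ^ q * Z ^ nat (2 * M + 1)"
    using kappa(1) by (simp add: Z_def power_mult[symmetric] power_one_over mult.commute)
  also have "\<dots> \<le> cmod ?\<nu> * Z ^ nat (2 * M + 1)"
    using Z by (intro mult_right_mono nu) auto
  finally have nu1: "c \<le> cmod ?\<nu> * Z ^ nat (2 * M + 1)" .
  have nu0: "?\<nu> \<noteq> 0" using nu1 c by auto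
  have eq: "(\<lambda>n. cleared_term s M n (-1) / ?\<nu>) = (\<lambda>n. if n = 0 then 1 else 0)"
    using nu0 off by (auto simp: fun_eq_iff)
  have "quadrature_rule G C rad e \<Lambda> (\<lambda>n. if n = 0 then 1 else 0)"
    if "dense_separated \<delta> T N \<Lambda>" for \<Lambda>
    using main[OF that, of "-1" ?\<nu>] nu1 \<alpha> unfolding eq by simp
  then show ?thesis using that[OF C(1-3)] by blast
qed

end

section \<open>Schur's test and integral norms\<close>

text \<open>
The graph of \<open>a powr p\<close> lies above its tangent at \<open>m\<close>; this is Young's inequality.
\<close>

lemma powr_tangent:
  fixes a m p :: real
  assumes "a \<ge> 0" "m \<ge> 0" "p \<ge> 1"
  shows "p * m powr (p - 1) * a \<le> a powr p + (p - 1) * m powr p"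
proof (cases "p = 1 \<or> m = 0 \<or> a = 0")
  case True
  then show ?thesis
    using assms by (auto simp: powr_def)
next
  case False
  then have p: "p > 1" and m: "m > 0" and a: "a > 0" using assms by auto
  define r where "r = p / (p - 1)"
  have r: "r > 1" "1 / p + 1 / r = 1" using p by (auto simp: r_def field_simps)
  have "(m powr (p - 1)) powr r = m powr p"
    using p by (simp add: powr_powr r_def)
  then have "a * m powr (p - 1) \<le> a powr p / p + m powr p / r"
    using Youngs_inequality[of p r a "m powr (p - 1)"] p r a m by simp
  then have "p * (a * m powr (p - 1)) \<le> p * (a powr p / p + m powr p / r)"
    using p by (intro mult_left_mono) auto
  also have "\<dots> = a powr p + (p - 1) * m powr p"
    using p by (simp add: r_def field_simps)
  finally show ?thesis by (simp add: mult_ac)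
qed

text \<open>
Jensen's inequality for a kernel of total mass at most \<open>A\<close>: integrate the tangent inequality at the
mean \<open>m = F / A\<close>.
\<close>

lemma nn_integral_powr_jensen:
  fixes k a :: "'j \<Rightarrow> real" and A F p :: real
  assumes [measurable]: "k \<in> borel_measurable M" "a \<in> borel_measurable M"
    and pos: "\<And>j. k j \<ge> 0" "\<And>j. a j \<ge> 0"
    and row: "(\<integral>\<^sup>+j. ennreal (k j) \<partial>M) \<le> ennreal A" and A: "A > 0"
    and F: "F \<ge> 0" "ennreal F \<le> (\<integral>\<^sup>+j. ennreal (k j * a j) \<partial>M)" and p: "p \<ge> 1"
  shows "ennreal (F powr p) \<le> ennreal (A powr (p - 1)) * (\<integral>\<^sup>+j. ennreal (k j * a j powr p) \<partial>M)"
proof (cases "F = 0 \<or> (\<integral>\<^sup>+j. ennreal (k j * a j powr p) \<partial>M) = \<infinity>")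
  case True
  then show ?thesis
    using A p by (auto simp: ennreal_mult_top)
next
  case False
  then have Fp: "F > 0" using F by simp
  obtain I where I: "I \<ge> 0" "(\<integral>\<^sup>+j. ennreal (k j * a j powr p) \<partial>M) = ennreal I"
    using False by (metis ennreal_cases infinity_ennreal_def)
  \<comment> \<open>the mean of a, when the kernel has mass A and F equals the integral\<close>
  define m where "m = F / A"
  have m: "m > 0" using Fp A by (simp add: m_def)
  have "ennreal (p * m powr (p - 1) * F) = ennreal (p * m powr (p - 1)) * ennreal F"
    using p Fp by (intro ennreal_mult) auto
  also have "\<dots> \<le> ennreal (p * m powr (p - 1)) * (\<integral>\<^sup>+j. ennreal (k j * a j) \<partial>M)"
    by (intro mult_left_mono F) auto
  also have "\<dots> = (\<integral>\<^sup>+j. ennreal (p * m powr (p - 1)) * ennreal (k j * a j) \<partial>M)"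
    by (rule nn_integral_cmult[symmetric]) measurable
  also have "\<dots> \<le> (\<integral>\<^sup>+j. ennreal (k j * a j powr p) + ennreal ((p - 1) * m powr p) * ennreal (k j) \<partial>M)"
  proof (rule nn_integral_mono)
    fix j
    have "k j * (p * m powr (p - 1) * a j) \<le> k j * (a j powr p + (p - 1) * m powr p)"
      using powr_tangent[OF pos(2) _ p, of m j] m pos(1) by (intro mult_left_mono) auto
    then have "p * m powr (p - 1) * (k j * a j) \<le> k j * a j powr p + (p - 1) * m powr p * k j"
      by (simp add: algebra_simps)
    moreover have "ennreal (p * m powr (p - 1)) * ennreal (k j * a j) = ennreal (p * m powr (p - 1) * (k j * a j))"
      using p pos by (intro ennreal_mult[symmetric]) auto
    moreover have "ennreal (k j * a j powr p) + ennreal ((p - 1) * m powr p) * ennreal (k j)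
        = ennreal (k j * a j powr p + (p - 1) * m powr p * k j)"
      using p pos by (simp add: ennreal_mult ennreal_plus)
    ultimately show "ennreal (p * m powr (p - 1)) * ennreal (k j * a j)
        \<le> ennreal (k j * a j powr p) + ennreal ((p - 1) * m powr p) * ennreal (k j)"
      by (simp add: ennreal_leI)
  qed
  also have "\<dots> = ennreal I + ennreal ((p - 1) * m powr p) * (\<integral>\<^sup>+j. ennreal (k j) \<partial>M)"
    by (simp add: nn_integral_add nn_integral_cmult I(2))
  also have "\<dots> \<le> ennreal I + ennreal ((p - 1) * m powr p) * ennreal A"
    by (intro add_left_mono mult_left_mono row) auto
  also have "\<dots> = ennreal (I + (p - 1) * m powr p * A)"
    using I p A by (simp add: ennreal_mult ennreal_plus)
  finally have "p * m powr (p - 1) * F \<le> I + (p - 1) * m powr p * A"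
    using I p A by (subst (asm) ennreal_le_iff) auto
  moreover have "m powr (p - 1) * F = m powr p * A"
  proof -
    have "m powr (p - 1) * F = (m * m powr (p - 1)) * A" using A by (simp add: m_def)
    also have "m * m powr (p - 1) = m powr p" using m by (simp add: powr_mult_base)
    finally show ?thesis .
  qed
  moreover have "p * m powr (p - 1) * F = p * (m powr (p - 1) * F)" by simp
  ultimately have "p * (m powr p * A) \<le> I + (p - 1) * (m powr p * A)" by simp
  then have "m powr p * A \<le> I" by (simp add: left_diff_distrib)
  moreover have "A powr (p - 1) * (m powr p * A) = F powr p"
  proof -
    have "A powr (p - 1) * (m powr p * A) = (A * A powr (p - 1)) * m powr p" by simp
    also have "A * A powr (p - 1) = A powr p" using A by (simp add: powr_mult_base)
    also have "A powr p * m powr p = F powr p" using A Fp by (simp add: m_def powr_mult[symmetric])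
    finally show ?thesis .
  qed
  ultimately have "F powr p \<le> A powr (p - 1) * I"
    by (metis mult_left_mono powr_ge_zero)
  then have "ennreal (F powr p) \<le> ennreal (A powr (p - 1) * I)" by (rule ennreal_leI)
  then show ?thesis using I by (simp add: ennreal_mult)
qed

text \<open>
Jensen's inequality in each row, followed by Tonelli's theorem.
\<close>

lemma schur_test:
  fixes k :: "'i \<Rightarrow> 'j \<Rightarrow> real" and a :: "'j \<Rightarrow> real" and F :: "'i \<Rightarrow> real"
  assumes M1: "sigma_finite_measure M1" and M2: "sigma_finite_measure M2"
    and meas: "(\<lambda>(i, j). k i j) \<in> borel_measurable (M1 \<Otimes>\<^sub>M M2)" and a_meas: "a \<in> borel_measurable M2"
    and pos: "\<And>i j. k i j \<ge> 0" "\<And>j. a j \<ge> 0"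
    and row: "\<And>i. i \<in> space M1 \<Longrightarrow> (\<integral>\<^sup>+j. ennreal (k i j) \<partial>M2) \<le> ennreal A" and A: "A > 0"
    and col: "\<And>j. j \<in> space M2 \<Longrightarrow> (\<integral>\<^sup>+i. ennreal (k i j) \<partial>M1) \<le> ennreal B" and B: "B \<ge> 0"
    and F: "\<And>i. i \<in> space M1 \<Longrightarrow> F i \<ge> 0"
      "\<And>i. i \<in> space M1 \<Longrightarrow> ennreal (F i) \<le> (\<integral>\<^sup>+j. ennreal (k i j * a j) \<partial>M2)"
    and p: "p \<ge> 1"
  shows "(\<integral>\<^sup>+i. ennreal (F i powr p) \<partial>M1) \<le> ennreal (A powr (p - 1) * B) * (\<integral>\<^sup>+j. ennreal (a j powr p) \<partial>M2)"
proof -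
  interpret P: pair_sigma_finite M1 M2 using M1 M2 by (simp add: pair_sigma_finite_def)
  note [measurable] = meas a_meas
  have k1: "k i \<in> borel_measurable M2" if "i \<in> space M1" for i
    using measurable_Pair2[OF meas that] by simp
  have k2: "(\<lambda>i. k i j) \<in> borel_measurable M1" if "j \<in> space M2" for j
    using measurable_Pair1[OF meas that] by simp
  have km: "(\<lambda>x. k (fst x) (snd x)) \<in> borel_measurable (M1 \<Otimes>\<^sub>M M2)"
    using meas by (simp add: case_prod_beta')
  note [measurable] = km
  have jm: "(\<lambda>(i, j). ennreal (k i j * a j powr p)) \<in> borel_measurable (M1 \<Otimes>\<^sub>M M2)"
    unfolding case_prod_beta' by measurable
  have "(\<integral>\<^sup>+i. ennreal (F i powr p) \<partial>M1)
     \<le> (\<integral>\<^sup>+i. ennreal (A powr (p - 1)) * (\<integral>\<^sup>+j. ennreal (k i j * a j powr p) \<partial>M2) \<partial>M1)"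
    by (intro nn_integral_mono nn_integral_powr_jensen k1 a_meas pos row A F p) auto
  also have "\<dots> = ennreal (A powr (p - 1)) * (\<integral>\<^sup>+i. (\<integral>\<^sup>+j. ennreal (k i j * a j powr p) \<partial>M2) \<partial>M1)"
    by (rule nn_integral_cmult) (rule P.M2.borel_measurable_nn_integral[OF jm])
  also have "(\<integral>\<^sup>+i. (\<integral>\<^sup>+j. ennreal (k i j * a j powr p) \<partial>M2) \<partial>M1)
      = (\<integral>\<^sup>+j. (\<integral>\<^sup>+i. ennreal (k i j * a j powr p) \<partial>M1) \<partial>M2)"
    by (rule P.Fubini'[OF jm, symmetric])
  also have "\<dots> \<le> (\<integral>\<^sup>+j. ennreal B * ennreal (a j powr p) \<partial>M2)"
  proof (rule nn_integral_mono)
    fix j assume j: "j \<in> space M2"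
    have "(\<integral>\<^sup>+i. ennreal (k i j * a j powr p) \<partial>M1) = (\<integral>\<^sup>+i. ennreal (k i j) \<partial>M1) * ennreal (a j powr p)"
      using k2[OF j] pos by (simp add: ennreal_mult nn_integral_multc)
    also have "\<dots> \<le> ennreal B * ennreal (a j powr p)"
      by (intro mult_right_mono col[OF j]) auto
    finally show "(\<integral>\<^sup>+i. ennreal (k i j * a j powr p) \<partial>M1) \<le> ennreal B * ennreal (a j powr p)" .
  qed
  also have "\<dots> = ennreal B * (\<integral>\<^sup>+j. ennreal (a j powr p) \<partial>M2)"
    by (rule nn_integral_cmult) measurable
  finally show ?thesis
    using B by (simp add: ennreal_mult mult.assoc mult_left_mono)
qed

lemma measurable_pair_count_space2:
  assumes J: "countable J" and f: "\<And>j. j \<in> J \<Longrightarrow> (\<lambda>x. f x j) \<in> measurable M N"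
  shows "(\<lambda>(x, j). f x j) \<in> measurable (M \<Otimes>\<^sub>M count_space J) N"
proof -
  have "(\<lambda>z. (\<lambda>j z. f (fst z) j) (snd z) z) \<in> measurable (M \<Otimes>\<^sub>M count_space J) N"
  proof (rule measurable_compose_countable'[OF _ _ J])
    fix j assume "j \<in> J"
    show "(\<lambda>z. f (fst z) j) \<in> measurable (M \<Otimes>\<^sub>M count_space J) N"
      by (rule measurable_compose[OF measurable_fst f[OF \<open>j \<in> J\<close>]])
  qed simp
  then show ?thesis by (simp add: case_prod_beta')
qed

lemma ennreal_infsum_eq_nn_integral:
  fixes f :: "'a \<Rightarrow> real"
  assumes f: "f summable_on A" and pos: "\<And>x. x \<in> A \<Longrightarrow> f x \<ge> 0"
  shows "ennreal (infsum f A) = (\<integral>\<^sup>+x. ennreal (f x) \<partial>count_space A)"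
proof -
  have "(\<lambda>x. norm (f x)) summable_on A"
    using f pos by (simp cong: summable_on_cong)
  then have "Infinite_Set_Sum.abs_summable_on f A"
    using abs_summable_equivalent by blast
  then show ?thesis
    using nn_integral_conv_infsetsum[of f A] pos infsetsum_infsum[of f A] by simp
qed

lemma infsum_ennreal_eq_nn_integral:
  fixes f :: "'a \<Rightarrow> ennreal"
  assumes A: "countable A"
  shows "infsum f A = (\<integral>\<^sup>+x. f x \<partial>count_space A)"
proof (cases "finite A")
  case True
  then show ?thesis by (simp add: nn_integral_count_space_finite)
next
  case False
  have sup: "infsum f A = (SUP F\<in>{F. finite F \<and> F \<subseteq> A}. sum f F)"
    by (rule nonneg_infsum_complete) simp
  have bij: "bij_betw (from_nat_into A) UNIV A"
    using A False by (rule bij_betw_from_nat_into)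
  have "(\<integral>\<^sup>+x. f x \<partial>count_space A) = (\<integral>\<^sup>+n. f (from_nat_into A n) \<partial>count_space UNIV)"
    by (rule nn_integral_bij_count_space[OF bij, symmetric])
  also have "\<dots> = (\<Sum>n. f (from_nat_into A n))" by (rule nn_integral_count_space_nat)
  also have "\<dots> = (SUP n. \<Sum>i<n. f (from_nat_into A i))" by (rule suminf_eq_SUP)
  also have "\<dots> \<le> infsum f A"
  proof (rule SUP_least)
    fix n
    have "(\<Sum>i<n. f (from_nat_into A i)) = sum f (from_nat_into A ` {..<n})"
      by (rule sum.reindex[symmetric, unfolded comp_def]) (use bij in \<open>auto simp: bij_betw_def inj_on_def\<close>)
    also have "\<dots> \<le> infsum f A"
      unfolding sup by (rule SUP_upper) (use bij in \<open>auto simp: bij_betw_def\<close>)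
    finally show "(\<Sum>i<n. f (from_nat_into A i)) \<le> infsum f A" .
  qed
  finally have 1: "(\<integral>\<^sup>+x. f x \<partial>count_space A) \<le> infsum f A" .
  have 2: "infsum f A \<le> (\<integral>\<^sup>+x. f x \<partial>count_space A)"
    unfolding sup
  proof (rule SUP_least)
    fix F assume "F \<in> {F. finite F \<and> F \<subseteq> A}"
    then have F: "finite F" "F \<subseteq> A" by auto
    have "sum f F = (\<integral>\<^sup>+x. f x \<partial>count_space F)" using F by (simp add: nn_integral_count_space_finite)
    also have "\<dots> = (\<integral>\<^sup>+x. f x * indicator F x \<partial>count_space A)"
      using F by (subst nn_integral_restrict_space[symmetric]) (auto simp: restrict_count_space_subset)
    also have "\<dots> \<le> (\<integral>\<^sup>+x. f x \<partial>count_space A)"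
      by (intro nn_integral_mono) (auto simp: indicator_def)
    finally show "sum f F \<le> (\<integral>\<^sup>+x. f x \<partial>count_space A)" .
  qed
  show ?thesis using 1 2 by (rule antisym[rotated])
qed

text \<open>
Each unit cell of the coordinate \<open>x\<close> has mass at most \<open>\<nu>\<close>.  This covers Lebesgue measure and the
counting measures of separated sets with the same argument.
\<close>

definition cell_bounded :: "'a measure \<Rightarrow> ('a \<Rightarrow> real) \<Rightarrow> real \<Rightarrow> bool" where
  "cell_bounded M x \<nu> \<longleftrightarrow> x \<in> borel_measurable M \<and> 0 \<le> \<nu> \<and>
     (\<forall>m. emeasure M {i \<in> space M. \<lfloor>x i\<rfloor> = m} \<le> ennreal \<nu>)"

lemma nn_integral_cell_bounded:
  assumes M: "sigma_finite_measure M" and cb: "cell_bounded M x \<nu>"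
  shows "(\<integral>\<^sup>+i. h \<lfloor>x i\<rfloor> \<partial>M) \<le> ennreal \<nu> * (\<integral>\<^sup>+m. h m \<partial>count_space (UNIV::int set))"
proof -
  have [measurable]: "x \<in> borel_measurable M" using cb by (simp add: cell_bounded_def)
  interpret pair_sigma_finite M "count_space (UNIV::int set)"
    using M by (simp add: pair_sigma_finite_def sigma_finite_measure_count_space)
  have "(\<integral>\<^sup>+i. h \<lfloor>x i\<rfloor> \<partial>M) = (\<integral>\<^sup>+i. (\<integral>\<^sup>+m. h m * indicator {i \<in> space M. \<lfloor>x i\<rfloor> = m} i \<partial>count_space UNIV) \<partial>M)"
  proof (rule nn_integral_cong)
    fix i assume i: "i \<in> space M"
    have "(\<integral>\<^sup>+m. h m * indicator {i \<in> space M. \<lfloor>x i\<rfloor> = m} i \<partial>count_space UNIV)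
        = (\<integral>\<^sup>+m. h m * indicator {\<lfloor>x i\<rfloor>} m \<partial>count_space UNIV)"
      using i by (intro nn_integral_cong) (auto simp: indicator_def)
    also have "\<dots> = h \<lfloor>x i\<rfloor>"
      by (subst nn_integral_indicator_singleton) auto
    finally show "h \<lfloor>x i\<rfloor> = (\<integral>\<^sup>+m. h m * indicator {i \<in> space M. \<lfloor>x i\<rfloor> = m} i \<partial>count_space UNIV)" by simp
  qed
  also have "\<dots> = (\<integral>\<^sup>+m. (\<integral>\<^sup>+i. h m * indicator {i \<in> space M. \<lfloor>x i\<rfloor> = m} i \<partial>M) \<partial>count_space UNIV)"
    by (rule Fubini'[symmetric]) (rule measurable_pair_count_space2; measurable)
  also have "\<dots> \<le> (\<integral>\<^sup>+m. ennreal \<nu> * h m \<partial>count_space UNIV)"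
  proof (rule nn_integral_mono)
    fix m
    have "(\<integral>\<^sup>+i. h m * indicator {i \<in> space M. \<lfloor>x i\<rfloor> = m} i \<partial>M) = h m * emeasure M {i \<in> space M. \<lfloor>x i\<rfloor> = m}"
      by (rule nn_integral_cmult_indicator) measurable
    also have "\<dots> \<le> h m * ennreal \<nu>"
      using cb by (intro mult_left_mono) (auto simp: cell_bounded_def)
    finally show "(\<integral>\<^sup>+i. h m * indicator {i \<in> space M. \<lfloor>x i\<rfloor> = m} i \<partial>M) \<le> ennreal \<nu> * h m"
      by (simp add: mult.commute)
  qed
  also have "\<dots> = ennreal \<nu> * (\<integral>\<^sup>+m. h m \<partial>count_space UNIV)"
    by (rule nn_integral_cmult) simp
  finally show ?thesis .
qed

lemma cell_bounded_lborel: "cell_bounded lborel (\<lambda>x. x) 1"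
proof -
  have "{i::real. \<lfloor>i\<rfloor> = m} = {real_of_int m..<real_of_int m + 1}" for m
    by (auto simp: floor_eq_iff)
  then show ?thesis by (simp add: cell_bounded_def)
qed

lemma cell_bounded_count_int: "cell_bounded (count_space UNIV) real_of_int 1"
  by (simp add: cell_bounded_def)

text \<open>
The map \<open>x \<mapsto> \<lfloor>(x - a) / \<delta>\<rfloor>\<close> is injective on a set with gaps at least \<open>\<delta>\<close>.
\<close>

lemma card_separated_interval:
  fixes a b \<delta> :: real
  assumes \<delta>: "\<delta> > 0" and sep: "\<And>x y. x \<in> \<Lambda> \<Longrightarrow> y \<in> \<Lambda> \<Longrightarrow> x \<noteq> y \<Longrightarrow> \<delta> \<le> \<bar>x - y\<bar>" and ab: "a \<le> b"
  shows "finite (\<Lambda> \<inter> {a..b})" "real (card (\<Lambda> \<inter> {a..b})) \<le> (b - a) / \<delta> + 1"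
proof -
  let ?S = "\<Lambda> \<inter> {a..b}"
  define g where "g x = nat \<lfloor>(x - a) / \<delta>\<rfloor>" for x
  have inj: "inj_on g ?S"
  proof (rule inj_onI, rule ccontr)
    fix x y assume xy: "x \<in> ?S" "y \<in> ?S" "g x = g y" "x \<noteq> y"
    then have "\<lfloor>(x - a) / \<delta>\<rfloor> = \<lfloor>(y - a) / \<delta>\<rfloor>"
      using \<delta> by (auto simp: g_def nat_eq_iff2)
    then have "\<bar>(x - a) / \<delta> - (y - a) / \<delta>\<bar> < 1" by linarith
    then have "\<bar>x - y\<bar> / \<delta> < 1" using \<delta> by (simp add: diff_divide_distrib[symmetric] abs_divide)
    then have "\<bar>x - y\<bar> < \<delta>" using \<delta> by (simp add: field_simps)
    then show False using sep[of x y] xy by auto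
  qed
  have sub: "g ` ?S \<subseteq> {..nat \<lfloor>(b - a) / \<delta>\<rfloor>}"
    using \<delta> by (auto simp: g_def intro!: nat_mono floor_mono divide_right_mono)
  show "finite ?S" using inj sub finite_subset finite_imageD by blast
  have "card ?S \<le> card {..nat \<lfloor>(b - a) / \<delta>\<rfloor>}"
    using inj sub by (intro card_inj_on_le) auto
  also have "\<dots> = nat \<lfloor>(b - a) / \<delta>\<rfloor> + 1" by simp
  finally have "real (card ?S) \<le> real (nat \<lfloor>(b - a) / \<delta>\<rfloor>) + 1" by linarith
  moreover have "real (nat \<lfloor>(b - a) / \<delta>\<rfloor>) \<le> (b - a) / \<delta>"
    using ab \<delta> by (simp add: of_nat_nat)
  ultimately show "real (card ?S) \<le> (b - a) / \<delta> + 1" by linarith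
qed

lemma separated_gap:
  assumes "separated \<Lambda>"
  obtains \<delta> where "\<delta> > 0" "\<And>x y. x \<in> \<Lambda> \<Longrightarrow> y \<in> \<Lambda> \<Longrightarrow> x \<noteq> y \<Longrightarrow> \<delta> \<le> \<bar>x - y\<bar>"
proof -
  obtain e where e: "e > 0" "\<And>x y. x \<in> \<Lambda> \<Longrightarrow> y \<in> \<Lambda> \<Longrightarrow> dist x y < e \<Longrightarrow> x = y"
    using assms unfolding separated_def uniform_discrete_def by metis
  show ?thesis
    by (rule that[OF e(1)]) (metis dist_real_def e(2) not_le)
qed

lemma cell_bounded_separated:
  assumes \<delta>: "\<delta> > 0" and sep: "\<And>x y. x \<in> \<Lambda> \<Longrightarrow> y \<in> \<Lambda> \<Longrightarrow> x \<noteq> y \<Longrightarrow> \<delta> \<le> \<bar>x - y\<bar>"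
  shows "cell_bounded (count_space \<Lambda>) (\<lambda>x. x) (1 / \<delta> + 1)"
proof -
  have "emeasure (count_space \<Lambda>) {x \<in> \<Lambda>. \<lfloor>x\<rfloor> = m} \<le> ennreal (1 / \<delta> + 1)" for m
  proof -
    let ?S = "\<Lambda> \<inter> {real_of_int m..real_of_int m + 1}"
    have fin: "finite ?S" and c: "real (card ?S) \<le> 1 / \<delta> + 1"
      using card_separated_interval[OF \<delta> sep, where a = "real_of_int m" and b = "real_of_int m + 1"] by auto
    have "emeasure (count_space \<Lambda>) {x \<in> \<Lambda>. \<lfloor>x\<rfloor> = m} \<le> emeasure (count_space \<Lambda>) ?S"
      by (rule emeasure_mono) (auto simp: floor_eq_iff)
    also have "\<dots> = ennreal (real (card ?S))" using fin by (simp add: emeasure_count_space_finite ennreal_of_nat_eq_real_of_nat)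
    also have "\<dots> \<le> ennreal (1 / \<delta> + 1)" using c by (rule ennreal_leI)
    finally show ?thesis .
  qed
  then show ?thesis using \<delta> by (auto simp: cell_bounded_def)
qed

text \<open>
The \<open>r\<close>th power of the norm; inequalities between norms become inequalities between masses without
roots.
\<close>

definition Lp_mass :: "'a measure \<Rightarrow> real \<Rightarrow> ('a \<Rightarrow> complex) \<Rightarrow> ennreal" where
  "Lp_mass M r f = (\<integral>\<^sup>+x. ennreal (cmod (f x) powr r) \<partial>M)"

lemma Lp_norm_finite_exponent:
  assumes "p \<noteq> \<infinity>"
  shows "Lp_norm M p f = (if Lp_mass M (enn2real p) f = \<infinity> then \<infinity> else ennreal (enn2real (Lp_mass M (enn2real p) f) powr (1 / enn2real p)))"
  using assms by (simp add: Lp_norm_def Lp_mass_def Let_def)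

lemma enn2real_ge_1: "1 \<le> p \<Longrightarrow> p \<noteq> \<infinity> \<Longrightarrow> 1 \<le> enn2real p"
  by (metis enn2real_1 enn2real_mono infinity_ennreal_def top.not_eq_extremum)

lemma mult_Lp_norm_le_iff:
  fixes p :: ennreal and M :: "'a measure" and M' :: "'b measure"
  assumes p: "1 \<le> p" "p \<noteq> \<infinity>" and C: "C > 0"
  shows "ennreal C * Lp_norm M p f \<le> Lp_norm M' p g \<longleftrightarrow>
     ennreal (C powr enn2real p) * Lp_mass M (enn2real p) f \<le> Lp_mass M' (enn2real p) g"
proof -
  define r where "r = enn2real p"
  have r: "r \<ge> 1" using enn2real_ge_1[OF p] by (simp add: r_def)
  have cp: "ennreal C * \<infinity> = \<infinity>" "ennreal (C powr r) * \<infinity> = \<infinity>" using C by (auto simp: ennreal_mult_top)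
  show ?thesis
  proof (cases "Lp_mass M r f = \<infinity> \<or> Lp_mass M' r g = \<infinity>")
    case True
    then show ?thesis
      unfolding Lp_norm_finite_exponent[OF p(2)] r_def[symmetric] using cp
      by (auto simp: top_unique ennreal_mult_eq_top_iff)
  next
    case False
    then obtain I J where I: "I \<ge> 0" "Lp_mass M r f = ennreal I" and J: "J \<ge> 0" "Lp_mass M' r g = ennreal J"
      by (metis ennreal_cases infinity_ennreal_def)
    have "ennreal C * Lp_norm M p f \<le> Lp_norm M' p g \<longleftrightarrow> C * I powr (1 / r) \<le> J powr (1 / r)"
      unfolding Lp_norm_finite_exponent[OF p(2)] r_def[symmetric] I(2) J(2)
      using C I(1) J(1) by (simp add: ennreal_mult[symmetric])
    also have "\<dots> \<longleftrightarrow> (C * I powr (1 / r)) powr r \<le> (J powr (1 / r)) powr r"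
    proof
      assume "C * I powr (1 / r) \<le> J powr (1 / r)"
      then show "(C * I powr (1 / r)) powr r \<le> (J powr (1 / r)) powr r"
        using C r by (intro powr_mono2) auto
    next
      assume le: "(C * I powr (1 / r)) powr r \<le> (J powr (1 / r)) powr r"
      show "C * I powr (1 / r) \<le> J powr (1 / r)"
      proof (rule ccontr)
        assume "\<not> ?thesis"
        then have "(J powr (1 / r)) powr r < (C * I powr (1 / r)) powr r"
          using r by (intro powr_less_mono2) auto
        with le show False by simp
      qed
    qed
    also have "\<dots> \<longleftrightarrow> C powr r * I \<le> J"
      using C r I J by (simp add: powr_mult powr_powr)
    also have "\<dots> \<longleftrightarrow> ennreal (C powr r) * Lp_mass M r f \<le> Lp_mass M' r g"
      unfolding I(2) J(2) using C I(1) J(1) by (simp add: ennreal_mult[symmetric])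
    finally show ?thesis by (simp add: r_def)
  qed
qed

lemma ennreal_inverse_mult_le_iff:
  fixes c :: real and x y :: ennreal
  assumes "c > 0"
  shows "ennreal (1 / c) * x \<le> y \<longleftrightarrow> x \<le> ennreal c * y"
proof -
  have u: "ennreal c * ennreal (1 / c) = 1" using assms by (simp add: ennreal_mult[symmetric])
  show ?thesis
  proof
    assume "ennreal (1 / c) * x \<le> y"
    then have "ennreal c * (ennreal (1 / c) * x) \<le> ennreal c * y" by (rule mult_left_mono) simp
    then show "x \<le> ennreal c * y" by (simp add: mult.assoc[symmetric] u)
  next
    assume "x \<le> ennreal c * y"
    then have "ennreal (1 / c) * x \<le> ennreal (1 / c) * (ennreal c * y)" by (rule mult_left_mono) simp
    then show "ennreal (1 / c) * x \<le> y" by (simp add: mult.assoc[symmetric] mult.commute[of _ "ennreal c"] u)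
  qed
qed

lemma Lp_norm_le_mult_iff:
  fixes p :: ennreal and M :: "'a measure" and M' :: "'b measure"
  assumes p: "1 \<le> p" "p \<noteq> \<infinity>" and C: "C > 0"
  shows "Lp_norm M' p g \<le> ennreal C * Lp_norm M p f \<longleftrightarrow>
     Lp_mass M' (enn2real p) g \<le> ennreal (C powr enn2real p) * Lp_mass M (enn2real p) f"
proof -
  have "(1 / C) powr enn2real p = 1 / C powr enn2real p" using C by (simp add: powr_divide)
  then show ?thesis
    using mult_Lp_norm_le_iff[OF p, of "1 / C" M' g M f] C by (simp add: ennreal_inverse_mult_le_iff)
qed

lemma Lp_norm_infinity_le:
  assumes "f \<in> borel_measurable M" "AE x in M. ennreal (cmod (f x)) \<le> c"
  shows "Lp_norm M \<infinity> f \<le> c"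
  using assms by (auto simp: Lp_norm_def intro!: esssup_I)

lemma Lp_norm_infinity_AE: "AE x in M. ennreal (cmod (f x)) \<le> Lp_norm M \<infinity> f"
  unfolding Lp_norm_def by (simp add: esssup_AE)

lemma lp_norm_infinity_ge: "ennreal (cmod (c n)) \<le> lp_norm \<infinity> c"
  using Lp_norm_infinity_AE[where M = "count_space UNIV" and f = c] by (simp add: AE_count_space)

lemma lp_norm_infinity_le:
  assumes "\<And>n. ennreal (cmod (c n)) \<le> B"
  shows "lp_norm \<infinity> c \<le> B"
  using assms by (intro Lp_norm_infinity_le) auto

lemma lp_space_finite_mass:
  assumes p: "1 \<le> p" "p \<noteq> \<infinity>" and c: "c \<in> lp_space p"
  shows "Lp_mass (count_space UNIV) (enn2real p) c < \<infinity>"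
  using c unfolding lp_space_def by (auto simp: Lp_norm_finite_exponent[OF p(2)] less_top[symmetric] split: if_splits)

lemma lp_space_bounded:
  assumes p: "1 \<le> p" and c: "c \<in> lp_space p"
  obtains B where "B > 0" "\<And>n. cmod (c n) \<le> B"
proof (cases "p = \<infinity>")
  case True
  then obtain b where b: "b \<ge> 0" "lp_norm \<infinity> c = ennreal b"
    using c unfolding lp_space_def by (cases "lp_norm \<infinity> c") auto
  have "cmod (c n) \<le> b" for n
    using lp_norm_infinity_ge[of c n] b by simp
  then show ?thesis using that[of "b + 1"] b by (smt (verit))
next
  case False
  define r where "r = enn2real p"
  have r: "r \<ge> 1" using enn2real_ge_1[OF p False] by (simp add: r_def)
  obtain I where I: "I \<ge> 0" "Lp_mass (count_space UNIV) r c = ennreal I"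
    using lp_space_finite_mass[OF p False c] unfolding r_def by (cases "Lp_mass (count_space UNIV) (enn2real p) c") auto
  have "cmod (c n) \<le> I powr (1 / r)" for n
  proof -
    have "ennreal (cmod (c n) powr r) = (\<integral>\<^sup>+m. ennreal (cmod (c m) powr r) * indicator {n} m \<partial>count_space UNIV)"
      by (subst nn_integral_indicator_singleton) auto
    also have "\<dots> \<le> ennreal I"
      unfolding I(2)[symmetric] Lp_mass_def by (intro nn_integral_mono) (auto simp: indicator_def)
    finally have "cmod (c n) powr r \<le> I" using I by simp
    then have "(cmod (c n) powr r) powr (1 / r) \<le> I powr (1 / r)"
      using r by (intro powr_mono2) auto
    then show ?thesis using r by (simp add: powr_powr)
  qed
  then show ?thesis using that[of "I powr (1 / r) + 1"] by (smt (verit) powr_ge_zero)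
qed

section \<open>Series of integer shifts\<close>

lemma has_sum_finite_sum:
  fixes f :: "'a \<Rightarrow> 'b \<Rightarrow> 'c::{topological_comm_monoid_add}"
  assumes "finite X" "\<And>x. x \<in> X \<Longrightarrow> (f x has_sum s x) A"
  shows "((\<lambda>n. \<Sum>x\<in>X. f x n) has_sum (\<Sum>x\<in>X. s x)) A"
  using assms by (induction X rule: finite_induct) (auto intro!: has_sum_add)

definition cell_sum :: real where
  "cell_sum = infsum (\<lambda>n::int. exp (- \<bar>real_of_int n\<bar>)) UNIV"

lemma exp_abs_summable: "(\<lambda>n::int. exp (- \<bar>real_of_int n\<bar>)) summable_on UNIV"
  using summable_on_int_exp_neg_abs[of 1] by simp

lemma cell_sum_pos: "cell_sum > 0"
proof -
  have "infsum (\<lambda>n::int. exp (- \<bar>real_of_int n\<bar>)) {0} \<le> cell_sum"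
    unfolding cell_sum_def by (rule infsum_mono2) (use exp_abs_summable in auto)
  then show ?thesis by simp
qed

lemma nn_integral_int_shift:
  fixes h :: "int \<Rightarrow> ennreal"
  shows "(\<integral>\<^sup>+n. h (n - m) \<partial>count_space UNIV) = (\<integral>\<^sup>+n. h n \<partial>count_space UNIV)"
    "(\<integral>\<^sup>+n. h (n + m) \<partial>count_space UNIV) = (\<integral>\<^sup>+n. h n \<partial>count_space UNIV)"
    "(\<integral>\<^sup>+n. h (m - n) \<partial>count_space UNIV) = (\<integral>\<^sup>+n. h n \<partial>count_space UNIV)"
proof -
  have "bij (\<lambda>n::int. n - m)" by (rule bij_betw_byWitness[of _ "\<lambda>n. n + m"]) auto
  then show "(\<integral>\<^sup>+n. h (n - m) \<partial>count_space UNIV) = (\<integral>\<^sup>+n. h n \<partial>count_space UNIV)"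
    by (rule nn_integral_bij_count_space)
  have "bij (\<lambda>n::int. n + m)" by (rule bij_betw_byWitness[of _ "\<lambda>n. n - m"]) auto
  then show "(\<integral>\<^sup>+n. h (n + m) \<partial>count_space UNIV) = (\<integral>\<^sup>+n. h n \<partial>count_space UNIV)"
    by (rule nn_integral_bij_count_space)
  have "bij (\<lambda>n::int. m - n)" by (rule bij_betw_byWitness[of _ "\<lambda>n. m - n"]) auto
  then show "(\<integral>\<^sup>+n. h (m - n) \<partial>count_space UNIV) = (\<integral>\<^sup>+n. h n \<partial>count_space UNIV)"
    by (rule nn_integral_bij_count_space)
qed

lemma cell_sum_nn: "(\<integral>\<^sup>+n. ennreal (exp (- \<bar>real_of_int n\<bar>)) \<partial>count_space UNIV) = ennreal cell_sum"
  unfolding cell_sum_def by (rule ennreal_infsum_eq_nn_integral[symmetric, OF exp_abs_summable]) auto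

lemma exp_floor_le: "exp (- \<bar>x - real_of_int n\<bar>) \<le> exp 1 * exp (- \<bar>real_of_int (\<lfloor>x\<rfloor> - n)\<bar>)"
proof -
  have "\<bar>real_of_int (\<lfloor>x\<rfloor> - n)\<bar> \<le> \<bar>x - real_of_int n\<bar> + 1" by linarith
  then show ?thesis by (simp flip: exp_add)
qed

lemma sigma_finite_count_int: "sigma_finite_measure (count_space (UNIV :: int set))"
  by (rule sigma_finite_measure_count_space)

text \<open>
The estimates for series of shifts use the generator on the real line only, and only its decay.
Exponential decay is far less than the generators have, but it is convenient to sum.
\<close>

locale decaying_generator =
  fixes G :: "complex \<Rightarrow> complex" and CG :: real
  assumes G_meas: "(\<lambda>x::real. G (of_real x)) \<in> borel_measurable borel"
    and G_decay: "\<And>x::real. cmod (G (of_real x)) \<le> CG * exp (- \<bar>x\<bar>)"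
    and CG: "CG > 0"
begin

definition amalgam_bound :: real where "amalgam_bound = CG * (exp 1 * cell_sum)"

lemma amalgam_bound_pos: "amalgam_bound > 0" using CG cell_sum_pos by (simp add: amalgam_bound_def)

lemma G_floor: "cmod (G (of_real (x - of_int n))) \<le> CG * exp 1 * exp (- \<bar>real_of_int (\<lfloor>x\<rfloor> - n)\<bar>)"
proof -
  have "CG * exp (- \<bar>x - real_of_int n\<bar>) \<le> CG * (exp 1 * exp (- \<bar>real_of_int (\<lfloor>x\<rfloor> - n)\<bar>))"
    using CG by (intro mult_left_mono exp_floor_le) auto
  then show ?thesis using G_decay[of "x - of_int n"] by (simp add: mult.assoc)
qed

lemma row_bound: "(\<integral>\<^sup>+n. ennreal (cmod (G (of_real (x - of_int n)))) \<partial>count_space UNIV) \<le> ennreal amalgam_bound"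
proof -
  have "(\<integral>\<^sup>+n. ennreal (cmod (G (of_real (x - of_int n)))) \<partial>count_space UNIV)
     \<le> (\<integral>\<^sup>+n. ennreal (CG * exp 1) * ennreal (exp (- \<bar>real_of_int (\<lfloor>x\<rfloor> - n)\<bar>)) \<partial>count_space UNIV)"
    using G_floor[of x] CG by (intro nn_integral_mono) (simp add: ennreal_leI flip: ennreal_mult)
  also have "\<dots> = ennreal (CG * exp 1) * (\<integral>\<^sup>+n. ennreal (exp (- \<bar>real_of_int (\<lfloor>x\<rfloor> - n)\<bar>)) \<partial>count_space UNIV)"
    by (rule nn_integral_cmult) simp
  also have "(\<integral>\<^sup>+n. ennreal (exp (- \<bar>real_of_int (\<lfloor>x\<rfloor> - n)\<bar>)) \<partial>count_space UNIV) = ennreal cell_sum"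
    using nn_integral_int_shift(3)[where h = "\<lambda>n. ennreal (exp (- \<bar>real_of_int n\<bar>))" and m = "\<lfloor>x\<rfloor>"]
    by (simp add: cell_sum_nn)
  finally show ?thesis using CG cell_sum_pos by (simp add: amalgam_bound_def mult.assoc flip: ennreal_mult)
qed

lemma col_bound:
  assumes M: "sigma_finite_measure M" and cb: "cell_bounded M x \<nu>"
  shows "(\<integral>\<^sup>+i. ennreal (cmod (G (of_real (x i - of_int n)))) \<partial>M) \<le> ennreal (\<nu> * amalgam_bound)"
proof -
  have nu: "\<nu> \<ge> 0" using cb by (simp add: cell_bounded_def)
  have "(\<integral>\<^sup>+i. ennreal (cmod (G (of_real (x i - of_int n)))) \<partial>M)
     \<le> (\<integral>\<^sup>+i. ennreal (CG * exp 1 * exp (- \<bar>real_of_int (\<lfloor>x i\<rfloor> - n)\<bar>)) \<partial>M)"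
    using G_floor by (intro nn_integral_mono ennreal_leI) auto
  also have "\<dots> \<le> ennreal \<nu> * (\<integral>\<^sup>+m. ennreal (CG * exp 1 * exp (- \<bar>real_of_int (m - n)\<bar>)) \<partial>count_space UNIV)"
    by (rule nn_integral_cell_bounded[OF M cb])
  also have "(\<integral>\<^sup>+m. ennreal (CG * exp 1 * exp (- \<bar>real_of_int (m - n)\<bar>)) \<partial>count_space UNIV)
      = (\<integral>\<^sup>+m. ennreal (CG * exp 1) * ennreal (exp (- \<bar>real_of_int m\<bar>)) \<partial>count_space UNIV)"
    using nn_integral_int_shift(1)[where h = "\<lambda>m. ennreal (CG * exp 1 * exp (- \<bar>real_of_int m\<bar>))" and m = n] CG
    by (simp add: ennreal_mult)
  also have "\<dots> = ennreal (CG * exp 1) * ennreal cell_sum"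
    by (subst nn_integral_cmult) (simp_all add: cell_sum_nn)
  finally show ?thesis
    using CG cell_sum_pos nu by (simp add: amalgam_bound_def mult.assoc flip: ennreal_mult)
qed

context
  fixes c :: "int \<Rightarrow> complex" and Bc :: real
  assumes Bc: "\<And>n. cmod (c n) \<le> Bc"
begin

lemma Bc_nonneg: "Bc \<ge> 0" using Bc[of 0] norm_ge_zero order_trans by blast

lemma series_abs_summable: "(\<lambda>n. norm (c n * G (of_real (x - of_int n)))) summable_on UNIV"
proof -
  have "(\<lambda>n::int. exp (- \<bar>real_of_int (\<lfloor>x\<rfloor> - n)\<bar>)) summable_on UNIV"
  proof -
    have bij: "bij (\<lambda>n::int. \<lfloor>x\<rfloor> - n)"
      by (rule bij_betw_byWitness[of _ "\<lambda>n. \<lfloor>x\<rfloor> - n"]) auto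
    show ?thesis
      using summable_on_reindex_bij_betw[OF bij, of "\<lambda>n. exp (- \<bar>real_of_int n\<bar>)"] exp_abs_summable by simp
  qed
  then have "(\<lambda>n::int. Bc * (CG * exp 1) * exp (- \<bar>real_of_int (\<lfloor>x\<rfloor> - n)\<bar>)) summable_on UNIV"
    by (rule summable_on_cmult_right)
  then show ?thesis
  proof (rule summable_on_comparison_test)
    fix n
    have "cmod (c n) * cmod (G (of_real (x - of_int n))) \<le> Bc * (CG * exp 1 * exp (- \<bar>real_of_int (\<lfloor>x\<rfloor> - n)\<bar>))"
      by (intro mult_mono Bc G_floor Bc_nonneg) auto
    then show "norm (c n * G (of_real (x - of_int n))) \<le> Bc * (CG * exp 1) * exp (- \<bar>real_of_int (\<lfloor>x\<rfloor> - n)\<bar>)"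
      by (simp add: norm_mult mult_ac)
  qed auto
qed

lemma series_summable: "(\<lambda>n. c n * G (of_real (x - of_int n))) summable_on UNIV"
  using series_abs_summable by (rule abs_summable_summable)

lemma series_norm_le:
  "ennreal (cmod (shift_series G c x)) \<le> (\<integral>\<^sup>+n. ennreal (cmod (G (of_real (x - of_int n))) * cmod (c n)) \<partial>count_space UNIV)"
proof -
  have "cmod (shift_series G c x) \<le> infsum (\<lambda>n. norm (c n * G (of_real (x - of_int n)))) UNIV"
    unfolding shift_series_def by (rule norm_infsum_bound[OF series_abs_summable])
  then have "ennreal (cmod (shift_series G c x)) \<le> ennreal (infsum (\<lambda>n. norm (c n * G (of_real (x - of_int n)))) UNIV)"
    by (rule ennreal_leI)
  also have "\<dots> = (\<integral>\<^sup>+n. ennreal (norm (c n * G (of_real (x - of_int n)))) \<partial>count_space UNIV)"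
    by (rule ennreal_infsum_eq_nn_integral[OF series_abs_summable]) auto
  finally show ?thesis by (simp add: norm_mult mult.commute)
qed

lemma series_measurable: "shift_series G c \<in> borel_measurable borel"
proof (rule borel_measurable_LIMSEQ_metric)
  fix k :: nat
  show "(\<lambda>x. \<Sum>n\<in>{-int k..int k}. c n * G (of_real (x - of_int n))) \<in> borel_measurable borel"
  proof (intro borel_measurable_sum borel_measurable_times borel_measurable_const)
    fix n :: int
    have "(\<lambda>x::real. x - of_int n) \<in> borel_measurable borel" by measurable
    then show "(\<lambda>x. G (complex_of_real (x - of_int n))) \<in> borel_measurable borel"
      by (rule measurable_compose[OF _ G_meas])
  qed
next
  fix x :: real
  have lim: "filterlim (\<lambda>k::nat. {-int k..int k}) (finite_subsets_at_top UNIV) sequentially"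
    unfolding filterlim_finite_subsets_at_top
  proof safe
    fix Y :: "int set" assume Y: "finite Y"
    obtain b where b: "\<And>y. y \<in> Y \<Longrightarrow> \<bar>y\<bar> \<le> b"
      using Y by (meson finite_imageI imageI Max_ge finite_nat_set_iff_bounded_le[of "(\<lambda>y. nat \<bar>y\<bar>) ` Y"] nat_le_iff)
    show "\<forall>\<^sub>F k in sequentially. finite {-int k..int k} \<and> Y \<subseteq> {-int k..int k} \<and> {-int k..int k} \<subseteq> UNIV"
      using eventually_ge_at_top[of "nat b"]
    proof eventually_elim
      case (elim k)
      have "- int k \<le> y \<and> y \<le> int k" if "y \<in> Y" for y
        using b[OF that] elim by linarith
      then show ?case by auto
    qed
  qed
  have "((\<lambda>n. c n * G (of_real (x - of_int n))) has_sum shift_series G c x) UNIV"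
    unfolding shift_series_def using series_summable by (rule has_sum_infsum)
  then have "(sum (\<lambda>n. c n * G (of_real (x - of_int n))) \<longlongrightarrow> shift_series G c x) (finite_subsets_at_top UNIV)"
    by (simp add: has_sum_def)
  from filterlim_compose[OF this lim]
  show "(\<lambda>k. \<Sum>n\<in>{-int k..int k}. c n * G (of_real (x - of_int n))) \<longlonglongrightarrow> shift_series G c x" .
qed

lemma series_bounded: "cmod (shift_series G c x) \<le> amalgam_bound * Bc"
proof -
  have "ennreal (cmod (shift_series G c x)) \<le> (\<integral>\<^sup>+n. ennreal (cmod (G (of_real (x - of_int n))) * cmod (c n)) \<partial>count_space UNIV)"
    by (rule series_norm_le)
  also have "\<dots> \<le> (\<integral>\<^sup>+n. ennreal (cmod (G (of_real (x - of_int n)))) * ennreal Bc \<partial>count_space UNIV)"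
    using Bc Bc_nonneg by (intro nn_integral_mono) (simp add: ennreal_leI mult_left_mono flip: ennreal_mult)
  also have "\<dots> = (\<integral>\<^sup>+n. ennreal (cmod (G (of_real (x - of_int n)))) \<partial>count_space UNIV) * ennreal Bc"
    by (rule nn_integral_multc) simp
  also have "\<dots> \<le> ennreal amalgam_bound * ennreal Bc"
    by (intro mult_right_mono row_bound) auto
  also have "\<dots> = ennreal (amalgam_bound * Bc)" using amalgam_bound_pos Bc_nonneg by (simp add: ennreal_mult)
  finally show ?thesis using amalgam_bound_pos Bc_nonneg by simp
qed

text \<open>
Schur's test with the kernel \<open>|G (x - n)|\<close>, whose rows and columns are bounded because of the decay.
With Lebesgue measure this is the upper stability bound, with counting measure on a separated set the
upper sampling bound.
\<close>

lemma series_upper: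
  assumes M: "sigma_finite_measure M" and cb: "cell_bounded M x \<nu>" and r: "r \<ge> 1"
  shows "(\<integral>\<^sup>+i. ennreal (cmod (shift_series G c (x i)) powr r) \<partial>M)
    \<le> ennreal (amalgam_bound powr (r - 1) * (\<nu> * amalgam_bound)) * Lp_mass (count_space UNIV) r c"
  unfolding Lp_mass_def
proof (rule schur_test[OF M sigma_finite_count_int, where k = "\<lambda>i n. cmod (G (of_real (x i - of_int n)))"])
  have [measurable]: "x \<in> borel_measurable M" using cb by (simp add: cell_bounded_def)
  show "(\<lambda>(i, n). cmod (G (of_real (x i - of_int n)))) \<in> borel_measurable (M \<Otimes>\<^sub>M count_space UNIV)"
  proof (rule measurable_pair_count_space2)
    fix n :: int
    have "(\<lambda>i. x i - of_int n) \<in> borel_measurable M" by measurable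
    from measurable_compose[OF this G_meas]
    show "(\<lambda>i. cmod (G (of_real (x i - of_int n)))) \<in> borel_measurable M" by measurable
  qed simp
  show "(\<integral>\<^sup>+i. ennreal (cmod (G (of_real (x i - of_int n)))) \<partial>M) \<le> ennreal (\<nu> * amalgam_bound)" for n
    by (rule col_bound[OF M cb])
  show "0 \<le> \<nu> * amalgam_bound" using cb amalgam_bound_pos by (simp add: cell_bounded_def)
qed (use row_bound amalgam_bound_pos r series_norm_le in auto)

lemma shift_series_translate:
  "shift_series G (\<lambda>n. c (n + m)) x = shift_series G c (x + of_int m)"
proof -
  have bij: "bij (\<lambda>n::int. n + m)" by (rule bij_betw_byWitness[of _ "\<lambda>n. n - m"]) auto
  show ?thesis
    unfolding shift_series_def
    using infsum_reindex_bij_betw[OF bij, of "\<lambda>n. c n * G (of_real (x + of_int m - of_int n))"]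
    by (simp add: algebra_simps)
qed

end

lemma quadrature_series:
  assumes Bc: "\<And>n. cmod (c n) \<le> Bc"
    and quad: "quadrature_rule G C rad e \<Lambda> t" and e: "small_error \<eta> e"
    and t: "(\<lambda>n. c n * t n) summable_on UNIV" and \<Lambda>: "finite (\<Lambda> \<inter> {-rad..rad})" and C: "C \<ge> 0"
  shows "cmod (infsum (\<lambda>n. c n * t n) UNIV)
    \<le> infsum (\<lambda>n. e n * cmod (c n)) UNIV + (\<Sum>x\<in>\<Lambda> \<inter> {-rad..rad}. C * cmod (shift_series G c x))"
    "(\<lambda>n. e n * cmod (c n)) summable_on UNIV"
proof -
  obtain X v where X: "finite X" "X \<subseteq> \<Lambda> \<inter> {-rad..rad}" "\<And>x. x \<in> X \<Longrightarrow> cmod (v x) \<le> C"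
    and ap: "\<And>n. cmod (t n - (\<Sum>x\<in>X. v x * G (of_real (x - of_int n)))) \<le> e n"
    using quad unfolding quadrature_rule_def by blast
  have e0: "e n \<ge> 0" for n using e by (simp add: small_error_def)
  have es: "e summable_on UNIV" using e by (simp add: small_error_def)
  have sum_e: "(\<lambda>n. e n * cmod (c n)) summable_on UNIV"
  proof (rule summable_on_comparison_test)
    show "(\<lambda>n. Bc * e n) summable_on UNIV" using es by (rule summable_on_cmult_right)
    show "e n * cmod (c n) \<le> Bc * e n" for n
      using mult_left_mono[OF Bc e0, of n n] by (simp add: mult.commute)
  qed (use e0 in auto)
  then show "(\<lambda>n. e n * cmod (c n)) summable_on UNIV" .
  define d where "d n = t n - (\<Sum>x\<in>X. v x * G (of_real (x - of_int n)))" for n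
  have dn: "norm (c n * d n) \<le> e n * cmod (c n)" for n
    using mult_left_mono[OF ap[of n], of "cmod (c n)"] by (simp add: norm_mult d_def mult.commute)
  have ds: "(\<lambda>n. norm (c n * d n)) summable_on UNIV"
    by (rule summable_on_comparison_test[OF sum_e dn]) auto
  have gs: "(\<lambda>n. c n * G (of_real (x - of_int n))) summable_on UNIV" for x
    by (rule series_summable[OF Bc])
  have G_sum: "((\<lambda>n. \<Sum>x\<in>X. v x * (c n * G (of_real (x - of_int n)))) has_sum (\<Sum>x\<in>X. v x * shift_series G c x)) UNIV"
    unfolding shift_series_def
  proof (rule has_sum_finite_sum[OF X(1)])
    fix x
    have "((\<lambda>n. c n * G (of_real (x - of_int n))) has_sum infsum (\<lambda>n. c n * G (of_real (x - of_int n))) UNIV) UNIV"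
      by (rule has_sum_infsum[OF gs])
    then show "((\<lambda>n. v x * (c n * G (of_real (x - of_int n)))) has_sum v x * infsum (\<lambda>n. c n * G (of_real (x - of_int n))) UNIV) UNIV"
      by (rule has_sum_cmult_right)
  qed
  have d_sum: "((\<lambda>n. c n * d n) has_sum infsum (\<lambda>n. c n * d n) UNIV) UNIV"
    by (rule has_sum_infsum[OF abs_summable_summable[OF ds]])
  have "((\<lambda>n. c n * d n + (\<Sum>x\<in>X. v x * (c n * G (of_real (x - of_int n))))) has_sum
      (infsum (\<lambda>n. c n * d n) UNIV + (\<Sum>x\<in>X. v x * shift_series G c x))) UNIV"
    by (rule has_sum_add[OF d_sum G_sum])
  moreover have "c n * d n + (\<Sum>x\<in>X. v x * (c n * G (of_real (x - of_int n)))) = c n * t n" for n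
    by (simp add: d_def right_diff_distrib sum_distrib_left mult_ac)
  ultimately have "infsum (\<lambda>n. c n * t n) UNIV = infsum (\<lambda>n. c n * d n) UNIV + (\<Sum>x\<in>X. v x * shift_series G c x)"
    by (simp add: infsumI)
  then have "cmod (infsum (\<lambda>n. c n * t n) UNIV) \<le> cmod (infsum (\<lambda>n. c n * d n) UNIV) + cmod (\<Sum>x\<in>X. v x * shift_series G c x)"
    by (metis norm_triangle_ineq)
  also have "cmod (infsum (\<lambda>n. c n * d n) UNIV) \<le> infsum (\<lambda>n. norm (c n * d n)) UNIV"
    by (rule norm_infsum_bound[OF ds])
  also have "\<dots> \<le> infsum (\<lambda>n. e n * cmod (c n)) UNIV"
    by (rule infsum_mono[OF ds sum_e dn])
  also have "cmod (\<Sum>x\<in>X. v x * shift_series G c x) \<le> (\<Sum>x\<in>X. C * cmod (shift_series G c x))"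
    by (intro sum_norm_le) (auto simp: norm_mult intro!: mult_right_mono X(3))
  also have "\<dots> \<le> (\<Sum>x\<in>\<Lambda> \<inter> {-rad..rad}. C * cmod (shift_series G c x))"
    by (rule sum_mono2[OF \<Lambda> X(2)]) (use C in auto)
  finally show "cmod (infsum (\<lambda>n. c n * t n) UNIV)
    \<le> infsum (\<lambda>n. e n * cmod (c n)) UNIV + (\<Sum>x\<in>\<Lambda> \<inter> {-rad..rad}. C * cmod (shift_series G c x))"
    by simp
qed

text \<open>
A rule for the translated set \<open>\<Lambda> - m\<close>, applied to the translated coefficients, in the form of a local
estimate: the errors are centred at \<open>m\<close>, and only nodes within \<open>rad\<close> of \<open>m\<close> enter.
\<close>

lemma quadrature_translate:
  assumes Bc: "\<And>n. cmod (c n) \<le> Bc" and C: "C \<ge> 0" and e: "small_error \<eta> e"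
    and quad: "quadrature_rule G C rad e ((\<lambda>x. x - of_int m) ` \<Lambda>) t"
    and t: "(\<lambda>n. c (n + m) * t n) summable_on UNIV"
    and \<Lambda>: "finite (\<Lambda> \<inter> {of_int m - rad..of_int m + rad})"
  shows "ennreal (cmod (infsum (\<lambda>n. c (n + m) * t n) UNIV))
    \<le> (\<integral>\<^sup>+n. ennreal (e (n - m) * cmod (c n)) \<partial>count_space UNIV)
      + (\<integral>\<^sup>+x. ennreal ((if \<bar>x - of_int m\<bar> \<le> rad then C else 0) * cmod (shift_series G c x)) \<partial>count_space \<Lambda>)"
proof -
  let ?L = "(\<lambda>x. x - of_int m) ` \<Lambda> \<inter> {-rad..rad}" and ?S = "\<Lambda> \<inter> {of_int m - rad..of_int m + rad}"
  have L: "?L = (\<lambda>x. x - of_int m) ` ?S" by force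
  have Bc': "\<And>n. cmod (c (n + m)) \<le> Bc" using Bc by auto
  have fin: "finite ?L" unfolding L using \<Lambda> by (rule finite_imageI)
  note q = quadrature_series[OF Bc' quad e t fin C]
  have e0: "e n \<ge> 0" for n using e by (simp add: small_error_def)
  have inf0: "infsum (\<lambda>n. e n * cmod (c (n + m))) UNIV \<ge> 0"
    by (intro infsum_nonneg) (use e0 in auto)
  have "(\<Sum>x\<in>?L. C * cmod (shift_series G (\<lambda>n. c (n + m)) x))
      = (\<Sum>x\<in>?S. C * cmod (shift_series G c x))"
  proof -
    have "shift_series G (\<lambda>n. c (n + m)) (x - of_int m) = shift_series G c x" for x
      by (subst shift_series_translate[OF Bc]) simp
    then show ?thesis unfolding L by (subst sum.reindex) (auto simp: inj_on_def)
  qed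
  with q(1) have "ennreal (cmod (infsum (\<lambda>n. c (n + m) * t n) UNIV))
     \<le> ennreal (infsum (\<lambda>n. e n * cmod (c (n + m))) UNIV + (\<Sum>x\<in>?S. C * cmod (shift_series G c x)))"
    by (intro ennreal_leI) simp
  also have "\<dots> = ennreal (infsum (\<lambda>n. e n * cmod (c (n + m))) UNIV) + ennreal (\<Sum>x\<in>?S. C * cmod (shift_series G c x))"
    using inf0 C by (intro ennreal_plus sum_nonneg) auto
  also have "ennreal (infsum (\<lambda>n. e n * cmod (c (n + m))) UNIV) = (\<integral>\<^sup>+n. ennreal (e n * cmod (c (n + m))) \<partial>count_space UNIV)"
    by (rule ennreal_infsum_eq_nn_integral[OF q(2)]) (use e0 in auto)
  also have "\<dots> = (\<integral>\<^sup>+n. ennreal (e (n - m) * cmod (c n)) \<partial>count_space UNIV)"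
    using nn_integral_int_shift(2)[where h = "\<lambda>n. ennreal (e (n - m) * cmod (c n))" and m = m] by simp
  also have "ennreal (\<Sum>x\<in>?S. C * cmod (shift_series G c x)) = (\<Sum>x\<in>?S. ennreal (C * cmod (shift_series G c x)))"
    using C by (intro sum_ennreal[symmetric]) auto
  also have "\<dots> = (\<integral>\<^sup>+x. ennreal (C * cmod (shift_series G c x)) \<partial>count_space ?S)"
    using \<Lambda> by (simp add: nn_integral_count_space_finite)
  also have "\<dots> = (\<integral>\<^sup>+x. ennreal (C * cmod (shift_series G c x)) * indicator ?S x \<partial>count_space \<Lambda>)"
    by (subst nn_integral_restrict_space[symmetric]) (auto simp: restrict_count_space_subset)
  also have "\<dots> = (\<integral>\<^sup>+x. ennreal ((if \<bar>x - of_int m\<bar> \<le> rad then C else 0) * cmod (shift_series G c x)) \<partial>count_space \<Lambda>)"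
    by (intro nn_integral_cong) (auto simp: indicator_def abs_le_iff)
  finally show ?thesis .
qed

end

section \<open>Norm estimates from local estimates\<close>

lemma ennreal_absorb:
  fixes X Y :: ennreal
  assumes "X < \<infinity>" "X \<le> ennreal a * X + Y" "0 \<le> a" "a \<le> 1 / 2"
  shows "X \<le> ennreal 2 * Y"
proof (cases "Y = \<infinity>")
  case True
  then show ?thesis by (simp add: ennreal_mult_top)
next
  case False
  obtain x where x: "x \<ge> 0" "X = ennreal x" using assms(1) by (cases X) auto
  obtain y where y: "y \<ge> 0" "Y = ennreal y" using False by (cases Y) auto
  have "x \<le> a * x + y"
    using assms(2,3) x y by (simp add: ennreal_mult[symmetric] ennreal_plus[symmetric] del: ennreal_plus)
  moreover have "a * x \<le> 1 / 2 * x" using assms(4) x by (intro mult_right_mono) auto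
  ultimately have "x \<le> 2 * y" by linarith
  then show ?thesis using x y by (simp add: ennreal_mult[symmetric] del: ennreal_numeral)
qed

lemma powr_add_le:
  fixes a b r :: real
  assumes "a \<ge> 0" "b \<ge> 0" "r \<ge> 1"
  shows "(a + b) powr r \<le> 2 powr r * (a powr r + b powr r)"
proof -
  have "(a + b) powr r \<le> (2 * max a b) powr r" using assms by (intro powr_mono2) auto
  also have "\<dots> = 2 powr r * max a b powr r" using assms by (simp add: powr_mult)
  also have "max a b powr r \<le> a powr r + b powr r" by (auto simp: max_def)
  finally show ?thesis by simp
qed

lemma int_window:
  assumes C: "C \<ge> 0" and rad: "rad \<ge> 0"
  shows "(\<integral>\<^sup>+m. ennreal (if \<bar>y - real_of_int m\<bar> \<le> rad then C else 0) \<partial>count_space UNIV) \<le> ennreal (C * (2 * rad + 1))"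
proof -
  let ?S = "{m::int. \<bar>y - real_of_int m\<bar> \<le> rad}"
  have im: "real_of_int ` ?S = range real_of_int \<inter> {y - rad..y + rad}" by (auto simp: abs_le_iff)
  have sep: "1 \<le> \<bar>a - b\<bar>" if "a \<in> range real_of_int" "b \<in> range real_of_int" "a \<noteq> b" for a b :: real
    using that by auto
  have fin: "finite ?S" and card: "real (card ?S) \<le> 2 * rad + 1"
  proof -
    note c = card_separated_interval[OF zero_less_one sep, where a = "y - rad" and b = "y + rad"]
    have "finite (real_of_int ` ?S)" unfolding im using c rad by simp
    then show "finite ?S" by (rule finite_imageD) (simp add: inj_on_def)
    have "card ?S = card (real_of_int ` ?S)" by (rule card_image[symmetric]) (simp add: inj_on_def)
    then show "real (card ?S) \<le> 2 * rad + 1" unfolding im using c(2) rad by simp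
  qed
  have "(\<integral>\<^sup>+m. ennreal (if \<bar>y - real_of_int m\<bar> \<le> rad then C else 0) \<partial>count_space UNIV)
     = (\<integral>\<^sup>+m. ennreal C * indicator ?S m \<partial>count_space UNIV)"
    by (intro nn_integral_cong) (auto simp: indicator_def)
  also have "\<dots> = ennreal C * ennreal (real (card ?S))"
    using fin by (simp add: nn_integral_cmult_indicator ennreal_of_nat_eq_real_of_nat)
  also have "\<dots> = ennreal (C * real (card ?S))" using C by (simp add: ennreal_mult)
  also have "\<dots> \<le> ennreal (C * (2 * rad + 1))" using C card by (intro ennreal_leI mult_left_mono)
  finally show ?thesis .
qed

text \<open>
Mass at most \<open>\<nu>\<close> in the windows of radius \<open>rad\<close> around the integers.
\<close>

definition window_bounded :: "'j measure \<Rightarrow> ('j \<Rightarrow> real) \<Rightarrow> real \<Rightarrow> real \<Rightarrow> bool" where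
  "window_bounded M y rad \<nu> \<longleftrightarrow> y \<in> borel_measurable M \<and> 0 < \<nu> \<and>
     (\<forall>m::int. (\<integral>\<^sup>+j. ennreal (if \<bar>y j - of_int m\<bar> \<le> rad then 1 else 0) \<partial>M) \<le> ennreal \<nu>)"

lemma window_scaled:
  assumes w: "window_bounded M y rad \<nu>" and C: "C \<ge> 0"
  shows "(\<integral>\<^sup>+j. ennreal (if \<bar>y j - of_int m\<bar> \<le> rad then C else 0) \<partial>M) \<le> ennreal (C * \<nu>)"
proof -
  have [measurable]: "y \<in> borel_measurable M" using w by (simp add: window_bounded_def)
  have "(\<integral>\<^sup>+j. ennreal (if \<bar>y j - of_int m\<bar> \<le> rad then C else 0) \<partial>M)
     = (\<integral>\<^sup>+j. ennreal C * ennreal (if \<bar>y j - of_int m\<bar> \<le> rad then 1 else 0) \<partial>M)"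
    by (intro nn_integral_cong) auto
  also have "\<dots> = ennreal C * (\<integral>\<^sup>+j. ennreal (if \<bar>y j - of_int m\<bar> \<le> rad then 1 else 0) \<partial>M)"
    by (rule nn_integral_cmult) measurable
  also have "\<dots> \<le> ennreal C * ennreal \<nu>"
    using w by (intro mult_left_mono) (auto simp: window_bounded_def)
  finally show ?thesis using w C by (simp add: ennreal_mult window_bounded_def)
qed

lemma error_row:
  assumes e: "small_error \<eta> e"
  shows "(\<integral>\<^sup>+n. ennreal (e (n - m)) \<partial>count_space UNIV) \<le> ennreal \<eta>"
    "(\<integral>\<^sup>+m. ennreal (e (n - m)) \<partial>count_space UNIV) \<le> ennreal \<eta>"
proof -
  have "(\<integral>\<^sup>+n. ennreal (e n) \<partial>count_space UNIV) = ennreal (infsum e UNIV)"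
    using e by (intro ennreal_infsum_eq_nn_integral[symmetric]) (auto simp: small_error_def)
  also have "\<dots> \<le> ennreal \<eta>" using e by (intro ennreal_leI) (simp add: small_error_def)
  finally have *: "(\<integral>\<^sup>+n. ennreal (e n) \<partial>count_space UNIV) \<le> ennreal \<eta>" .
  show "(\<integral>\<^sup>+n. ennreal (e (n - m)) \<partial>count_space UNIV) \<le> ennreal \<eta>"
    using nn_integral_int_shift(1)[where h = "\<lambda>n. ennreal (e n)" and m = m] * by simp
  show "(\<integral>\<^sup>+m. ennreal (e (n - m)) \<partial>count_space UNIV) \<le> ennreal \<eta>"
    using nn_integral_int_shift(3)[where h = "\<lambda>n. ennreal (e n)" and m = n] * by simp
qed

text \<open>
The case \<open>p = \<infinity>\<close>: rows of both kernels have bounded mass.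
\<close>

lemma sup_bound_of_local_bound:
  assumes e: "small_error \<eta> e" and w: "window_bounded M2 y rad \<nu>" and C: "C \<ge> 0"
    and c: "\<And>n. ennreal (cmod (c n)) \<le> X" and g: "AE j in M2. ennreal (g j) \<le> Y"
    and pos: "\<And>j. g j \<ge> 0"
  shows "(\<integral>\<^sup>+n. ennreal (e (n - m) * cmod (c n)) \<partial>count_space UNIV)
      + (\<integral>\<^sup>+j. ennreal ((if \<bar>y j - of_int m\<bar> \<le> rad then C else 0) * g j) \<partial>M2)
     \<le> ennreal \<eta> * X + ennreal (C * \<nu>) * Y"
proof (rule add_mono)
  have [measurable]: "y \<in> borel_measurable M2" using w by (simp add: window_bounded_def)
  have e0: "e n \<ge> 0" for n using e by (simp add: small_error_def)
  have "(\<integral>\<^sup>+n. ennreal (e (n - m) * cmod (c n)) \<partial>count_space UNIV) \<le> (\<integral>\<^sup>+n. ennreal (e (n - m)) * X \<partial>count_space UNIV)"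
    using c e0 by (intro nn_integral_mono) (simp add: ennreal_mult mult_left_mono)
  also have "\<dots> = (\<integral>\<^sup>+n. ennreal (e (n - m)) \<partial>count_space UNIV) * X"
    by (rule nn_integral_multc) simp
  also have "\<dots> \<le> ennreal \<eta> * X" by (intro mult_right_mono error_row[OF e]) auto
  finally show "(\<integral>\<^sup>+n. ennreal (e (n - m) * cmod (c n)) \<partial>count_space UNIV) \<le> ennreal \<eta> * X" .
  have "(\<integral>\<^sup>+j. ennreal ((if \<bar>y j - of_int m\<bar> \<le> rad then C else 0) * g j) \<partial>M2)
     \<le> (\<integral>\<^sup>+j. ennreal (if \<bar>y j - of_int m\<bar> \<le> rad then C else 0) * Y \<partial>M2)"
    using g C pos by (intro nn_integral_mono_AE) (auto elim!: eventually_mono simp: ennreal_mult mult_left_mono)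
  also have "\<dots> = (\<integral>\<^sup>+j. ennreal (if \<bar>y j - of_int m\<bar> \<le> rad then C else 0) \<partial>M2) * Y"
    by (rule nn_integral_multc) measurable
  also have "\<dots> \<le> ennreal (C * \<nu>) * Y" by (intro mult_right_mono window_scaled[OF w C]) auto
  finally show "(\<integral>\<^sup>+j. ennreal ((if \<bar>y j - of_int m\<bar> \<le> rad then C else 0) * g j) \<partial>M2) \<le> ennreal (C * \<nu>) * Y" .
qed

text \<open>
The case of finite \<open>p\<close>: Schur's test for each of the two kernels.  The factor in front of the mass of
\<open>c\<close> becomes small with \<open>\<eta>\<close>, so this term can later be absorbed.
\<close>

lemma mass_bound_of_local_bound:
  fixes F :: "'i \<Rightarrow> real" and g :: "'j \<Rightarrow> real"
  assumes e: "small_error \<eta> e" and \<eta>: "\<eta> > 0" and C: "C > 0" and rad: "rad > 0" and r: "r \<ge> 1"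
    and M1: "sigma_finite_measure M1" "cell_bounded M1 x 1"
    and M2: "sigma_finite_measure M2" "window_bounded M2 y rad \<nu>"
    and g: "g \<in> borel_measurable M2" "\<And>j. 0 \<le> g j" "\<And>j. g j \<le> Bg"
    and Bc: "\<And>n. cmod (c n) \<le> Bc"
    and F: "\<And>i. i \<in> space M1 \<Longrightarrow> 0 \<le> F i"
      "\<And>i. i \<in> space M1 \<Longrightarrow> ennreal (F i) \<le>
         (\<integral>\<^sup>+n. ennreal (e (n - \<lfloor>x i\<rfloor>) * cmod (c n)) \<partial>count_space UNIV)
         + (\<integral>\<^sup>+j. ennreal ((if \<bar>y j - of_int \<lfloor>x i\<rfloor>\<bar> \<le> rad then C else 0) * g j) \<partial>M2)"
  shows "(\<integral>\<^sup>+i. ennreal (F i powr r) \<partial>M1) \<le> ennreal (2 powr r) *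
      (ennreal (\<eta> powr r) * Lp_mass (count_space UNIV) r c
       + ennreal ((C * \<nu>) powr (r - 1) * (C * (2 * rad + 1))) * (\<integral>\<^sup>+j. ennreal (g j powr r) \<partial>M2))"
proof -
  have x[measurable]: "x \<in> borel_measurable M1" using M1 by (simp add: cell_bounded_def)
  have y[measurable]: "y \<in> borel_measurable M2" and \<nu>: "\<nu> > 0" using M2 by (auto simp: window_bounded_def)
  note [measurable] = g(1)
  have e0: "e n \<ge> 0" for n using e by (simp add: small_error_def)
  define a where "a m = (\<integral>\<^sup>+n. ennreal (e (n - m) * cmod (c n)) \<partial>count_space UNIV)" for m
  define b where "b m = (\<integral>\<^sup>+j. ennreal ((if \<bar>y j - of_int m\<bar> \<le> rad then C else 0) * g j) \<partial>M2)" for m :: int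
  have "a m + b m \<le> ennreal \<eta> * ennreal Bc + ennreal (C * \<nu>) * ennreal Bg" for m
    unfolding a_def b_def
    by (rule sup_bound_of_local_bound[OF e M2(2)]) (use C Bc g in \<open>auto intro!: ennreal_leI\<close>)
  then have "a m + b m < \<infinity>" for m
    by (rule le_less_trans) (simp add: ennreal_mult_less_top)
  then have fin: "a m < \<infinity>" "b m < \<infinity>" for m by auto
  define a' where "a' m = enn2real (a m)" for m
  define b' where "b' m = enn2real (b m)" for m
  have a': "ennreal (a' m) = a m" "a' m \<ge> 0" for m using fin(1)[of m] by (auto simp: a'_def)
  have b': "ennreal (b' m) = b m" "b' m \<ge> 0" for m using fin(2)[of m] by (auto simp: b'_def)
  have floor_meas: "(\<lambda>i. \<lfloor>x i\<rfloor>) \<in> measurable M1 (count_space UNIV)" by measurable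
  have hm[measurable]: "(\<lambda>i. h \<lfloor>x i\<rfloor>) \<in> borel_measurable M1" for h :: "int \<Rightarrow> ennreal"
    by (rule measurable_compose[OF floor_meas]) simp
  have "(\<integral>\<^sup>+i. ennreal (F i powr r) \<partial>M1)
     \<le> (\<integral>\<^sup>+i. ennreal (2 powr r) * (ennreal (a' \<lfloor>x i\<rfloor> powr r) + ennreal (b' \<lfloor>x i\<rfloor> powr r)) \<partial>M1)"
  proof (rule nn_integral_mono)
    fix i assume i: "i \<in> space M1"
    have "ennreal (F i) \<le> ennreal (a' \<lfloor>x i\<rfloor>) + ennreal (b' \<lfloor>x i\<rfloor>)"
      using F(2)[OF i] unfolding a' b' a_def b_def .
    then have "F i \<le> a' \<lfloor>x i\<rfloor> + b' \<lfloor>x i\<rfloor>"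
      using a'(2) b'(2) by (simp add: ennreal_plus[symmetric] del: ennreal_plus)
    then have "F i powr r \<le> (a' \<lfloor>x i\<rfloor> + b' \<lfloor>x i\<rfloor>) powr r"
      using F(1)[OF i] r by (intro powr_mono2) auto
    also have "\<dots> \<le> 2 powr r * (a' \<lfloor>x i\<rfloor> powr r + b' \<lfloor>x i\<rfloor> powr r)"
      by (rule powr_add_le[OF a'(2) b'(2) r])
    finally show "ennreal (F i powr r) \<le> ennreal (2 powr r) * (ennreal (a' \<lfloor>x i\<rfloor> powr r) + ennreal (b' \<lfloor>x i\<rfloor> powr r))"
      by (simp add: ennreal_leI flip: ennreal_mult ennreal_plus)
  qed
  also have "\<dots> = ennreal (2 powr r) * ((\<integral>\<^sup>+i. ennreal (a' \<lfloor>x i\<rfloor> powr r) \<partial>M1) + (\<integral>\<^sup>+i. ennreal (b' \<lfloor>x i\<rfloor> powr r) \<partial>M1))"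
    by (subst nn_integral_cmult) (auto simp: nn_integral_add)
  also have "\<dots> \<le> ennreal (2 powr r) * (ennreal (\<eta> powr (r - 1) * \<eta>) * Lp_mass (count_space UNIV) r c
       + ennreal ((C * \<nu>) powr (r - 1) * (C * (2 * rad + 1))) * (\<integral>\<^sup>+j. ennreal (g j powr r) \<partial>M2))"
  proof (intro mult_left_mono add_mono)
    show "(\<integral>\<^sup>+i. ennreal (a' \<lfloor>x i\<rfloor> powr r) \<partial>M1) \<le> ennreal (\<eta> powr (r - 1) * \<eta>) * Lp_mass (count_space UNIV) r c"
      unfolding Lp_mass_def
    proof (rule schur_test[OF M1(1) sigma_finite_count_int, where k = "\<lambda>i n. e (n - \<lfloor>x i\<rfloor>)"])
      show "(\<lambda>(i, n). e (n - \<lfloor>x i\<rfloor>)) \<in> borel_measurable (M1 \<Otimes>\<^sub>M count_space UNIV)"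
        by (rule measurable_pair_count_space2) (auto intro!: measurable_compose[OF floor_meas])
      show "(\<integral>\<^sup>+i. ennreal (e (n - \<lfloor>x i\<rfloor>)) \<partial>M1) \<le> ennreal \<eta>" for n
        using nn_integral_cell_bounded[OF M1, of "\<lambda>m. ennreal (e (n - m))"] error_row(2)[OF e, of n]
        by simp
      show "ennreal (a' \<lfloor>x i\<rfloor>) \<le> (\<integral>\<^sup>+n. ennreal (e (n - \<lfloor>x i\<rfloor>) * cmod (c n)) \<partial>count_space UNIV)" for i
        unfolding a' a_def by simp
    qed (use e0 \<eta> r a'(2) error_row(1)[OF e] in auto)
    show "(\<integral>\<^sup>+i. ennreal (b' \<lfloor>x i\<rfloor> powr r) \<partial>M1)
       \<le> ennreal ((C * \<nu>) powr (r - 1) * (C * (2 * rad + 1))) * (\<integral>\<^sup>+j. ennreal (g j powr r) \<partial>M2)"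
    proof (rule schur_test[OF M1(1) M2(1), where k = "\<lambda>i j. if \<bar>y j - of_int \<lfloor>x i\<rfloor>\<bar> \<le> rad then C else 0"])
      show "(\<lambda>(i, j). if \<bar>y j - of_int \<lfloor>x i\<rfloor>\<bar> \<le> rad then C else 0) \<in> borel_measurable (M1 \<Otimes>\<^sub>M M2)"
        unfolding case_prod_beta' by measurable
      show "(\<integral>\<^sup>+j. ennreal (if \<bar>y j - of_int \<lfloor>x i\<rfloor>\<bar> \<le> rad then C else 0) \<partial>M2) \<le> ennreal (C * \<nu>)" for i
        using window_scaled[OF M2(2), of C] C by simp
      show "(\<integral>\<^sup>+i. ennreal (if \<bar>y j - of_int \<lfloor>x i\<rfloor>\<bar> \<le> rad then C else 0) \<partial>M1) \<le> ennreal (C * (2 * rad + 1))" for j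
        using nn_integral_cell_bounded[OF M1, of "\<lambda>m. ennreal (if \<bar>y j - of_int m\<bar> \<le> rad then C else 0)"]
          int_window[of C rad "y j"] C rad by simp
      show "ennreal (b' \<lfloor>x i\<rfloor>) \<le> (\<integral>\<^sup>+j. ennreal ((if \<bar>y j - of_int \<lfloor>x i\<rfloor>\<bar> \<le> rad then C else 0) * g j) \<partial>M2)" for i
        unfolding b' b_def by simp
    qed (use C \<nu> rad r b'(2) g in auto)
  qed auto
  also have "\<eta> powr (r - 1) * \<eta> = \<eta> powr r" using \<eta> powr_mult_base[of \<eta> "r - 1"] by (simp add: mult.commute)
  finally show ?thesis .
qed

lemma sigma_finite_count_countable: "countable A \<Longrightarrow> sigma_finite_measure (count_space A)"
  by (rule sigma_finite_measure_count_space_countable)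

lemma window_bounded_separated:
  assumes \<delta>: "\<delta> > 0" and sep: "\<And>x y. x \<in> \<Lambda> \<Longrightarrow> y \<in> \<Lambda> \<Longrightarrow> x \<noteq> y \<Longrightarrow> \<delta> \<le> \<bar>x - y\<bar>" and rad: "rad \<ge> 0"
  shows "window_bounded (count_space \<Lambda>) (\<lambda>x. x) rad (2 * rad / \<delta> + 1)"
proof -
  have "(\<integral>\<^sup>+x. ennreal (if \<bar>x - of_int m\<bar> \<le> rad then 1 else 0) \<partial>count_space \<Lambda>) \<le> ennreal (2 * rad / \<delta> + 1)" for m :: int
  proof -
    let ?S = "\<Lambda> \<inter> {of_int m - rad..of_int m + rad}"
    have c: "finite ?S" "real (card ?S) \<le> 2 * rad / \<delta> + 1"
      using card_separated_interval[OF \<delta> sep, where a = "of_int m - rad" and b = "of_int m + rad"] rad by auto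
    have "(\<integral>\<^sup>+x. ennreal (if \<bar>x - of_int m\<bar> \<le> rad then 1 else 0) \<partial>count_space \<Lambda>)
        = (\<integral>\<^sup>+x. indicator ?S x \<partial>count_space \<Lambda>)"
      by (intro nn_integral_cong) (auto simp: indicator_def abs_le_iff)
    also have "\<dots> = emeasure (count_space \<Lambda>) ?S" by (rule nn_integral_indicator) simp
    also have "\<dots> = ennreal (real (card ?S))" using c by (simp add: emeasure_count_space_finite ennreal_of_nat_eq_real_of_nat)
    also have "\<dots> \<le> ennreal (2 * rad / \<delta> + 1)" using c by (intro ennreal_leI)
    finally show ?thesis .
  qed
  moreover have "2 * rad / \<delta> + 1 > 0" using \<delta> rad by (simp add: add_nonneg_pos)
  ultimately show ?thesis by (simp add: window_bounded_def)
qed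

lemma window_bounded_lborel:
  assumes "rad > 0"
  shows "window_bounded lborel (\<lambda>x. x) rad (2 * rad)"
proof -
  have "(\<integral>\<^sup>+x. ennreal (if \<bar>x - of_int m\<bar> \<le> rad then 1 else 0) \<partial>lborel) \<le> ennreal (2 * rad)" for m :: int
  proof -
    have "(\<integral>\<^sup>+x. ennreal (if \<bar>x - of_int m\<bar> \<le> rad then 1 else 0) \<partial>lborel)
        = (\<integral>\<^sup>+x. indicator {of_int m - rad..of_int m + rad} x \<partial>lborel)"
      by (intro nn_integral_cong) (auto simp: indicator_def abs_le_iff)
    also have "\<dots> = ennreal (2 * rad)" using assms by simp
    finally show ?thesis by simp
  qed
  then show ?thesis using assms by (simp add: window_bounded_def)
qed

section \<open>Sampling, vanishing and stability from quadrature rules\<close>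

definition comb :: "real \<Rightarrow> real \<Rightarrow> real set" where
  "comb h y = range (\<lambda>k::int. y + of_int k * h)"

text \<open>
Translates of a comb by \<open>y \<in> {0..<h}\<close> sweep out the real line exactly once.
\<close>

lemma nn_integral_comb:
  assumes h: "h > 0" and \<phi>[measurable]: "\<phi> \<in> borel_measurable borel"
  shows "(\<integral>\<^sup>+y. (\<integral>\<^sup>+z. \<phi> z \<partial>count_space (comb h y)) * indicator {0..<h} y \<partial>lborel) = (\<integral>\<^sup>+x. \<phi> x \<partial>lborel)"
    "(\<lambda>y. (\<integral>\<^sup>+z. \<phi> z \<partial>count_space (comb h y))) \<in> borel_measurable borel"
proof -
  interpret pair_sigma_finite lborel "count_space (UNIV::int set)"
    by (intro pair_sigma_finite.intro lborel.sigma_finite_measure_axioms sigma_finite_count_int)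
  have comb: "(\<integral>\<^sup>+z. \<phi> z \<partial>count_space (comb h y)) = (\<integral>\<^sup>+k. \<phi> (y + of_int k * h) \<partial>count_space UNIV)" for y
    by (rule nn_integral_bij_count_space[symmetric])
       (use h in \<open>auto simp: comb_def bij_betw_def inj_on_def\<close>)
  have m1: "(\<lambda>(y, k). \<phi> (y + of_int k * h)) \<in> borel_measurable (lborel \<Otimes>\<^sub>M count_space (UNIV::int set))"
    by (rule measurable_pair_count_space2) (auto intro!: measurable_compose[OF _ \<phi>])
  have m2: "(\<lambda>(y, k). \<phi> (y + of_int k * h) * indicator {0..<h} y) \<in> borel_measurable (lborel \<Otimes>\<^sub>M count_space (UNIV::int set))"
    by (rule measurable_pair_count_space2) (auto intro!: borel_measurable_times_ennreal measurable_compose[OF _ \<phi>])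
  have m3: "(\<lambda>(x, k). \<phi> x * indicator {0..<h} (x - of_int k * h)) \<in> borel_measurable (lborel \<Otimes>\<^sub>M count_space (UNIV::int set))"
    by (rule measurable_pair_count_space2) (auto intro!: borel_measurable_times_ennreal measurable_compose[OF _ borel_measurable_indicator])
  show "(\<lambda>y. (\<integral>\<^sup>+z. \<phi> z \<partial>count_space (comb h y))) \<in> borel_measurable borel"
    unfolding comb using M2.borel_measurable_nn_integral[OF m1] by simp
  have "(\<integral>\<^sup>+y. (\<integral>\<^sup>+z. \<phi> z \<partial>count_space (comb h y)) * indicator {0..<h} y \<partial>lborel)
     = (\<integral>\<^sup>+y. (\<integral>\<^sup>+k. \<phi> (y + of_int k * h) * indicator {0..<h} y \<partial>count_space UNIV) \<partial>lborel)"
    unfolding comb by (simp add: nn_integral_multc)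
  also have "\<dots> = (\<integral>\<^sup>+k. (\<integral>\<^sup>+y. \<phi> (y + of_int k * h) * indicator {0..<h} y \<partial>lborel) \<partial>count_space UNIV)"
    by (rule Fubini'[OF m2, symmetric])
  also have "\<dots> = (\<integral>\<^sup>+k. (\<integral>\<^sup>+x. \<phi> x * indicator {0..<h} (x - of_int k * h) \<partial>lborel) \<partial>count_space UNIV)"
  proof (rule nn_integral_cong)
    fix k :: int
    have "(\<lambda>x. \<phi> x * indicator {0..<h} (x - of_int k * h)) \<in> borel_measurable borel"
      by (auto intro!: borel_measurable_times_ennreal measurable_compose[OF _ borel_measurable_indicator])
    from nn_integral_real_affine[OF this, of 1 "of_int k * h"]
    show "(\<integral>\<^sup>+y. \<phi> (y + of_int k * h) * indicator {0..<h} y \<partial>lborel) = (\<integral>\<^sup>+x. \<phi> x * indicator {0..<h} (x - of_int k * h) \<partial>lborel)"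
      by (simp add: add.commute)
  qed
  also have "\<dots> = (\<integral>\<^sup>+x. (\<integral>\<^sup>+k. \<phi> x * indicator {0..<h} (x - of_int k * h) \<partial>count_space UNIV) \<partial>lborel)"
    by (rule Fubini'[OF m3])
  also have "\<dots> = (\<integral>\<^sup>+x. \<phi> x \<partial>lborel)"
  proof (rule nn_integral_cong)
    fix x :: real
    have "(x - of_int k * h \<in> {0..<h}) \<longleftrightarrow> k = \<lfloor>x / h\<rfloor>" for k :: int
    proof -
      have "(x - of_int k * h \<in> {0..<h}) \<longleftrightarrow> of_int k \<le> x / h \<and> x / h < of_int k + 1"
        using h by (auto simp: field_simps)
      also have "\<dots> \<longleftrightarrow> k = \<lfloor>x / h\<rfloor>" by linarith
      finally show ?thesis .
    qed
    then have "(\<integral>\<^sup>+k. \<phi> x * indicator {0..<h} (x - of_int k * h) \<partial>count_space UNIV)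
        = (\<integral>\<^sup>+k. \<phi> x * indicator {\<lfloor>x / h\<rfloor>} k \<partial>count_space UNIV)"
      by (intro nn_integral_cong) (auto simp: indicator_def)
    also have "\<dots> = \<phi> x" by (subst nn_integral_cmult_indicator) auto
    finally show "(\<integral>\<^sup>+k. \<phi> x * indicator {0..<h} (x - of_int k * h) \<partial>count_space UNIV) = \<phi> x" .
  qed
  finally show "(\<integral>\<^sup>+y. (\<integral>\<^sup>+z. \<phi> z \<partial>count_space (comb h y)) * indicator {0..<h} y \<partial>lborel) = (\<integral>\<^sup>+x. \<phi> x \<partial>lborel)" .
qed

lemma comb_separated:
  assumes "h > 0" "a \<in> comb h y" "b \<in> comb h y" "a \<noteq> b"
  shows "h \<le> \<bar>a - b\<bar>"
proof -
  obtain i j :: int where ij: "a = y + of_int i * h" "b = y + of_int j * h"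
    using assms by (auto simp: comb_def)
  then have "i \<noteq> j" using assms by auto
  then have "1 \<le> \<bar>real_of_int (i - j)\<bar>" by linarith
  then have "1 * h \<le> \<bar>real_of_int (i - j)\<bar> * h" using assms(1) by (intro mult_right_mono) auto
  moreover have "\<bar>a - b\<bar> = \<bar>real_of_int (i - j)\<bar> * h"
    using ij assms(1) by (simp add: left_diff_distrib[symmetric] abs_mult)
  ultimately show ?thesis by simp
qed

context decaying_generator
begin

definition point_rule :: "real set \<Rightarrow> real \<Rightarrow> real \<Rightarrow> (int \<Rightarrow> real) \<Rightarrow> bool" where
  "point_rule \<Lambda> C rad e \<longleftrightarrow> C > 0 \<and> rad > 0 \<and>
     (\<forall>m::int. \<forall>x0. 0 \<le> x0 \<longrightarrow> x0 \<le> 1 \<longrightarrow>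
        quadrature_rule G C rad e ((\<lambda>x. x - of_int m) ` \<Lambda>) (\<lambda>n. G (of_real (x0 - of_int n))))"

lemma point_rule_local_bound:
  assumes rule: "point_rule \<Lambda> C rad e" and e: "small_error \<eta> e"
    and \<delta>: "\<delta> > 0" and sep: "\<And>x y. x \<in> \<Lambda> \<Longrightarrow> y \<in> \<Lambda> \<Longrightarrow> x \<noteq> y \<Longrightarrow> \<delta> \<le> \<bar>x - y\<bar>"
    and Bc: "\<And>n. cmod (c n) \<le> Bc"
  shows "ennreal (cmod (shift_series G c x)) \<le>
    (\<integral>\<^sup>+n. ennreal (e (n - \<lfloor>x\<rfloor>) * cmod (c n)) \<partial>count_space UNIV)
      + (\<integral>\<^sup>+y. ennreal ((if \<bar>y - of_int \<lfloor>x\<rfloor>\<bar> \<le> rad then C else 0) * cmod (shift_series G c y)) \<partial>count_space \<Lambda>)"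
proof -
  define x0 where "x0 = x - of_int \<lfloor>x\<rfloor>"
  have x0: "0 \<le> x0" "x0 \<le> 1" unfolding x0_def by linarith+
  have C: "C \<ge> 0" "rad \<ge> 0" using rule by (auto simp: point_rule_def)
  have q: "quadrature_rule G C rad e ((\<lambda>x. x - of_int \<lfloor>x'\<rfloor>) ` \<Lambda>) (\<lambda>n. G (of_real (x0 - of_int n)))" for x'
    using rule x0 by (simp add: point_rule_def)
  have Bc': "\<And>n. cmod (c (n + \<lfloor>x\<rfloor>)) \<le> Bc" using Bc by simp
  have "infsum (\<lambda>n. c (n + \<lfloor>x\<rfloor>) * G (of_real (x0 - of_int n))) UNIV = shift_series G (\<lambda>n. c (n + \<lfloor>x\<rfloor>)) x0"
    by (simp add: shift_series_def)
  also have "\<dots> = shift_series G c (x0 + of_int \<lfloor>x\<rfloor>)" by (rule shift_series_translate[OF Bc])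
  also have "x0 + of_int \<lfloor>x\<rfloor> = x" by (simp add: x0_def)
  finally have eq: "infsum (\<lambda>n. c (n + \<lfloor>x\<rfloor>) * G (of_real (x0 - of_int n))) UNIV = shift_series G c x" .
  have "ennreal (cmod (infsum (\<lambda>n. c (n + \<lfloor>x\<rfloor>) * G (of_real (x0 - of_int n))) UNIV))
    \<le> (\<integral>\<^sup>+n. ennreal (e (n - \<lfloor>x\<rfloor>) * cmod (c n)) \<partial>count_space UNIV)
      + (\<integral>\<^sup>+y. ennreal ((if \<bar>y - of_int \<lfloor>x\<rfloor>\<bar> \<le> rad then C else 0) * cmod (shift_series G c y)) \<partial>count_space \<Lambda>)"
  proof (rule quadrature_translate[where c = c and m = "\<lfloor>x\<rfloor>", OF Bc C(1) e q])
    show "(\<lambda>n. c (n + \<lfloor>x\<rfloor>) * G (of_real (x0 - of_int n))) summable_on UNIV"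
      by (rule series_summable[where c = "\<lambda>n. c (n + \<lfloor>x\<rfloor>)", OF Bc'])
    show "finite (\<Lambda> \<inter> {of_int \<lfloor>x\<rfloor> - rad..of_int \<lfloor>x\<rfloor> + rad})"
      by (rule card_separated_interval(1)[OF \<delta> sep]) (use C in auto)
  qed
  then show ?thesis unfolding eq .
qed

text \<open>
The rules bound \<open>f\<close> by a small multiple of the coefficients plus the samples, and stability bounds the
coefficients by \<open>f\<close>.  With \<open>\<eta> = C1 / 4\<close> the coefficient term can be absorbed: the remaining factor is
\<open>(1 / 2) powr p\<close> for finite \<open>p\<close> and \<open>1 / 4\<close> for \<open>p = \<infinity>\<close>.
\<close>

lemma sampling_from_point_rules:
  assumes stable: "stable_shifts G" and sep: "separated \<Lambda>"
    and rules: "\<And>\<eta>. \<eta> > 0 \<Longrightarrow> \<exists>C rad e. small_error \<eta> e \<and> point_rule \<Lambda> C rad e"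
    and p: "1 \<le> p"
  shows "sampling_set \<Lambda> p G"
proof -
  obtain \<delta> where \<delta>: "\<delta> > 0" "\<And>x y. x \<in> \<Lambda> \<Longrightarrow> y \<in> \<Lambda> \<Longrightarrow> x \<noteq> y \<Longrightarrow> \<delta> \<le> \<bar>x - y\<bar>"
    using separated_gap[OF sep] by blast
  obtain C1 C2 where C1: "C1 > 0" and C2: "C2 > 0" and
    lo: "\<And>c. c \<in> lp_space p \<Longrightarrow> ennreal C1 * lp_norm p c \<le> Lp_norm lborel p (shift_series G c)" and
    up: "\<And>c. c \<in> lp_space p \<Longrightarrow> Lp_norm lborel p (shift_series G c) \<le> ennreal C2 * lp_norm p c"
    using stable p unfolding stable_shifts_def by blast
  have "C1 / 4 > 0" using C1 by simp
  \<comment> \<open>the error level that can be absorbed by the lower stability bound\<close>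
  then obtain C rad e where e: "small_error (C1 / 4) e" and rule: "point_rule \<Lambda> C rad e"
    using rules by blast
  have C: "C > 0" and rad: "rad > 0" using rule by (auto simp: point_rule_def)
  define \<nu> where "\<nu> = 2 * rad / \<delta> + 1"
  have w: "window_bounded (count_space \<Lambda>) (\<lambda>x. x) rad \<nu>"
    unfolding \<nu>_def by (rule window_bounded_separated[OF \<delta>]) (use rad in auto)
  have \<nu>: "\<nu> > 0" using w by (simp add: window_bounded_def)
  have countable: "countable \<Lambda>" using sep by (simp add: separated_def)
  note sf = sigma_finite_count_countable[OF countable]
  show ?thesis
  proof (cases "p = \<infinity>")
    case True
    define K where "K = C2 * (2 / C1 * (C * \<nu>))"
    have K: "K > 0" using C1 C2 C \<nu> by (simp add: K_def)
    have "Lp_norm lborel \<infinity> f \<le> ennreal K * (SUP l\<in>\<Lambda>. ennreal (cmod (f l)))" if fs: "f \<in> shift_space \<infinity> G" for f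
    proof -
      obtain c where c: "c \<in> lp_space \<infinity>" and f: "f = shift_series G c"
        using fs by (auto simp: shift_space_def)
      obtain Bc where Bc: "\<And>n. cmod (c n) \<le> Bc" using lp_space_bounded[OF _ c] by auto
      let ?X = "lp_norm \<infinity> c" and ?Y = "SUP l\<in>\<Lambda>. ennreal (cmod (f l))"
      have "ennreal (cmod (f x)) \<le> ennreal (C1 / 4) * ?X + ennreal (C * \<nu>) * ?Y" for x
      proof -
        have "ennreal (cmod (f x)) \<le>
          (\<integral>\<^sup>+n. ennreal (e (n - \<lfloor>x\<rfloor>) * cmod (c n)) \<partial>count_space UNIV)
          + (\<integral>\<^sup>+y. ennreal ((if \<bar>y - of_int \<lfloor>x\<rfloor>\<bar> \<le> rad then C else 0) * cmod (f y)) \<partial>count_space \<Lambda>)"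
          unfolding f by (rule point_rule_local_bound[OF rule e \<delta> Bc])
        also have "\<dots> \<le> ennreal (C1 / 4) * ?X + ennreal (C * \<nu>) * ?Y"
          by (rule sup_bound_of_local_bound[OF e w])
             (use C lp_norm_infinity_ge in \<open>auto simp: AE_count_space intro: SUP_upper\<close>)
        finally show ?thesis .
      qed
      then have "Lp_norm lborel \<infinity> f \<le> ennreal (C1 / 4) * ?X + ennreal (C * \<nu>) * ?Y"
        unfolding f using series_measurable[OF Bc] by (intro Lp_norm_infinity_le) auto
      then have "ennreal C1 * ?X \<le> ennreal (C1 / 4) * ?X + ennreal (C * \<nu>) * ?Y"
        using lo[of c] c True unfolding f by (auto intro: order_trans)
      then have "ennreal (1 / C1) * (ennreal C1 * ?X) \<le> ennreal (1 / C1) * (ennreal (C1 / 4) * ?X + ennreal (C * \<nu>) * ?Y)"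
        by (rule mult_left_mono) simp
      moreover have "ennreal (1 / C1) * (ennreal C1 * ?X) = ?X"
        using C1 by (simp add: mult.assoc[symmetric] ennreal_mult[symmetric])
      moreover have "ennreal (1 / C1) * (ennreal (C1 / 4) * ?X + ennreal (C * \<nu>) * ?Y) = ennreal (1 / 4) * ?X + ennreal (1 / C1 * (C * \<nu>)) * ?Y"
        using C1 C \<nu> by (simp add: distrib_left mult.assoc[symmetric] ennreal_mult[symmetric])
      ultimately have "?X \<le> ennreal (1 / 4) * ?X + ennreal (1 / C1 * (C * \<nu>)) * ?Y" by simp
      then have "?X \<le> ennreal 2 * (ennreal (1 / C1 * (C * \<nu>)) * ?Y)"
        using c by (intro ennreal_absorb) (auto simp: lp_space_def)
      then have "ennreal C2 * ?X \<le> ennreal C2 * (ennreal 2 * (ennreal (1 / C1 * (C * \<nu>)) * ?Y))"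
        by (rule mult_left_mono) simp
      also have "\<dots> = ennreal (C2 * (2 * (1 / C1 * (C * \<nu>)))) * ?Y"
        using C1 C2 C \<nu> by (simp only: mult.assoc[symmetric] ennreal_mult[symmetric] zero_le_numeral
            zero_le_divide_1_iff mult_nonneg_nonneg less_imp_le)
      also have "C2 * (2 * (1 / C1 * (C * \<nu>))) = K" by (simp add: K_def)
      finally show ?thesis using up[of c] c True unfolding f by (auto intro: order_trans)
    qed
    then show ?thesis
      unfolding sampling_set_def using sep True K by auto
  next
    case False
    define r where "r = enn2real p"
    have r: "r \<ge> 1" using enn2real_ge_1[OF p False] by (simp add: r_def)
    define W where "W = (C * \<nu>) powr (r - 1) * (C * (2 * rad + 1))"
    have W: "W > 0" using C \<nu> rad by (simp add: W_def)
    define K where "K = 2 * (2 powr r * W / C1 powr r)"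
    have K: "K > 0" using W C1 by (simp add: K_def)
    define U where "U = amalgam_bound powr (r - 1) * ((1 / \<delta> + 1) * amalgam_bound)"
    have U: "U > 0" using amalgam_bound_pos \<delta> by (simp add: U_def add_pos_nonneg)
    define A where "A = 1 / (C2 powr r * K)"
    define B where "B = U * (1 / C1 powr r)"
    have A: "A > 0" and B: "B > 0" using C2 K U C1 by (auto simp: A_def B_def)
    have "ennreal A * Lp_mass lborel r f \<le> Lp_mass (count_space \<Lambda>) r f \<and>
        Lp_mass (count_space \<Lambda>) r f \<le> ennreal B * Lp_mass lborel r f" if fs: "f \<in> shift_space p G" for f
    proof -
      obtain c where c: "c \<in> lp_space p" and f: "f = shift_series G c"
        using fs by (auto simp: shift_space_def)
      obtain Bc where Bc: "\<And>n. cmod (c n) \<le> Bc" using lp_space_bounded[OF p c] by auto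
      let ?X = "Lp_mass (count_space UNIV) r c" and ?S = "Lp_mass (count_space \<Lambda>) r f" and ?I = "Lp_mass lborel r f"
      have Xfin: "?X < \<infinity>" using lp_space_finite_mass[OF p False c] by (simp add: r_def)
      have lo': "ennreal (C1 powr r) * ?X \<le> ?I"
        using lo[OF c] unfolding mult_Lp_norm_le_iff[OF p False C1] by (simp add: r_def f)
      have up': "?I \<le> ennreal (C2 powr r) * ?X"
        using up[OF c] unfolding Lp_norm_le_mult_iff[OF p False C2] by (simp add: r_def f)
      have "?I \<le> ennreal (2 powr r) * (ennreal ((C1 / 4) powr r) * ?X + ennreal W * ?S)"
        unfolding Lp_mass_def W_def
        unfolding Lp_mass_def[symmetric, of "count_space UNIV"]
      proof (rule mass_bound_of_local_bound[OF e _ C rad r lborel.sigma_finite_measure_axioms cell_bounded_lborel sf w])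
        show "ennreal (cmod (f x)) \<le>
          (\<integral>\<^sup>+n. ennreal (e (n - \<lfloor>x\<rfloor>) * cmod (c n)) \<partial>count_space UNIV)
          + (\<integral>\<^sup>+y. ennreal ((if \<bar>y - of_int \<lfloor>x\<rfloor>\<bar> \<le> rad then C else 0) * cmod (f y)) \<partial>count_space \<Lambda>)" for x
          unfolding f by (rule point_rule_local_bound[OF rule e \<delta> Bc])
        show "cmod (f y) \<le> amalgam_bound * Bc" for y unfolding f by (rule series_bounded[OF Bc])
      qed (use C1 Bc in auto)
      with lo' have "ennreal (C1 powr r) * ?X \<le> ennreal (2 powr r) * (ennreal ((C1 / 4) powr r) * ?X + ennreal W * ?S)"
        by (rule order_trans)
      then have "ennreal (1 / C1 powr r) * (ennreal (C1 powr r) * ?X)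
         \<le> ennreal (1 / C1 powr r) * (ennreal (2 powr r) * (ennreal ((C1 / 4) powr r) * ?X + ennreal W * ?S))"
        by (rule mult_left_mono) simp
      moreover have "ennreal (1 / C1 powr r) * (ennreal (C1 powr r) * ?X) = ?X"
        using C1 by (simp add: mult.assoc[symmetric] ennreal_mult[symmetric])
      moreover have "ennreal (1 / C1 powr r) * (ennreal (2 powr r) * (ennreal ((C1 / 4) powr r) * ?X + ennreal W * ?S))
         = ennreal ((1 / 2) powr r) * ?X + ennreal (2 powr r * W / C1 powr r) * ?S"
      proof -
        have "1 / C1 powr r * (2 powr r * (C1 / 4) powr r) = (1 / 2) powr r"
        proof -
          have "(1 / C1 * (2 * (C1 / 4))) powr r = (1 / C1) powr r * (2 powr r * (C1 / 4) powr r)"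
            using C1 by (simp only: powr_mult divide_nonneg_nonneg zero_le_numeral less_imp_le zero_le_one mult_nonneg_nonneg)
          moreover have "1 / C1 * (2 * (C1 / 4)) = 1 / 2" using C1 by simp
          ultimately show ?thesis using C1 by (simp add: powr_divide)
        qed
        then show ?thesis
          using C1 W by (simp add: distrib_left mult.assoc[symmetric] ennreal_mult[symmetric])
      qed
      ultimately have "?X \<le> ennreal ((1 / 2) powr r) * ?X + ennreal (2 powr r * W / C1 powr r) * ?S" by simp
      moreover have "(1 / 2) powr r \<le> (1 / 2 :: real)" using powr_mono'[of 1 r "1 / 2"] r by simp
      ultimately have "?X \<le> ennreal 2 * (ennreal (2 powr r * W / C1 powr r) * ?S)"
        using Xfin by (intro ennreal_absorb) auto
      then have XK: "?X \<le> ennreal K * ?S"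
      proof -
        have "ennreal K = ennreal 2 * ennreal (2 powr r * W / C1 powr r)"
          unfolding K_def using W by (intro ennreal_mult) auto
        then show ?thesis using \<open>?X \<le> ennreal 2 * _\<close> by (simp only: mult.assoc)
      qed
      have "?I \<le> ennreal (C2 powr r) * (ennreal K * ?S)"
        using up' mult_left_mono[OF XK, of "ennreal (C2 powr r)"] by (rule order_trans) simp
      then have "?I \<le> ennreal (C2 powr r * K) * ?S" using K by (simp add: ennreal_mult mult.assoc)
      then have 1: "ennreal A * ?I \<le> ?S"
        unfolding A_def using C2 K by (subst ennreal_inverse_mult_le_iff) auto
      have "?S \<le> ennreal U * ?X"
        unfolding U_def f
        using series_upper[OF Bc sf cell_bounded_separated[OF \<delta>] r]
        by (simp add: Lp_mass_def)
      also have "\<dots> \<le> ennreal U * (ennreal (1 / C1 powr r) * ?I)"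
      proof (rule mult_left_mono)
        have "ennreal (1 / (1 / C1 powr r)) * ?X \<le> ?I" using lo' by simp
        then show "?X \<le> ennreal (1 / C1 powr r) * ?I"
          using C1 by (subst (asm) ennreal_inverse_mult_le_iff) auto
      qed simp
      also have "\<dots> = ennreal B * ?I"
      proof -
        have "ennreal B = ennreal U * ennreal (1 / C1 powr r)"
          unfolding B_def using U by (intro ennreal_mult) auto
        then show ?thesis by (simp only: mult.assoc)
      qed
      finally show ?thesis using 1 by simp
    qed
    then show ?thesis
      unfolding sampling_set_def Let_def using sep False A B
      by (auto simp: infsum_ennreal_eq_nn_integral[OF countable] Lp_mass_def r_def)
  qed
qed

text \<open>
When the samples vanish, the rules bound \<open>f\<close> by arbitrarily small multiples of the bound on \<open>c\<close>.
\<close>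

lemma vanishing_on_rule_set:
  assumes sep: "separated \<Lambda>"
    and rules: "\<And>\<eta>. \<eta> > 0 \<Longrightarrow> \<exists>C rad e. small_error \<eta> e \<and> point_rule \<Lambda> C rad e"
    and Bc: "\<And>n. cmod (c n) \<le> Bc" and zero: "\<And>x. x \<in> \<Lambda> \<Longrightarrow> shift_series G c x = 0"
  shows "shift_series G c x = 0"
proof -
  obtain \<delta> where \<delta>: "\<delta> > 0" "\<And>x y. x \<in> \<Lambda> \<Longrightarrow> y \<in> \<Lambda> \<Longrightarrow> x \<noteq> y \<Longrightarrow> \<delta> \<le> \<bar>x - y\<bar>"
    using separated_gap[OF sep] by blast
  have Bc0: "Bc \<ge> 0" by (rule Bc_nonneg[OF Bc])
  have "cmod (shift_series G c x) \<le> \<eta>" if \<eta>: "\<eta> > 0" for \<eta>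
  proof -
    have "\<eta> / (Bc + 1) > 0" using \<eta> Bc0 by simp
    then obtain C rad e where e: "small_error (\<eta> / (Bc + 1)) e" and rule: "point_rule \<Lambda> C rad e"
      using rules by blast
    have e0: "e n \<ge> 0" for n using e by (simp add: small_error_def)
    have z: "(\<integral>\<^sup>+y. ennreal ((if \<bar>y - of_int \<lfloor>x\<rfloor>\<bar> \<le> rad then C else 0) * cmod (shift_series G c y)) \<partial>count_space \<Lambda>) = 0"
      using zero by (simp add: nn_integral_0_iff_AE AE_count_space)
    have "ennreal (cmod (shift_series G c x)) \<le>
      (\<integral>\<^sup>+n. ennreal (e (n - \<lfloor>x\<rfloor>) * cmod (c n)) \<partial>count_space UNIV)
        + (\<integral>\<^sup>+y. ennreal ((if \<bar>y - of_int \<lfloor>x\<rfloor>\<bar> \<le> rad then C else 0) * cmod (shift_series G c y)) \<partial>count_space \<Lambda>)"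
      by (rule point_rule_local_bound[where c = c, OF rule e \<delta> Bc])
    then have "ennreal (cmod (shift_series G c x)) \<le> (\<integral>\<^sup>+n. ennreal (e (n - \<lfloor>x\<rfloor>) * cmod (c n)) \<partial>count_space UNIV)"
      unfolding z by simp
    also have "\<dots> \<le> (\<integral>\<^sup>+n. ennreal (e (n - \<lfloor>x\<rfloor>)) * ennreal Bc \<partial>count_space UNIV)"
      using Bc Bc0 e0 by (intro nn_integral_mono) (simp add: ennreal_leI mult_left_mono flip: ennreal_mult)
    also have "\<dots> = (\<integral>\<^sup>+n. ennreal (e (n - \<lfloor>x\<rfloor>)) \<partial>count_space UNIV) * ennreal Bc"
      by (rule nn_integral_multc) simp
    also have "\<dots> \<le> ennreal (\<eta> / (Bc + 1)) * ennreal Bc"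
      by (intro mult_right_mono error_row(1)[OF e]) auto
    also have "\<dots> = ennreal (\<eta> / (Bc + 1) * Bc)" using \<eta> Bc0 by (intro ennreal_mult[symmetric]) auto
    also have "\<dots> \<le> ennreal \<eta>" using \<eta> Bc0 by (intro ennreal_leI) (simp add: field_simps)
    finally show ?thesis using \<eta> by simp
  qed
  then have "cmod (shift_series G c x) \<le> 0" by (rule field_le_epsilon[where y = 0, simplified])
  then show ?thesis by simp
qed

text \<open>
The rules bound a coefficient by the values of \<open>f\<close> on a comb.  Averaging over the translates of the
comb replaces these values by an integral of \<open>|f|\<close>, to which the estimates for local bounds apply with
the integers as outer and the real line as inner measure space.
\<close>

lemma stable_from_coefficient_rule:
  assumes h: "h > 0" and e: "small_error (1 / 4) e" and C: "C > 0" and rad: "rad > 0"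
    and rule: "\<And>y (m::int). quadrature_rule G C rad e ((\<lambda>x. x - of_int m) ` comb h y) (\<lambda>n. if n = 0 then 1 else 0)"
  shows "stable_shifts G"
proof -
  have coeff_bound: "ennreal (cmod (c m)) \<le> (\<integral>\<^sup>+n. ennreal (e (n - m) * cmod (c n)) \<partial>count_space UNIV)
      + (\<integral>\<^sup>+x. ennreal ((if \<bar>x - of_int m\<bar> \<le> rad then C / h else 0) * cmod (shift_series G c x)) \<partial>lborel)"
    if Bc: "\<And>n. cmod (c n) \<le> Bc" for c Bc m
  proof -
    let ?f = "shift_series G c"
    note [measurable] = series_measurable[OF Bc]
    define S where "S = (\<integral>\<^sup>+n. ennreal (e (n - m) * cmod (c n)) \<partial>count_space UNIV)"
    define \<phi> where "\<phi> x = ennreal ((if \<bar>x - of_int m\<bar> \<le> rad then C else 0) * cmod (?f x))" for x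
    have \<phi>: "\<phi> \<in> borel_measurable borel" unfolding \<phi>_def[abs_def] by measurable
    have t0: "c (n + m) * (if n = 0 then 1 else 0) = (if n = 0 then c m else 0)" for n by auto
    have hs: "((\<lambda>n. c (n + m) * (if n = 0 then 1 else 0)) has_sum c m) UNIV"
      unfolding t0 by (rule has_sum_finite_neutralI[where B = "{0}"]) auto
    \<comment> \<open>the rule on the translated comb, before averaging over y\<close>
    have pt: "ennreal (cmod (c m)) \<le> S + (\<integral>\<^sup>+z. \<phi> z \<partial>count_space (comb h y))" for y
    proof -
      have "ennreal (cmod (infsum (\<lambda>n. c (n + m) * (if n = 0 then 1 else 0)) UNIV))
          \<le> S + (\<integral>\<^sup>+z. \<phi> z \<partial>count_space (comb h y))"
        unfolding S_def \<phi>_def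
        by (rule quadrature_translate[OF Bc _ e rule has_sum_imp_summable[OF hs]])
           (use C rad card_separated_interval(1)[OF h comb_separated[OF h]] in auto)
      then show ?thesis unfolding infsumI[OF hs] .
    qed
    have "ennreal (cmod (c m)) * ennreal h = (\<integral>\<^sup>+y. ennreal (cmod (c m)) * indicator {0..<h} y \<partial>lborel)"
      using h by (simp add: nn_integral_cmult_indicator)
    also have "\<dots> \<le> (\<integral>\<^sup>+y. S * indicator {0..<h} y + (\<integral>\<^sup>+z. \<phi> z \<partial>count_space (comb h y)) * indicator {0..<h} y \<partial>lborel)"
      by (intro nn_integral_mono) (use pt in \<open>auto simp: indicator_def\<close>)
    also have "\<dots> = S * ennreal h + (\<integral>\<^sup>+x. \<phi> x \<partial>lborel)"
      using h nn_integral_comb[OF h \<phi>] by (subst nn_integral_add) (auto simp: nn_integral_cmult_indicator)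
    finally have "ennreal (1 / h) * (ennreal (cmod (c m)) * ennreal h) \<le> ennreal (1 / h) * (S * ennreal h + (\<integral>\<^sup>+x. \<phi> x \<partial>lborel))"
      by (rule mult_left_mono) simp
    moreover have inv: "ennreal (1 / h) * (a * ennreal h) = a" for a
    proof -
      have "ennreal (1 / h) * ennreal h = 1" using h by (simp add: ennreal_mult[symmetric])
      then show ?thesis by (metis mult.assoc mult.commute mult_1)
    qed
    moreover have "ennreal (1 / h) * (\<integral>\<^sup>+x. \<phi> x \<partial>lborel)
       = (\<integral>\<^sup>+x. ennreal ((if \<bar>x - of_int m\<bar> \<le> rad then C / h else 0) * cmod (?f x)) \<partial>lborel)"
    proof -
      have "ennreal (1 / h) * (\<integral>\<^sup>+x. \<phi> x \<partial>lborel) = (\<integral>\<^sup>+x. ennreal (1 / h) * \<phi> x \<partial>lborel)"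
        by (rule nn_integral_cmult[symmetric]) (use \<phi> in simp)
      also have "\<dots> = (\<integral>\<^sup>+x. ennreal ((if \<bar>x - of_int m\<bar> \<le> rad then C / h else 0) * cmod (?f x)) \<partial>lborel)"
        using h C by (intro nn_integral_cong) (auto simp: \<phi>_def ennreal_mult[symmetric])
      finally show ?thesis .
    qed
    ultimately show ?thesis unfolding S_def[symmetric] by (simp add: distrib_left)
  qed
  have Ch: "C / h > 0" using C h by simp
  have w: "window_bounded lborel (\<lambda>x. x) rad (2 * rad)" by (rule window_bounded_lborel[OF rad])
  show ?thesis
    unfolding stable_shifts_def
  proof (intro allI impI)
    fix p :: ennreal assume p: "1 \<le> p"
    show "\<exists>C1 C2 :: real. C1 > 0 \<and> C2 > 0 \<and> (\<forall>c\<in>lp_space p.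
           ennreal C1 * lp_norm p c \<le> Lp_norm lborel p (shift_series G c) \<and>
           Lp_norm lborel p (shift_series G c) \<le> ennreal C2 * lp_norm p c)"
    proof (cases "p = \<infinity>")
      case True
      define K where "K = 2 * (C / h * (2 * rad))"
      have K: "K > 0" using C h rad by (simp add: K_def)
      have "ennreal (1 / K) * lp_norm \<infinity> c \<le> Lp_norm lborel \<infinity> (shift_series G c) \<and>
           Lp_norm lborel \<infinity> (shift_series G c) \<le> ennreal amalgam_bound * lp_norm \<infinity> c" if c: "c \<in> lp_space \<infinity>" for c
      proof
        obtain Bc where Bc: "\<And>n. cmod (c n) \<le> Bc" using lp_space_bounded[OF _ c] by auto
        let ?X = "lp_norm \<infinity> c" and ?Y = "Lp_norm lborel \<infinity> (shift_series G c)"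
        have "ennreal (cmod (c m)) \<le> ennreal (1 / 4) * ?X + ennreal (C / h * (2 * rad)) * ?Y" for m
          by (rule order_trans[OF coeff_bound[OF Bc] sup_bound_of_local_bound[OF e w]])
             (use Ch lp_norm_infinity_ge Lp_norm_infinity_AE in auto)
        then have "?X \<le> ennreal (1 / 4) * ?X + ennreal (C / h * (2 * rad)) * ?Y"
          by (rule lp_norm_infinity_le)
        then have "?X \<le> ennreal 2 * (ennreal (C / h * (2 * rad)) * ?Y)"
          using c by (intro ennreal_absorb) (auto simp: lp_space_def)
        also have "\<dots> = ennreal K * ?Y"
          unfolding K_def using Ch rad by (simp only: ennreal_mult mult.assoc less_imp_le zero_le_numeral mult_nonneg_nonneg)
        finally show "ennreal (1 / K) * ?X \<le> ?Y" using K by (subst ennreal_inverse_mult_le_iff)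
        obtain b where b: "b \<ge> 0" "?X = ennreal b" using c by (cases ?X) (auto simp: lp_space_def)
        have bb: "cmod (c n) \<le> b" for n using lp_norm_infinity_ge[of c n] b by simp
        show "?Y \<le> ennreal amalgam_bound * ?X"
        proof (rule Lp_norm_infinity_le)
          show "shift_series G c \<in> borel_measurable lborel" using series_measurable[OF Bc] by simp
          have "ennreal (cmod (shift_series G c x)) \<le> ennreal (amalgam_bound * b)" for x
            by (intro ennreal_leI series_bounded[OF bb])
          then show "AE x in lborel. ennreal (cmod (shift_series G c x)) \<le> ennreal amalgam_bound * ?X"
            using b amalgam_bound_pos by (simp add: ennreal_mult)
        qed
      qed
      then show ?thesis using True K amalgam_bound_pos by (intro exI[of _ "1 / K"] exI[of _ amalgam_bound]) auto
    next
      case False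
      define r where "r = enn2real p"
      have r: "r \<ge> 1" using enn2real_ge_1[OF p False] by (simp add: r_def)
      define W where "W = (C / h * (2 * rad)) powr (r - 1) * (C / h * (2 * rad + 1))"
      have W: "W > 0" unfolding W_def using Ch rad by (intro mult_pos_pos) auto
      define K where "K = 2 * (2 powr r * W)"
      have K: "K > 0" using W by (simp add: K_def)
      define U where "U = amalgam_bound powr (r - 1) * (1 * amalgam_bound)"
      have U: "U > 0" using amalgam_bound_pos by (simp add: U_def)
      define C1 where "C1 = (1 / K) powr (1 / r)"
      define C2 where "C2 = U powr (1 / r)"
      have C12: "C1 > 0" "C2 > 0" "C1 powr r = 1 / K" "C2 powr r = U"
        using K U r by (auto simp: C1_def C2_def powr_powr)
      have "ennreal C1 * lp_norm p c \<le> Lp_norm lborel p (shift_series G c) \<and>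
           Lp_norm lborel p (shift_series G c) \<le> ennreal C2 * lp_norm p c" if c: "c \<in> lp_space p" for c
      proof
        obtain Bc where Bc: "\<And>n. cmod (c n) \<le> Bc" using lp_space_bounded[OF p c] by auto
        let ?f = "shift_series G c"
        let ?X = "Lp_mass (count_space UNIV) r c" and ?I = "Lp_mass lborel r ?f"
        have Xfin: "?X < \<infinity>" using lp_space_finite_mass[OF p False c] by (simp add: r_def)
        have "(\<integral>\<^sup>+m. ennreal (cmod (c m) powr r) \<partial>count_space UNIV)
          \<le> ennreal (2 powr r) * (ennreal ((1 / 4) powr r) * ?X + ennreal W * (\<integral>\<^sup>+x. ennreal (cmod (?f x) powr r) \<partial>lborel))"
          unfolding W_def
        proof (rule mass_bound_of_local_bound[OF e _ Ch rad r sigma_finite_count_int cell_bounded_count_int lborel.sigma_finite_measure_axioms w])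
          show "ennreal (cmod (c m)) \<le> (\<integral>\<^sup>+n. ennreal (e (n - \<lfloor>real_of_int m\<rfloor>) * cmod (c n)) \<partial>count_space UNIV)
            + (\<integral>\<^sup>+x. ennreal ((if \<bar>x - of_int \<lfloor>real_of_int m\<rfloor>\<bar> \<le> rad then C / h else 0) * cmod (?f x)) \<partial>lborel)" for m
            using coeff_bound[of c Bc m, OF Bc] by simp
          show "cmod (?f y) \<le> amalgam_bound * Bc" for y by (rule series_bounded[OF Bc])
          show "(\<lambda>x. cmod (?f x)) \<in> borel_measurable lborel" using series_measurable[OF Bc] by simp
        qed (use Bc in auto)
        then have "?X \<le> ennreal (2 powr r) * (ennreal ((1 / 4) powr r) * ?X + ennreal W * ?I)"
          unfolding Lp_mass_def .
        also have "\<dots> = ennreal ((1 / 2) powr r) * ?X + ennreal (2 powr r * W) * ?I"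
        proof -
          have "(2 * (1 / 4)) powr r = 2 powr r * (1 / 4 :: real) powr r" by (rule powr_mult)
          then have "2 powr r * (1 / 4) powr r = (1 / 2 :: real) powr r" by simp
          then show ?thesis
            using W by (simp only: distrib_left mult.assoc[symmetric] ennreal_mult[symmetric] powr_ge_zero less_imp_le)
        qed
        finally have "?X \<le> ennreal ((1 / 2) powr r) * ?X + ennreal (2 powr r * W) * ?I" .
        moreover have "(1 / 2) powr r \<le> (1 / 2 :: real)" using powr_mono'[of 1 r "1 / 2"] r by simp
        ultimately have "?X \<le> ennreal 2 * (ennreal (2 powr r * W) * ?I)"
          using Xfin by (intro ennreal_absorb) auto
        also have "\<dots> = ennreal K * ?I"
          unfolding K_def using W by (simp only: ennreal_mult mult.assoc less_imp_le zero_le_numeral mult_nonneg_nonneg powr_ge_zero)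
        finally have "ennreal (1 / K) * ?X \<le> ?I" using K by (subst ennreal_inverse_mult_le_iff)
        then show "ennreal C1 * lp_norm p c \<le> Lp_norm lborel p ?f"
          unfolding mult_Lp_norm_le_iff[OF p False C12(1)] r_def[symmetric] C12(3) .
        have "?I \<le> ennreal U * ?X"
          unfolding U_def
          using series_upper[OF Bc lborel.sigma_finite_measure_axioms cell_bounded_lborel r] by (simp add: Lp_mass_def)
        then show "Lp_norm lborel p ?f \<le> ennreal C2 * lp_norm p c"
          unfolding Lp_norm_le_mult_iff[OF p False C12(2)] r_def[symmetric] C12(4) .
      qed
      then show ?thesis using C12 by blast
    qed
  qed
qed

end

section \<open>Sampling above the critical density\<close>

lemma represents_gauss_rational:
  assumes "\<alpha> > 0" "represents \<alpha> G P Q"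
  obtains l om D c0 where "gauss_rational_const \<alpha> G P Q l (degree Q) om D c0" "\<And>j. j < degree Q \<Longrightarrow> poly Q (om j) = 0"
proof -
  obtain om where om: "Q = smult (lead_coeff Q) (\<Prod>j<degree Q. [:- om j, 1:])"
    using complex_poly_decompose'[of Q] by metis
  have Q0: "Q \<noteq> 0" using assms by (simp add: represents_def)
  have root: "poly Q (om j) = 0" if "j < degree Q" for j
  proof -
    have "poly (\<Prod>j<degree Q. [:- om j, 1:]) (om j) = 0"
      unfolding poly_prod using that by (intro prod_zero) auto
    then show ?thesis by (subst om) simp
  qed
  have off: "om j \<noteq> complex_of_real x" if "j < degree Q" "0 \<le> x" for j x
    using root[OF that(1)] assms(2) that(2) by (auto simp: represents_def)
  have gr: "gauss_rational \<alpha> G P Q (lead_coeff Q) (degree Q) om"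
  proof
    show "G = (\<lambda>z. exp (- of_real \<alpha> * z ^ 2 / 2) * (poly P (exp (of_real \<alpha> * z)) / poly Q (exp (of_real \<alpha> * z))))"
      using assms(2) by (simp only: represents_def)
  qed (use assms(1) om Q0 off in auto)
  define D where "D = 1 + (\<Sum>j<degree Q. cmod (om j) + 1 / cmod (om j))"
  have le: "cmod (om j) + 1 / cmod (om j) \<le> (\<Sum>j<degree Q. cmod (om j) + 1 / cmod (om j))" if "j < degree Q" for j
    using that by (intro member_le_sum) auto
  have D1: "D \<ge> 1" unfolding D_def by (simp add: sum_nonneg)
  define c0 where "c0 = nat \<lceil>ln (2 * D) / \<alpha>\<rceil>"
  have "ln (2 * D) / \<alpha> \<le> real c0" unfolding c0_def by linarith
  then have "ln (2 * D) \<le> \<alpha> * real c0" using assms(1) by (simp add: field_simps)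
  then have "exp (ln (2 * D)) \<le> exp (\<alpha> * real c0)" by simp
  then have c0: "2 * D \<le> exp (\<alpha> * real c0)" using D1 by simp
  have b: "1 + cmod (om j) \<le> D" "1 + 1 / cmod (om j) \<le> D" if "j < degree Q" for j
  proof -
    have "0 \<le> cmod (om j)" "0 \<le> 1 / cmod (om j)" by auto
    then show "1 + cmod (om j) \<le> D" "1 + 1 / cmod (om j) \<le> D" using le[OF that] unfolding D_def by linarith+
  qed
  interpret gauss_rational \<alpha> G P Q "lead_coeff Q" "degree Q" om by (rule gr)
  have "gauss_rational_const \<alpha> G P Q (lead_coeff Q) (degree Q) om D c0"
    by unfold_locales (use b D1 c0 in auto)
  then show ?thesis using root by (rule that)
qed

lemma dense_separated_translate:
  assumes sep: "\<And>x y. x \<in> \<Lambda> \<Longrightarrow> y \<in> \<Lambda> \<Longrightarrow> x \<noteq> y \<Longrightarrow> \<delta> \<le> \<bar>x - y\<bar>"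
    and rich: "\<And>y. N \<le> card (\<Lambda> \<inter> {y..<y + real T})"
  shows "dense_separated \<delta> T N ((\<lambda>x. x - of_int m) ` \<Lambda>)"
proof -
  have "N \<le> card ((\<lambda>x. x - of_int m) ` \<Lambda> \<inter> {real_of_int k * real T..<(real_of_int k + 1) * real T})" for k :: int
  proof -
    let ?y = "real_of_int k * real T + of_int m"
    have "(\<lambda>x. x - of_int m) ` \<Lambda> \<inter> {real_of_int k * real T..<(real_of_int k + 1) * real T}
        = (\<lambda>x. x - of_int m) ` (\<Lambda> \<inter> {?y..<?y + real T})"
      by (auto simp: algebra_simps intro!: imageI)
    then show ?thesis using rich[of ?y] by (simp add: card_image inj_on_def)
  qed
  then show ?thesis using sep by (auto simp: dense_separated_def)
qed

context gauss_rational_const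
begin

lemma generator_decays: "\<exists>CG. decaying_generator G CG"
proof -
  obtain c where c: "c > 0" "\<And>j k x. j < q \<Longrightarrow> c \<le> cmod (pole_factor (om j) k (exp (of_real (x::real))))"
    using pole_factor_lower_on_reals by blast
  define d where "d = cmod l * (\<Prod>j<q. c * cmod (om j))"
  have d: "d > 0" unfolding d_def using l c om_nz by (intro mult_pos_pos prod_pos) auto
  have Qd: "d \<le> cmod (poly Q (exp (of_real (\<alpha> * x))))" for x :: real
  proof -
    have "c * cmod (om j) \<le> cmod (exp (of_real (\<alpha> * x)) - om j)" if j: "j < q" for j
    proof -
      have "exp (of_real (\<alpha> * x)) - om j = - (pole_factor (om j) 0 (exp (of_real (\<alpha> * x))) * om j)"
        using om_nz[OF j] by (simp add: pole_factor_def exp_step_def field_simps)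
      then have "cmod (exp (of_real (\<alpha> * x)) - om j) = cmod (pole_factor (om j) 0 (exp (of_real (\<alpha> * x)))) * cmod (om j)"
        by (simp only: norm_minus_cancel norm_mult)
      then show ?thesis using c(2)[OF j, of 0 "\<alpha> * x"] by (metis mult_right_mono norm_ge_zero)
    qed
    then have "(\<Prod>j<q. c * cmod (om j)) \<le> (\<Prod>j<q. cmod (exp (of_real (\<alpha> * x)) - om j))"
      using c by (intro prod_mono) auto
    moreover have "cmod (poly Q (exp (of_real (\<alpha> * x)))) = cmod l * (\<Prod>j<q. cmod (exp (of_real (\<alpha> * x)) - om j))"
      by (simp add: Q poly_prod norm_mult flip: prod_norm)
    ultimately show ?thesis by (simp add: d_def mult_left_mono)
  qed
  have G_real: "G (of_real x) = of_real (exp (- \<alpha> * x\<^sup>2 / 2)) * (poly P (exp (of_real (\<alpha> * x))) / poly Q (exp (of_real (\<alpha> * x))))" for x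
    unfolding G exp_of_real[symmetric] by simp
  define E where "E = exp ((\<alpha> * real (degree P) + 1)\<^sup>2 / (2 * \<alpha>))"
  define CG where "CG = (coeff_norm + 1) / d * E"
  have E: "E > 0" by (simp add: E_def)
  have "cmod (G (of_real x)) \<le> CG * exp (- \<bar>x\<bar>)" for x
  proof -
    have P: "cmod (poly P (exp (of_real (\<alpha> * x)))) \<le> coeff_norm * exp (\<alpha> * real (degree P) * \<bar>x\<bar>)"
      by (rule poly_P_bound) simp
    have "cmod (G (of_real x)) = exp (- \<alpha> * x\<^sup>2 / 2) * (cmod (poly P (exp (of_real (\<alpha> * x)))) / cmod (poly Q (exp (of_real (\<alpha> * x)))))"
      by (simp add: G_real norm_mult norm_divide)
    also have "\<dots> \<le> exp (- \<alpha> * x\<^sup>2 / 2) * (coeff_norm * exp (\<alpha> * real (degree P) * \<bar>x\<bar>) / d)"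
      using coeff_norm_nonneg d by (intro mult_left_mono frac_le P Qd) auto
    also have "\<dots> = coeff_norm / d * gauss_weight x"
    proof -
      have "gauss_weight x = exp (- \<alpha> * x\<^sup>2 / 2) * exp (\<alpha> * real (degree P) * \<bar>x\<bar>)"
        by (simp only: gauss_weight_def exp_add)
      then show ?thesis by (simp add: mult_ac)
    qed
    also have "\<dots> \<le> (coeff_norm + 1) / d * (E * exp (- \<bar>x\<bar>))"
      using d coeff_norm_nonneg gauss_weight_le_exp[of x] gauss_weight_nonneg[of x]
      by (intro mult_mono divide_right_mono) (auto simp: E_def)
    finally show ?thesis by (simp add: CG_def mult.assoc)
  qed
  moreover have "CG > 0" using d coeff_norm_nonneg E by (simp add: CG_def add_nonneg_pos)
  moreover have "(\<lambda>x::real. G (of_real x)) \<in> borel_measurable borel"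
  proof (rule borel_measurable_continuous_onI)
    have "poly Q (exp (of_real (\<alpha> * x))) \<noteq> 0" for x using Qd[of x] d by auto
    then show "continuous_on UNIV (\<lambda>x::real. G (of_real x))"
      unfolding G_real by (intro continuous_intros) auto
  qed
  ultimately show ?thesis by (auto simp: decaying_generator_def)
qed

lemma point_rules_of_dense:
  assumes rational_gen: "decaying_generator G CG" and T: "T \<ge> 1" and N: "N \<ge> (q + 1) * T + 1"
    and \<delta>: "\<delta> > 0" and sep: "\<And>x y. x \<in> \<Lambda> \<Longrightarrow> y \<in> \<Lambda> \<Longrightarrow> x \<noteq> y \<Longrightarrow> \<delta> \<le> \<bar>x - y\<bar>"
    and rich: "\<And>y. N \<le> card (\<Lambda> \<inter> {y..<y + real T})" and \<eta>: "\<eta> > 0"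
  shows "\<exists>C rad e. small_error \<eta> e \<and> decaying_generator.point_rule G \<Lambda> C rad e"
proof -
  obtain C rad e where C: "C \<ge> 1" "rad \<ge> 1" and e: "small_error \<eta> e"
    and quad: "\<And>\<Lambda> x0. dense_separated \<delta> T N \<Lambda> \<Longrightarrow> 0 \<le> x0 \<Longrightarrow> x0 \<le> 1 \<Longrightarrow>
       quadrature_rule G C rad e \<Lambda> (\<lambda>n. G (of_real (x0 - of_int n)))"
    by (rule point_quadrature[OF T N \<delta> \<eta>]) (rule that, assumption+)
  have "dense_separated \<delta> T N ((\<lambda>x. x - of_int m) ` \<Lambda>)" for m :: int
    by (rule dense_separated_translate[OF sep rich])
  then have "decaying_generator.point_rule G \<Lambda> C rad e"
    using C quad unfolding decaying_generator.point_rule_def[OF rational_gen] by auto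
  then show ?thesis using e by blast
qed

end

text \<open>
Fekete's lemma: the quotient at a nearly optimal \<open>R0\<close> is inherited, up to a bounded error in \<open>h\<close>, by
all large arguments, since these are multiples of \<open>R0\<close> plus a remainder of size at most \<open>2 R0\<close>.
\<close>

lemma superadditive_limit:
  fixes h :: "real \<Rightarrow> real"
  assumes super: "\<And>R S. R \<ge> 1 \<Longrightarrow> S \<ge> 1 \<Longrightarrow> h R + h S \<le> h (R + S)"
    and low: "\<And>R. R \<ge> 1 \<Longrightarrow> b \<le> h R" and up: "\<And>R. R \<ge> 1 \<Longrightarrow> h R \<le> C * R"
  shows "\<exists>l. ((\<lambda>R. h R / R) \<longlongrightarrow> l) at_top"
proof -
  define l where "l = (SUP R\<in>{1..}. h R / R)"
  have bdd: "bdd_above ((\<lambda>R. h R / R) ` {1..})"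
    using up by (intro bdd_aboveI2[where M = C]) (auto simp: field_simps)
  have le_l: "h R / R \<le> l" if "R \<ge> 1" for R
    unfolding l_def using bdd that by (intro cSUP_upper) auto
  have mult: "real n * h R0 + h r \<le> h (real n * R0 + r)" if "R0 \<ge> 1" "r \<ge> 1" for n R0 r
  proof (induction n)
    case (Suc n)
    have "h R0 + h (real n * R0 + r) \<le> h (R0 + (real n * R0 + r))"
      using that by (intro super) (auto intro: add_increasing)
    then show ?case using Suc by (simp add: algebra_simps)
  qed simp
  have "((\<lambda>R. h R / R) \<longlongrightarrow> l) at_top"
  proof (rule order_tendstoI)
    fix a assume "a > l"
    show "\<forall>\<^sub>F R in at_top. h R / R < a"
      using eventually_ge_at_top[of 1]
    proof eventually_elim
      case (elim R)
      then show ?case using le_l[of R] \<open>a > l\<close> by linarith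
    qed
  next
    fix a assume "a < l"
    define a' where "a' = (a + l) / 2"
    have a': "a < a'" "a' < l" using \<open>a < l\<close> by (auto simp: a'_def)
    then obtain R0 where R0: "R0 \<ge> 1" "a' < h R0 / R0"
      unfolding l_def using bdd by (subst (asm) less_cSUP_iff) auto
    have h0: "a' * R0 \<le> h R0" using R0 by (simp add: field_simps)
    \<comment> \<open>write R as n R0 + r with r between R0 and 2 R0\<close>
    have key: "a' * R - (2 * R0 * \<bar>a'\<bar> + \<bar>b\<bar>) \<le> h R" if R: "R \<ge> 2 * R0" for R
    proof -
      define n where "n = nat (\<lfloor>R / R0\<rfloor> - 1)"
      have "2 \<le> R / R0" using R R0 by (simp add: field_simps)
      then have n: "real n = real_of_int \<lfloor>R / R0\<rfloor> - 1" unfolding n_def by linarith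
      then have "real n + 1 \<le> R / R0" "R / R0 < real n + 2" by linarith+
      then have nR: "(real n + 1) * R0 \<le> R" "R < (real n + 2) * R0" using R0 by (simp_all add: field_simps)
      define r where "r = R - real n * R0"
      have r: "r \<ge> 1" using nR R0 by (simp add: r_def algebra_simps)
      have "real n * h R0 + h r \<le> h R" using mult[OF R0(1) r, of n] by (simp add: r_def)
      moreover have "real n * (a' * R0) \<le> real n * h R0" using h0 by (intro mult_left_mono) auto
      moreover have "a' * R - real n * (a' * R0) \<le> 2 * R0 * \<bar>a'\<bar>"
      proof -
        have "a' * R - real n * (a' * R0) = a' * r" by (simp add: r_def algebra_simps)
        also have "\<dots> \<le> \<bar>a'\<bar> * r" using r by (intro mult_right_mono) auto
        also have "\<dots> \<le> \<bar>a'\<bar> * (2 * R0)" using nR by (intro mult_left_mono) (auto simp: r_def algebra_simps)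
        finally show ?thesis by (simp add: mult_ac)
      qed
      moreover have "- \<bar>b\<bar> \<le> h r" using low[OF r] by linarith
      ultimately show ?thesis by linarith
    qed
    define M where "M = 2 * R0 * \<bar>a'\<bar> + \<bar>b\<bar>"
    show "\<forall>\<^sub>F R in at_top. a < h R / R"
      using eventually_ge_at_top[of "2 * R0"] eventually_gt_at_top[of "M / (a' - a)"]
    proof eventually_elim
      case (elim R)
      have R: "R > 0" using elim R0 by linarith
      have "M < (a' - a) * R" using elim(2) a' by (simp add: field_simps)
      then have "a * R < h R" using key[OF elim(1)] by (simp add: M_def algebra_simps)
      then show ?case using R by (simp add: field_simps)
    qed
  qed
  then show ?thesis by blast
qed

text \<open>
The limit in the definition of the density exists: two adjacent closed windows share at most one
point, so the minimal number of points in a window, diminished by one, is superadditive in its length.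
\<close>

lemma lower_density_tendsto:
  assumes sep: "separated \<Lambda>"
  shows "((\<lambda>R. INF x::real. real (card (\<Lambda> \<inter> {x - R..x + R})) / (2 * R)) \<longlongrightarrow> lower_density \<Lambda>) at_top"
proof -
  obtain \<delta> where \<delta>: "\<delta> > 0" "\<And>x y. x \<in> \<Lambda> \<Longrightarrow> y \<in> \<Lambda> \<Longrightarrow> x \<noteq> y \<Longrightarrow> \<delta> \<le> \<bar>x - y\<bar>"
    using separated_gap[OF sep] by blast
  define cnt where "cnt R x = real (card (\<Lambda> \<inter> {x - R..x + R}))" for R x :: real
  define g where "g R = (INF x. cnt R x)" for R
  have bdd: "bdd_below (range (cnt R))" for R by (intro bdd_belowI2[where m = 0]) (simp add: cnt_def)
  have g_le: "g R \<le> cnt R x" for R x unfolding g_def using bdd by (intro cINF_lower) auto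
  have g_ge: "m \<le> g R" if "\<And>x. m \<le> cnt R x" for m R unfolding g_def using that by (intro cINF_greatest) auto
  have fin: "finite (\<Lambda> \<inter> {a..b})" for a b
    using card_separated_interval(1)[OF \<delta>, of \<Lambda> a b] by (cases "a \<le> b") auto
  have super: "(g R - 1) + (g S - 1) \<le> g (R + S) - 1" if "R \<ge> 1" "S \<ge> 1" for R S
  proof -
    have "g R + g S - 1 \<le> cnt (R + S) x" for x
    proof -
      \<comment> \<open>two windows with the common end point x + R - S\<close>
      let ?A = "\<Lambda> \<inter> {x - S - R..x - S + R}" and ?B = "\<Lambda> \<inter> {x + R - S..x + R + S}"
      have "card (?A \<inter> ?B) \<le> card {x + R - S}" by (rule card_mono) auto
      then have i: "card (?A \<inter> ?B) \<le> 1" by simp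
      have "card ?A + card ?B = card (?A \<union> ?B) + card (?A \<inter> ?B)"
        using fin by (rule card_Un_Int) (rule fin)
      moreover have "card (?A \<union> ?B) \<le> card (\<Lambda> \<inter> {x - (R + S)..x + (R + S)})"
        using that by (intro card_mono fin) auto
      ultimately have "real (card ?A) + real (card ?B) - 1 \<le> cnt (R + S) x"
        using i unfolding cnt_def by linarith
      moreover have "g R \<le> real (card ?A)" "g S \<le> real (card ?B)"
        using g_le[of R "x - S"] g_le[of S "x + R"] by (simp_all add: cnt_def)
      ultimately show ?thesis by linarith
    qed
    then have "g R + g S - 1 \<le> g (R + S)" by (rule g_ge)
    then show ?thesis by linarith
  qed
  have low: "-1 \<le> g R - 1" for R using g_ge[of 0 R] by (simp add: cnt_def)
  have up: "g R - 1 \<le> (2 / \<delta>) * R" if "R \<ge> 1" for R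
    using g_le[of R 0] card_separated_interval(2)[OF \<delta>, of \<Lambda> "-R" R] that by (simp add: cnt_def)
  obtain l where l: "((\<lambda>R. (g R - 1) / R) \<longlongrightarrow> l) at_top"
    using superadditive_limit[of "\<lambda>R. g R - 1", OF super low up] by blast
  have "((\<lambda>R. ((g R - 1) / R + 1 / R) / 2) \<longlongrightarrow> (l + 0) / 2) at_top"
  proof -
    have "((\<lambda>R::real. 1 / R) \<longlongrightarrow> 0) at_top" by real_asymp
    then show ?thesis by (intro tendsto_intros l) auto
  qed
  moreover have "\<forall>\<^sub>F R in at_top. ((g R - 1) / R + 1 / R) / 2 = (INF x. cnt R x / (2 * R))"
    using eventually_gt_at_top[of 0]
  proof eventually_elim
    case (elim R)
    have "(INF x. cnt R x / (2 * R)) = g R / (2 * R)"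
    proof (rule antisym)
      have b: "bdd_below (range (\<lambda>x. cnt R x / (2 * R)))"
        using elim by (intro bdd_belowI2[where m = 0]) (simp add: cnt_def)
      have "(INF x. cnt R x / (2 * R)) * (2 * R) \<le> cnt R y" for y
        using cINF_lower[OF b, of y] elim by (simp add: field_simps)
      then have "(INF x. cnt R x / (2 * R)) * (2 * R) \<le> g R" by (rule g_ge)
      then show "(INF x. cnt R x / (2 * R)) \<le> g R / (2 * R)" using elim by (simp add: field_simps)
      show "g R / (2 * R) \<le> (INF x. cnt R x / (2 * R))"
        using g_le elim by (intro cINF_greatest divide_right_mono) auto
    qed
    then show ?case using elim by (simp add: field_simps)
  qed
  ultimately have lim: "((\<lambda>R. INF x. cnt R x / (2 * R)) \<longlongrightarrow> (l + 0) / 2) at_top"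
    by (rule Lim_transform_eventually)
  have "lower_density \<Lambda> = (l + 0) / 2"
    unfolding lower_density_def by (rule tendsto_Lim[OF _ lim[unfolded cnt_def]]) simp
  then show ?thesis using lim unfolding cnt_def by (simp only:)
qed

text \<open>
A surplus of density gives, on long windows, a surplus of points that pays for the end point lost in
half-open windows and for the extra point that the quadrature rules require.
\<close>

lemma dense_windows_of_lower_density:
  assumes sep: "separated \<Lambda>" and dens: "lower_density \<Lambda> > real q + 1"
  obtains T where "T \<ge> 1" "\<And>y. (q + 1) * T + 1 \<le> card (\<Lambda> \<inter> {y..<y + real T})"
proof -
  obtain \<delta> where \<delta>: "\<delta> > 0" "\<And>x y. x \<in> \<Lambda> \<Longrightarrow> y \<in> \<Lambda> \<Longrightarrow> x \<noteq> y \<Longrightarrow> \<delta> \<le> \<bar>x - y\<bar>"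
    using separated_gap[OF sep] by blast
  \<comment> \<open>half of the surplus suffices\<close>
  define \<epsilon> where "\<epsilon> = (lower_density \<Lambda> - (real q + 1)) / 2"
  have \<epsilon>: "\<epsilon> > 0" "real q + 1 + \<epsilon> < lower_density \<Lambda>" using dens by (auto simp: \<epsilon>_def field_simps)
  have "\<forall>\<^sub>F R in at_top. real q + 1 + \<epsilon> < (INF x::real. real (card (\<Lambda> \<inter> {x - R..x + R})) / (2 * R))"
    using order_tendstoD(1)[OF lower_density_tendsto[OF sep] \<epsilon>(2)] .
  then obtain R1 where R1: "\<And>R. R \<ge> R1 \<Longrightarrow> real q + 1 + \<epsilon> < (INF x::real. real (card (\<Lambda> \<inter> {x - R..x + R})) / (2 * R))"
    by (auto simp: eventually_at_top_linorder)
  \<comment> \<open>long enough that the surplus amounts to two points in each window\<close>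
  define T where "T = nat \<lceil>max 1 (max (2 * R1) (2 / \<epsilon>))\<rceil>"
  have Tge: "real T \<ge> max 1 (max (2 * R1) (2 / \<epsilon>))" unfolding T_def by linarith
  then have T: "real T \<ge> 1" "real T / 2 \<ge> R1" "2 / \<epsilon> \<le> real T" by auto
  have "(q + 1) * T + 1 \<le> card (\<Lambda> \<inter> {y..<y + real T})" for y
  proof -
    let ?R = "real T / 2"
    have b: "bdd_below (range (\<lambda>x. real (card (\<Lambda> \<inter> {x - ?R..x + ?R})) / (2 * ?R)))"
      by (intro bdd_belowI2[where m = 0]) auto
    have *: "real q + 1 + \<epsilon> < real (card (\<Lambda> \<inter> {(y + ?R) - ?R..(y + ?R) + ?R})) / (2 * ?R)"
      by (rule less_le_trans[OF R1[OF T(2)] cINF_lower[OF b]]) simp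
    have "(real q + 1 + \<epsilon>) * real T < real (card (\<Lambda> \<inter> {y..y + real T}))"
    proof -
      have "(y + ?R) - ?R = y" "(y + ?R) + ?R = y + real T" "2 * ?R = real T" "0 < real T" using T(1) by simp_all
      with * show ?thesis by (simp only: pos_less_divide_eq)
    qed
    moreover have "2 \<le> \<epsilon> * real T" using T(3) \<epsilon> by (simp add: field_simps)
    ultimately have "(real q + 1) * real T + 2 < real (card (\<Lambda> \<inter> {y..y + real T}))"
      by (simp add: algebra_simps)
    then have "real ((q + 1) * T + 2) < real (card (\<Lambda> \<inter> {y..y + real T}))"
      by (simp add: algebra_simps)
    then have 1: "(q + 1) * T + 2 < card (\<Lambda> \<inter> {y..y + real T})" by (simp only: of_nat_less_iff)
    have fin: "finite (\<Lambda> \<inter> {y..y + real T})"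
      by (rule card_separated_interval(1)[OF \<delta>]) auto
    have "card (\<Lambda> \<inter> {y..y + real T}) \<le> card (insert (y + real T) (\<Lambda> \<inter> {y..<y + real T}))"
      using fin by (intro card_mono) (auto intro: finite_subset[OF _ fin])
    also have "\<dots> \<le> card (\<Lambda> \<inter> {y..<y + real T}) + 1"
    proof -
      have "finite (\<Lambda> \<inter> {y..<y + real T})" by (rule finite_subset[OF _ fin]) auto
      then show ?thesis by (simp add: card_insert_if)
    qed
    finally show ?thesis using 1 by linarith
  qed
  moreover have "T \<ge> 1" using T(1) by linarith
  ultimately show ?thesis by (intro that)
qed

theorem sampling_above_critical_density:
  assumes \<alpha>: "\<alpha> > 0" and rep: "represents \<alpha> G P Q" and stable: "stable_shifts G"
    and sep: "separated \<Lambda>" and dens: "lower_density \<Lambda> > real (degree Q) + 1" and p: "1 \<le> p"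
  shows "sampling_set \<Lambda> p G"
proof -
  obtain l om D c0 where loc: "gauss_rational_const \<alpha> G P Q l (degree Q) om D c0"
    using represents_gauss_rational[OF \<alpha> rep] by metis
  interpret gauss_rational_const \<alpha> G P Q l "degree Q" om D c0 by (rule loc)
  obtain CG where rational_gen: "decaying_generator G CG" using generator_decays by blast
  obtain \<delta> where \<delta>: "\<delta> > 0" "\<And>x y. x \<in> \<Lambda> \<Longrightarrow> y \<in> \<Lambda> \<Longrightarrow> x \<noteq> y \<Longrightarrow> \<delta> \<le> \<bar>x - y\<bar>"
    using separated_gap[OF sep] by blast
  obtain T where T: "T \<ge> 1" "\<And>y. (degree Q + 1) * T + 1 \<le> card (\<Lambda> \<inter> {y..<y + real T})"
    using dense_windows_of_lower_density[OF sep dens] by blast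
  show ?thesis
    by (rule decaying_generator.sampling_from_point_rules[OF rational_gen stable sep _ p])
       (rule point_rules_of_dense[OF rational_gen T(1) order_refl \<delta> T(2)])
qed

section \<open>An extremal generator\<close>

text \<open>
Gaussian elimination: a pivot in the last equation removes one equation and one unknown.
\<close>

lemma underdetermined_system:
  fixes A :: "nat \<Rightarrow> 'k \<Rightarrow> complex"
  assumes "finite K" "card K = Suc m"
  shows "\<exists>x. (\<exists>k\<in>K. x k \<noteq> 0) \<and> (\<forall>i<m. (\<Sum>k\<in>K. A i k * x k) = 0)"
  using assms
proof (induction m arbitrary: K A)
  case 0
  then obtain k where "K = {k}" by (metis One_nat_def card_1_singletonE)
  then show ?case by (intro exI[of _ "\<lambda>_. 1"]) auto
next
  case (Suc m)
  show ?case
  proof (cases "\<exists>p\<in>K. A m p \<noteq> 0")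
    case False
    obtain p where p: "p \<in> K" using Suc.prems by fastforce
    have "card (K - {p}) = Suc m" using Suc.prems p by simp
    then obtain x where x: "\<exists>k\<in>K - {p}. x k \<noteq> 0" "\<forall>i<m. (\<Sum>k\<in>K - {p}. A i k * x k) = 0"
      using Suc.IH[of "K - {p}" A] Suc.prems by auto
    define y where "y k = (if k = p then 0 else x k)" for k
    have "(\<Sum>k\<in>K. A i k * y k) = (\<Sum>k\<in>K - {p}. A i k * x k)" for i
    proof -
      have "(\<Sum>k\<in>K. A i k * y k) = A i p * y p + (\<Sum>k\<in>K - {p}. A i k * y k)"
        using Suc.prems p by (intro sum.remove) auto
      also have "(\<Sum>k\<in>K - {p}. A i k * y k) = (\<Sum>k\<in>K - {p}. A i k * x k)"
        by (intro sum.cong) (auto simp: y_def)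
      finally show ?thesis by (simp add: y_def)
    qed
    moreover have "(\<Sum>k\<in>K. A m k * y k) = 0" using False by simp
    moreover have "\<exists>k\<in>K. y k \<noteq> 0" using x(1) by (auto simp: y_def)
    ultimately show ?thesis using x(2) by (intro exI[of _ y]) (auto simp: less_Suc_eq)
  next
    case True
    then obtain p where p: "p \<in> K" "A m p \<noteq> 0" by blast
    define B where "B i k = A i k - A i p * A m k / A m p" for i k
    have "card (K - {p}) = Suc m" using Suc.prems p by simp
    then obtain x where x: "\<exists>k\<in>K - {p}. x k \<noteq> 0" "\<forall>i<m. (\<Sum>k\<in>K - {p}. B i k * x k) = 0"
      using Suc.IH[of "K - {p}" B] Suc.prems by auto
    define s where "s = (\<Sum>k\<in>K - {p}. A m k * x k)"
    define y where "y k = (if k = p then - s / A m p else x k)" for k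
    have y: "(\<Sum>k\<in>K. A i k * y k) = (\<Sum>k\<in>K - {p}. A i k * x k) - A i p * s / A m p" for i
    proof -
      have "(\<Sum>k\<in>K. A i k * y k) = A i p * y p + (\<Sum>k\<in>K - {p}. A i k * y k)"
        using Suc.prems p by (intro sum.remove) auto
      also have "(\<Sum>k\<in>K - {p}. A i k * y k) = (\<Sum>k\<in>K - {p}. A i k * x k)"
        by (intro sum.cong) (auto simp: y_def)
      finally show ?thesis by (simp add: y_def)
    qed
    have "(\<Sum>k\<in>K. A i k * y k) = 0" if i: "i < m" for i
    proof -
      have "(\<Sum>k\<in>K - {p}. B i k * x k) = (\<Sum>k\<in>K - {p}. A i k * x k - A i p / A m p * (A m k * x k))"
        by (intro sum.cong) (auto simp: B_def algebra_simps)
      also have "\<dots> = (\<Sum>k\<in>K - {p}. A i k * x k) - A i p / A m p * s"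
        unfolding s_def sum_distrib_left by (rule sum_subtractf)
      finally show ?thesis using x(2) i y[of i] by simp
    qed
    moreover have "(\<Sum>k\<in>K. A m k * y k) = 0" using y[of m] p by (simp add: s_def)
    moreover have "\<exists>k\<in>K. y k \<noteq> 0" using x(1) by (auto simp: y_def)
    ultimately show ?thesis by (intro exI[of _ y]) (auto simp: less_Suc_eq)
  qed
qed

lemma finite_comb_interval:
  assumes "h > 0" shows "finite (comb h y \<inter> {a..b})"
proof (cases "a \<le> b")
  case True
  then show ?thesis by (intro card_separated_interval(1)[OF assms comb_separated[OF assms]])
qed simp

lemma comb_window:
  assumes n: "n \<ge> (1::nat)"
  shows "real n * (b - a) - 1 \<le> real (card (comb (1 / real n) y \<inter> {a..b}))"
proof -
  let ?K = "{\<lceil>(a - y) * real n\<rceil>..\<lfloor>(b - y) * real n\<rfloor>}"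
  let ?g = "\<lambda>k::int. y + of_int k * (1 / real n)"
  have n0: "real n > 0" using n by simp
  have sub: "?g ` ?K \<subseteq> comb (1 / real n) y \<inter> {a..b}"
  proof (rule image_subsetI)
    fix k assume k: "k \<in> ?K"
    then have "(a - y) * real n \<le> of_int k" "of_int k \<le> (b - y) * real n"
      by (auto simp: ceiling_le_iff le_floor_iff)
    then have "a - y \<le> of_int k / real n" "of_int k / real n \<le> b - y"
      using n0 by (simp_all only: pos_le_divide_eq pos_divide_le_eq)
    then have "a \<le> ?g k" "?g k \<le> b" by simp_all
    then show "?g k \<in> comb (1 / real n) y \<inter> {a..b}" by (auto simp: comb_def)
  qed
  have inj: "inj_on ?g ?K" using n0 by (auto simp: inj_on_def)
  have "real n * (b - a) - 1 \<le> real (card ?K)"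
  proof -
    have "real n * (b - a) = (b - y) * real n - (a - y) * real n" by (simp add: algebra_simps)
    moreover have "of_int (\<lfloor>(b - y) * real n\<rfloor> - \<lceil>(a - y) * real n\<rceil> + 1) \<le> real (card ?K)" by simp
    ultimately show ?thesis by linarith
  qed
  also have "card ?K = card (?g ` ?K)" using inj by (simp add: card_image)
  also have "real (card (?g ` ?K)) \<le> real (card (comb (1 / real n) y \<inter> {a..b}))"
    using sub n0 by (intro of_nat_mono card_mono finite_comb_interval) auto
  finally show ?thesis .
qed

lemma comb_unit_window:
  assumes n: "n \<ge> (1::nat)"
  shows "n \<le> card (comb (1 / real n) y \<inter> {a..<a + real 1})"
proof -
  define k0 where "k0 = \<lceil>(a - y) * real n\<rceil>"
  let ?g = "\<lambda>k::int. y + of_int k * (1 / real n)"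
  have n0: "real n > 0" using n by simp
  have sub: "?g ` {k0..<k0 + int n} \<subseteq> comb (1 / real n) y \<inter> {a..<a + real 1}"
  proof (rule image_subsetI)
    fix k assume k: "k \<in> {k0..<k0 + int n}"
    have "(a - y) * real n \<le> of_int k0" "of_int k0 < (a - y) * real n + 1" unfolding k0_def by linarith+
    moreover have "real_of_int k0 \<le> of_int k" "real_of_int k \<le> of_int k0 + real n - 1"
      using k by auto
    ultimately have "(a - y) * real n \<le> of_int k" "of_int k < (a - y) * real n + real n" by linarith+
    then have "(a - y) * real n \<le> of_int k" "of_int k < (a - y + 1) * real n" by (simp_all add: distrib_right)
    then have "a - y \<le> of_int k / real n" "of_int k / real n < a - y + 1"
      using n0 by (simp_all only: pos_le_divide_eq pos_divide_less_eq)
    then have "a \<le> ?g k" "?g k < a + real 1" by simp_all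
    then show "?g k \<in> comb (1 / real n) y \<inter> {a..<a + real 1}" by (auto simp: comb_def)
  qed
  have inj: "inj_on ?g {k0..<k0 + int n}" using n0 by (auto simp: inj_on_def)
  have fin: "finite (comb (1 / real n) y \<inter> {a..<a + real 1})"
    by (rule finite_subset[OF _ finite_comb_interval[of "1 / real n" y a "a + 1"]]) (use n0 in auto)
  have "n = card (?g ` {k0..<k0 + int n})" using inj by (simp add: card_image)
  also have "\<dots> \<le> card (comb (1 / real n) y \<inter> {a..<a + real 1})"
    using sub fin by (intro card_mono)
  finally show ?thesis .
qed

lemma separated_comb:
  assumes "h > 0" shows "separated (comb h y)"
proof -
  have "\<exists>e>0. \<forall>a\<in>comb h y. \<forall>b\<in>comb h y. dist a b < e \<longrightarrow> a = b"
    using assms comb_separated[OF assms] by (intro exI[of _ h]) (force simp: dist_real_def)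
  then show ?thesis by (simp add: separated_def uniform_discrete_def comb_def)
qed

lemma lower_density_comb:
  assumes n: "n \<ge> (1::nat)"
  shows "lower_density (comb (1 / real n) y) = real n"
proof -
  let ?u = "\<lambda>R. INF x::real. real (card (comb (1 / real n) y \<inter> {x - R..x + R})) / (2 * R)"
  have h: "1 / real n > 0" using n by simp
  have "(?u \<longlongrightarrow> real n) at_top"
  proof (rule tendsto_sandwich)
    show "((\<lambda>R. real n - 1 / (2 * R)) \<longlongrightarrow> real n) at_top" by real_asymp
    show "((\<lambda>R. real n + 1 / (2 * R)) \<longlongrightarrow> real n) at_top" by real_asymp
    show "\<forall>\<^sub>F R in at_top. real n - 1 / (2 * R) \<le> ?u R"
      using eventually_gt_at_top[of 0]
    proof eventually_elim
      case (elim R)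
      have "real n - 1 / (2 * R) \<le> real (card (comb (1 / real n) y \<inter> {x - R..x + R})) / (2 * R)" for x
      proof -
        have "real n * (2 * R) - 1 \<le> real (card (comb (1 / real n) y \<inter> {x - R..x + R}))"
          using comb_window[OF n, of "x + R" "x - R" y] by simp
        then have "(real n * (2 * R) - 1) / (2 * R) \<le> real (card (comb (1 / real n) y \<inter> {x - R..x + R})) / (2 * R)"
          using elim by (intro divide_right_mono) auto
        then show ?thesis using elim by (simp add: diff_divide_distrib)
      qed
      then show ?case by (intro cINF_greatest) auto
    qed
    show "\<forall>\<^sub>F R in at_top. ?u R \<le> real n + 1 / (2 * R)"
      using eventually_gt_at_top[of 0]
    proof eventually_elim
      case (elim R)
      have "?u R \<le> real (card (comb (1 / real n) y \<inter> {0 - R..0 + R})) / (2 * R)"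
        using elim by (intro cINF_lower bdd_belowI2[where m = 0]) auto
      also have "real (card (comb (1 / real n) y \<inter> {0 - R..0 + R})) \<le> 2 * R * real n + 1"
      proof -
        have "real (card (comb (1 / real n) y \<inter> {0 - R..0 + R})) \<le> ((0 + R) - (0 - R)) / (1 / real n) + 1"
          by (rule card_separated_interval(2)[OF h comb_separated[OF h]]) (use elim in auto)
        then show ?thesis by simp
      qed
      finally show ?case using elim by (simp add: field_simps)
    qed
  qed
  then show ?thesis
    unfolding lower_density_def by (intro tendsto_Lim) auto
qed

lemma gaussian_power_summable:
  fixes b :: "nat \<Rightarrow> complex"
  assumes \<alpha>: "\<alpha> > 0" and b: "\<And>n. cmod (b n) \<le> exp (- \<alpha> * (real n)\<^sup>2 / 2)"
  shows "summable (\<lambda>n. b n * w ^ n)"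
proof (rule summable_comparison_test')
  define L where "L = ln (max 1 (cmod w))"
  define E where "E = exp ((L + 1)\<^sup>2 / (2 * \<alpha>))"
  show "summable (\<lambda>n. E * exp (- 1) ^ n)" by (intro summable_mult summable_geometric) simp
  fix n :: nat
  have "cmod w \<le> exp L" by (simp add: L_def)
  then have w: "cmod w ^ n \<le> exp (real n * L)" unfolding exp_of_nat_mult by (intro power_mono) auto
  have "0 \<le> (\<alpha> * real n - (L + 1))\<^sup>2 / (2 * \<alpha>)" using \<alpha> by simp
  also have "(\<alpha> * real n - (L + 1))\<^sup>2 = \<alpha>\<^sup>2 * (real n)\<^sup>2 - 2 * \<alpha> * (real n * (L + 1)) + (L + 1)\<^sup>2"
    by (simp add: power2_diff power_mult_distrib)
  also have "\<dots> / (2 * \<alpha>) = \<alpha> * (real n)\<^sup>2 / 2 - real n * (L + 1) + (L + 1)\<^sup>2 / (2 * \<alpha>)"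
    using \<alpha> by (simp add: add_divide_distrib diff_divide_distrib power2_eq_square)
  finally have le: "- \<alpha> * (real n)\<^sup>2 / 2 + real n * L \<le> (L + 1)\<^sup>2 / (2 * \<alpha>) + real n * (- 1)"
    by (simp add: algebra_simps)
  have "norm (b n * w ^ n) \<le> exp (- \<alpha> * (real n)\<^sup>2 / 2) * exp (real n * L)"
    unfolding norm_mult norm_power by (intro mult_mono b w) auto
  also have "\<dots> \<le> E * exp (- 1) ^ n"
    unfolding E_def exp_of_nat_mult[symmetric] exp_add[symmetric] using le by simp
  finally show "norm (b n * w ^ n) \<le> E * exp (- 1) ^ n" .
qed

lemma gaussian_power_has_sum:
  fixes b :: "nat \<Rightarrow> complex"
  assumes \<alpha>: "\<alpha> > 0" and b: "\<And>n. cmod (b n) \<le> exp (- \<alpha> * (real n)\<^sup>2 / 2)"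
  shows "((\<lambda>n. b n * w ^ n) has_sum (\<Sum>n. b n * w ^ n)) UNIV"
proof (rule norm_summable_imp_has_sum)
  show "(\<lambda>n. b n * w ^ n) sums (\<Sum>n. b n * w ^ n)"
    by (rule summable_sums[OF gaussian_power_summable[OF \<alpha> b]])
  have "summable (\<lambda>n. of_real (cmod (b n)) * of_real (cmod w) ^ n :: complex)"
    by (rule gaussian_power_summable[OF \<alpha>]) (use b in simp)
  then have "summable (\<lambda>n. complex_of_real (cmod (b n) * cmod w ^ n))" by simp
  then show "summable (\<lambda>n. norm (b n * w ^ n))"
    unfolding summable_complex_of_real by (simp add: norm_mult norm_power)
qed

lemma gaussian_power_holomorphic:
  fixes b :: "nat \<Rightarrow> complex"
  assumes \<alpha>: "\<alpha> > 0" and b: "\<And>n. cmod (b n) \<le> exp (- \<alpha> * (real n)\<^sup>2 / 2)"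
  shows "(\<lambda>w. \<Sum>n. b n * w ^ n) holomorphic_on UNIV"
proof -
  have "(\<lambda>w. \<Sum>n. b n * w ^ n) holomorphic_on ball 0 r" for r
    by (rule power_series_holomorphic[where a = b]) (use summable_sums[OF gaussian_power_summable[OF \<alpha> b]] in simp)
  then have "(\<lambda>w. \<Sum>n. b n * w ^ n) field_differentiable at z" for z
    by (rule holomorphic_on_imp_differentiable_at[of _ "ball 0 (cmod z + 1)"]) auto
  then show ?thesis by (simp add: holomorphic_on_def field_differentiable_at_within)
qed

text \<open>
In the variable \<open>w = e^(\<alpha> x)\<close> the series is a Laurent series \<open>H1 w + H2 (1 / w)\<close> with entire \<open>H1\<close> and
\<open>H2\<close> and \<open>H2 0 = 0\<close>.  If it vanished for \<open>w > 0\<close>, it would vanish on the punctured plane, so \<open>H1\<close> would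
tend to \<open>0\<close> at infinity and be zero by Liouville's theorem, although \<open>H1 0 = c 0\<close>.
\<close>

lemma gaussian_series_nontrivial:
  fixes c :: "int \<Rightarrow> complex"
  assumes \<alpha>: "\<alpha> > 0" and c: "\<And>n. cmod (c n) \<le> 1" "c 0 = 1"
  shows "\<exists>x. shift_series (\<lambda>z. exp (- of_real \<alpha> * z ^ 2 / 2)) c x \<noteq> 0"
proof (rule ccontr)
  assume "\<not> ?thesis"
  then have zero: "shift_series (\<lambda>z. exp (- of_real \<alpha> * z ^ 2 / 2)) c x = 0" for x by simp
  define a where "a n = c n * of_real (exp (- \<alpha> * (real_of_int n)\<^sup>2 / 2))" for n
  define b1 where "b1 k = a (int k)" for k
  \<comment> \<open>the term with index 0 belongs to the entire part H1\<close>
  define b2 where "b2 k = (if k = 0 then 0 else a (- int k))" for k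
  have ab: "cmod (a n) \<le> exp (- \<alpha> * (real_of_int n)\<^sup>2 / 2)" for n
    using mult_right_mono[OF c(1), of "exp (- \<alpha> * (real_of_int n)\<^sup>2 / 2)" n] by (simp add: a_def norm_mult)
  have b1: "cmod (b1 n) \<le> exp (- \<alpha> * (real n)\<^sup>2 / 2)" for n using ab[of "int n"] by (simp add: b1_def)
  have b2: "cmod (b2 n) \<le> exp (- \<alpha> * (real n)\<^sup>2 / 2)" for n using ab[of "- int n"] by (simp add: b2_def)
  define H1 where "H1 w = (\<Sum>n. b1 n * w ^ n)" for w
  define H2 where "H2 w = (\<Sum>n. b2 n * w ^ n)" for w
  have hol: "H1 holomorphic_on UNIV" "H2 holomorphic_on UNIV"
    unfolding H1_def[abs_def] H2_def[abs_def] by (intro gaussian_power_holomorphic[OF \<alpha>] b1 b2)+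
  have on_reals: "H1 (of_real (exp y)) + H2 (of_real (exp (- y))) = 0" for y :: real
  proof -
    define x where "x = y / \<alpha>"
    have y: "y = \<alpha> * x" using \<alpha> by (simp add: x_def)
    have trm: "c n * exp (- of_real \<alpha> * of_real (x - of_int n) ^ 2 / 2) = of_real (exp (- \<alpha> * x\<^sup>2 / 2)) * (a n * of_real (exp (y * of_int n)))" for n :: int
    proof -
      have "exp (- of_real \<alpha> * of_real (x - of_int n) ^ 2 / 2) = complex_of_real (exp (- \<alpha> * (x - of_int n)\<^sup>2 / 2))"
        unfolding exp_of_real[symmetric] by simp
      also have "- \<alpha> * (x - of_int n)\<^sup>2 / 2 = - \<alpha> * x\<^sup>2 / 2 + (- \<alpha> * (real_of_int n)\<^sup>2 / 2 + y * of_int n)"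
        by (simp add: y power2_eq_square field_simps)
      finally show ?thesis by (simp only: exp_add of_real_mult a_def mult_ac)
    qed
    have "of_real (exp (- \<alpha> * x\<^sup>2 / 2)) * infsum (\<lambda>n. a n * of_real (exp (y * of_int n))) UNIV = 0"
      using zero[of x] unfolding shift_series_def trm by (simp add: infsum_cmult_right')
    then have inf0: "infsum (\<lambda>n. a n * of_real (exp (y * of_int n))) UNIV = 0" by simp
    have s1: "((\<lambda>n. a n * of_real (exp (y * of_int n))) has_sum H1 (of_real (exp y))) (range int)"
    proof -
      have "((\<lambda>k. b1 k * of_real (exp y) ^ k) has_sum H1 (of_real (exp y))) UNIV"
        unfolding H1_def by (rule gaussian_power_has_sum[OF \<alpha> b1])
      then show ?thesis
        by (subst has_sum_reindex) (auto simp: comp_def b1_def mult.commute simp flip: exp_of_nat_mult of_real_power)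
    qed
    have s2: "((\<lambda>n. a n * of_real (exp (y * of_int n))) has_sum H2 (of_real (exp (- y)))) ((\<lambda>k. - int k) ` {1..})"
    proof -
      have "((\<lambda>k. b2 k * of_real (exp (- y)) ^ k) has_sum H2 (of_real (exp (- y)))) UNIV"
        unfolding H2_def by (rule gaussian_power_has_sum[OF \<alpha> b2])
      then have "((\<lambda>k. b2 k * of_real (exp (- y)) ^ k) has_sum H2 (of_real (exp (- y)))) {1..}"
        by (rule has_sum_cong_neutral[THEN iffD1, rotated -1]) (auto simp: b2_def)
      moreover have "b2 k * of_real (exp (- y)) ^ k = a (- int k) * of_real (exp (y * of_int (- int k)))" if "k \<in> {1..}" for k
        using that by (simp add: b2_def mult.commute flip: exp_of_nat_mult of_real_power)
      ultimately have "((\<lambda>k. a (- int k) * of_real (exp (y * of_int (- int k)))) has_sum H2 (of_real (exp (- y)))) {1..}"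
        by (rule has_sum_cong[THEN iffD1, rotated])
      then show ?thesis
        by (subst has_sum_reindex) (auto simp: comp_def inj_on_def)
    qed
    have un: "range int \<union> (\<lambda>k. - int k) ` {1..} = UNIV"
    proof -
      have "n \<in> range int \<union> (\<lambda>k. - int k) ` {1..}" for n :: int
      proof (cases "n \<ge> 0")
        case True
        then have "n = int (nat n)" by simp
        then show ?thesis by blast
      next
        case False
        then have "n = - int (nat (- n))" "nat (- n) \<in> {1..}" by auto
        then show ?thesis by blast
      qed
      then show ?thesis by auto
    qed
    have "((\<lambda>n. a n * of_real (exp (y * of_int n))) has_sum (H1 (of_real (exp y)) + H2 (of_real (exp (- y))))) (range int \<union> (\<lambda>k. - int k) ` {1..})"
      by (rule has_sum_Un_disjoint[OF s1 s2]) auto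
    then have "infsum (\<lambda>n. a n * of_real (exp (y * of_int n))) UNIV = H1 (of_real (exp y)) + H2 (of_real (exp (- y)))"
      unfolding un by (rule infsumI)
    then show ?thesis using inf0 by simp
  qed
  have cont: "H1 w + H2 (1 / w) = 0" if w: "w \<noteq> 0" for w
  proof (rule analytic_continuation[where S = "- {0}" and U = "complex_of_real ` {0<..}" and \<xi> = 1 and f = "\<lambda>w. H1 w + H2 (1 / w)"])
    have inv: "(\<lambda>w::complex. 1 / w) holomorphic_on - {0}" by (intro holomorphic_intros) auto
    have "(\<lambda>w. H2 (1 / w)) holomorphic_on - {0}"
      using holomorphic_on_compose_gen[OF inv hol(2)] by (simp add: comp_def)
    then show "(\<lambda>w. H1 w + H2 (1 / w)) holomorphic_on - {0}"
      by (intro holomorphic_on_add holomorphic_on_subset[OF hol(1)]) auto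
    show "connected (- {0::complex})" by (simp add: connected_punctured_universe)
    show "complex_of_real ` {0<..} \<subseteq> - {0}" by auto
    show "1 islimpt complex_of_real ` {0<..}"
      unfolding islimpt_approachable
    proof (intro allI impI)
      fix e :: real assume "e > 0"
      have "complex_of_real (1 + e / 2) - 1 = of_real (e / 2)" by simp
      then have "dist (complex_of_real (1 + e / 2)) 1 = e / 2"
        unfolding dist_norm using \<open>e > 0\<close> by (simp only: norm_of_real)
      moreover have "complex_of_real (1 + e / 2) \<in> complex_of_real ` {0<..}" using \<open>e > 0\<close> by (intro imageI) simp
      ultimately show "\<exists>z\<in>complex_of_real ` {0<..}. z \<noteq> 1 \<and> dist z 1 < e"
        using \<open>e > 0\<close> by (intro bexI[of _ "complex_of_real (1 + e / 2)"]) auto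
    qed
    show "H1 z + H2 (1 / z) = 0" if "z \<in> complex_of_real ` {0<..}" for z
    proof -
      obtain t where t: "t > 0" "z = of_real t" using \<open>z \<in> _\<close> by auto
      then have "z = of_real (exp (ln t))" "1 / z = of_real (exp (- ln t))"
        by (auto simp: exp_minus inverse_eq_divide)
      then show ?thesis using on_reals[of "ln t"] by simp
    qed
  qed (use w in auto)
  have "isCont H2 0"
    using holomorphic_on_imp_continuous_on[OF hol(2)] by (simp add: continuous_on_eq_continuous_at)
  then have "((\<lambda>w. H2 (inverse w)) \<longlongrightarrow> H2 0) at_infinity"
    by (rule isCont_tendsto_compose[OF _ tendsto_inverse_0])
  moreover have "H2 0 = 0" unfolding H2_def by (subst powser_zero) (simp add: b2_def)
  ultimately have "((\<lambda>w. H2 (inverse w)) \<longlongrightarrow> 0) at_infinity" by simp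
  then have "((\<lambda>w. - H2 (inverse w)) \<longlongrightarrow> 0) at_infinity"
    using tendsto_minus by fastforce
  moreover have "\<forall>\<^sub>F w in at_infinity. - H2 (inverse w) = H1 w"
    unfolding eventually_at_infinity
  proof (intro exI[of _ 1] allI impI)
    fix w :: complex assume "1 \<le> norm w"
    then have "w \<noteq> 0" by auto
    then show "- H2 (inverse w) = H1 w" using cont[of w] by (simp add: inverse_eq_divide eq_neg_iff_add_eq_0 add.commute neg_eq_iff_add_eq_0)
  qed
  ultimately have "(H1 \<longlongrightarrow> 0) at_infinity" by (rule Lim_transform_eventually)
  then have "H1 0 = 0" by (rule Liouville_weak_0[OF hol(1)])
  moreover have "H1 0 = 1" unfolding H1_def by (subst powser_zero) (simp add: b1_def a_def c(2))
  ultimately show False by simp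
qed

definition rational_gen :: "real \<Rightarrow> complex poly \<Rightarrow> complex poly \<Rightarrow> complex \<Rightarrow> complex" where
  "rational_gen \<alpha> P Q = (\<lambda>z. exp (- of_real \<alpha> * z ^ 2 / 2) *
     (poly P (exp (of_real \<alpha> * z)) / poly Q (exp (of_real \<alpha> * z))))"

lemma gen_binomial_locale:
  assumes \<alpha>: "\<alpha> > 0"
  shows "gauss_rational_const \<alpha> (rational_gen \<alpha> P ([:1, 1:] ^ q)) P ([:1, 1:] ^ q) 1 q (\<lambda>_. -1) 2 (nat \<lceil>ln 4 / \<alpha>\<rceil>)"
proof
  show "rational_gen \<alpha> P ([:1, 1:] ^ q) = (\<lambda>z. exp (- of_real \<alpha> * z ^ 2 / 2) *
     (poly P (exp (of_real \<alpha> * z)) / poly ([:1, 1:] ^ q) (exp (of_real \<alpha> * z))))"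
    by (simp only: rational_gen_def)
  show "- 1 \<noteq> complex_of_real x" if "0 \<le> x" for x
    using that by (metis less_eq_real_def linorder_not_le neg_less_0_iff_less of_real_1 of_real_eq_iff of_real_minus zero_less_one)
  have "ln 4 / \<alpha> \<le> real (nat \<lceil>ln 4 / \<alpha>\<rceil>)" by linarith
  then have "ln 4 \<le> \<alpha> * real (nat \<lceil>ln 4 / \<alpha>\<rceil>)"
    using \<alpha> by (simp only: pos_divide_le_eq mult.commute)
  then have "exp (ln 4) \<le> exp (\<alpha> * real (nat \<lceil>ln 4 / \<alpha>\<rceil>))" by (simp only: exp_le_cancel_iff)
  then show "2 * 2 \<le> exp (\<alpha> * real (nat \<lceil>ln 4 / \<alpha>\<rceil>))" by simp
qed (use \<alpha> in auto)

lemma stable_gen_binomial: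
  assumes \<alpha>: "\<alpha> > 0" and q: "q \<ge> 1" and P: "poly P (-1) \<noteq> 0"
  shows "stable_shifts (rational_gen \<alpha> P ([:1, 1:] ^ q))"
proof -
  let ?G = "rational_gen \<alpha> P ([:1, 1:] ^ q)"
  interpret gauss_rational_const \<alpha> ?G P "[:1, 1:] ^ q" 1 q "\<lambda>_. -1" 2 "nat \<lceil>ln 4 / \<alpha>\<rceil>"
    by (rule gen_binomial_locale[OF \<alpha>])
  obtain CG where gd: "decaying_generator ?G CG" using generator_decays by blast
  define h where "h = 1 / real (q + 2)"
  have h: "h > 0" by (simp add: h_def)
  have T: "(1::nat) \<le> 1" and N: "q + 2 \<ge> (q + 1) * 1 + 1" by simp_all
  have \<eta>: "(1 / 4 :: real) > 0" by simp
  obtain C rad e where C: "C \<ge> 1" "rad \<ge> 1" and e: "small_error (1 / 4) e"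
    and quad: "\<And>\<Lambda>. dense_separated h 1 (q + 2) \<Lambda> \<Longrightarrow> quadrature_rule ?G C rad e \<Lambda> (\<lambda>n. if n = 0 then 1 else 0)"
    by (rule pole_quadrature[OF T N h \<eta> q refl P]) (rule that, assumption+)
  have "dense_separated h 1 (q + 2) ((\<lambda>x. x - of_int m) ` comb h y)" for y and m :: int
    by (rule dense_separated_translate[OF comb_separated[OF h]], assumption+)
       (unfold h_def, rule comb_unit_window, simp)
  then show ?thesis
    using C by (intro decaying_generator.stable_from_coefficient_rule[OF gd h e, of C rad] quad) auto
qed

lemma stable_shifts_nontrivial:
  assumes stable: "stable_shifts G" and c: "\<And>n. cmod (c n) \<le> 1" "c 0 = 1"
  shows "\<exists>x. shift_series G c x \<noteq> 0"
proof (rule ccontr)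
  assume "\<not> ?thesis"
  then have z: "shift_series G c = (\<lambda>_. 0)" by auto
  have fin: "lp_norm \<infinity> c \<le> 1" by (rule lp_norm_infinity_le) (use c in simp)
  then have "c \<in> lp_space \<infinity>" by (auto simp: lp_space_def less_top[symmetric] top_unique)
  moreover have "(1::ennreal) \<le> \<infinity>" by simp
  ultimately obtain C1 where C1: "C1 > 0" "ennreal C1 * lp_norm \<infinity> c \<le> Lp_norm lborel \<infinity> (shift_series G c)"
    using stable unfolding stable_shifts_def by blast
  have "Lp_norm lborel \<infinity> (shift_series G c) \<le> 0"
    unfolding z by (rule Lp_norm_infinity_le) auto
  then have "ennreal C1 * lp_norm \<infinity> c \<le> 0" using C1(2) by (rule order_trans[rotated])
  then have "lp_norm \<infinity> c = 0" using C1(1) by auto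
  then show False using lp_norm_infinity_ge[of c 0] c(2) by simp
qed

lemma shift_series_cong:
  "(\<And>x::real. G (of_real x) = G' (of_real x)) \<Longrightarrow> shift_series G c = shift_series G' c"
  by (rule ext) (simp only: shift_series_def)

text \<open>
The comb has \<open>N + 1 > q + 1\<close> points per unit length, so the series vanishes on the whole real line.
For \<open>q > 0\<close> this contradicts stability, and for \<open>q = 0\<close> the series is a Gaussian one.
\<close>

lemma vanishing_gen_binomial:
  assumes \<alpha>: "\<alpha> > 0" and q: "q < N" and P: "q = 0 \<Longrightarrow> degree P = 0" "poly P (-1) \<noteq> 0"
    and c: "\<And>n. cmod (c n) \<le> 1" "c 0 = 1"
    and zero: "\<And>x. x \<in> comb (1 / real (N + 1)) y \<Longrightarrow> shift_series (rational_gen \<alpha> P ([:1, 1:] ^ q)) c x = 0"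
  shows False
proof -
  let ?G = "rational_gen \<alpha> P ([:1, 1:] ^ q)"
  interpret gauss_rational_const \<alpha> ?G P "[:1, 1:] ^ q" 1 q "\<lambda>_. -1" 2 "nat \<lceil>ln 4 / \<alpha>\<rceil>"
    by (rule gen_binomial_locale[OF \<alpha>])
  obtain CG where gd: "decaying_generator ?G CG" using generator_decays by blast
  define h where "h = 1 / real (N + 1)"
  have h: "h > 0" by (simp add: h_def)
  have T: "(1::nat) \<le> 1" and N: "N + 1 \<ge> (q + 1) * 1 + 1" using q by simp_all
  have rules: "\<exists>C rad e. small_error \<eta> e \<and> decaying_generator.point_rule ?G (comb h y) C rad e" if "\<eta> > 0" for \<eta>
  proof (rule point_rules_of_dense[OF gd T N h _ _ that])
    show "h \<le> \<bar>a - b\<bar>" if "a \<in> comb h y" "b \<in> comb h y" "a \<noteq> b" for a b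
      by (rule comb_separated[OF h that])
    show "N + 1 \<le> card (comb h y \<inter> {a..<a + real 1})" for a
      unfolding h_def by (rule comb_unit_window) simp
  qed
  have all0: "shift_series ?G c x = 0" for x
    by (rule decaying_generator.vanishing_on_rule_set[OF gd separated_comb[OF h] rules c(1)])
       (use zero in \<open>auto simp: h_def\<close>)
  show False
  proof (cases "q = 0")
    case False
    then have "stable_shifts ?G" using P by (intro stable_gen_binomial[OF \<alpha>]) auto
    from stable_shifts_nontrivial[where c = c, OF this c] show False using all0 by blast
  next
    case True
    define k where "k = coeff P 0"
    have Pk: "P = [:k:]" using P(1)[OF True] by (metis degree_0_id k_def)
    then have k: "k \<noteq> 0" using P(2) by simp
    have "shift_series ?G c x = k * shift_series (\<lambda>z. exp (- of_real \<alpha> * z ^ 2 / 2)) c x" for x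
      unfolding shift_series_def infsum_cmult_right'[symmetric]
      by (intro infsum_cong) (simp add: rational_gen_def Pk True)
    then show False using gaussian_series_nontrivial[where c = c, OF \<alpha> c] all0 k by auto
  qed
qed

text \<open>
Let \<open>z k\<close> be the value at \<open>1 / 2 + k / (N + 1)\<close>.  The quasi-periodicity of the series gives
\<open>z (k + N + 1) = chi * z k\<close>, its oddness about \<open>1 / 2\<close> gives \<open>z (- k) = - z k\<close>, and together they reduce every index
to \<open>0\<close>, to the range of the hypothesis, or for odd \<open>N\<close> to the middle index \<open>(N + 1) / 2\<close>, where
\<open>z k = - z k\<close> because then \<open>chi = 1\<close>.
\<close>

lemma symmetric_series_zeros:
  fixes N :: nat and chi :: complex
  defines "chi \<equiv> - ((-1) ^ N)"
  defines "c \<equiv> (\<lambda>n::int. if even n then 1 else chi)"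
  assumes sym: "\<And>x::real. G (of_real (- x)) = (-1) ^ N * G (of_real x)"
    and zero: "\<And>k. 1 \<le> k \<Longrightarrow> k \<le> N div 2 \<Longrightarrow> shift_series G c (1 / 2 + real k / real (N + 1)) = 0"
    and x: "x \<in> comb (1 / real (N + 1)) (1 / 2)"
  shows "shift_series G c x = 0"
proof -
  let ?f = "shift_series G c"
  have chi2: "chi * chi = 1" unfolding chi_def by (simp flip: power_add mult_2)
  have chi0: "chi \<noteq> 0" using chi2 by auto
  have per: "?f (x + 1) = chi * ?f x" for x
  proof -
    have bij: "bij (\<lambda>n::int. n + 1)" by (rule bij_betw_byWitness[of _ "\<lambda>n. n - 1"]) auto
    have "?f (x + 1) = infsum (\<lambda>n. c (n + 1) * G (of_real (x + 1 - of_int (n + 1)))) UNIV"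
      unfolding shift_series_def by (rule infsum_reindex_bij_betw[OF bij, symmetric])
    also have "\<dots> = infsum (\<lambda>n. chi * (c n * G (of_real (x - of_int n)))) UNIV"
      using chi2 by (intro infsum_cong) (auto simp: c_def mult.assoc[symmetric])
    also have "\<dots> = chi * ?f x" unfolding shift_series_def by (rule infsum_cmult_right')
    finally show ?thesis .
  qed
  have reflect: "?f (1 - x) = - ?f x" for x
  proof -
    have bij: "bij (\<lambda>n::int. 1 - n)" by (rule bij_betw_byWitness[of _ "\<lambda>n. 1 - n"]) auto
    have "?f (1 - x) = infsum (\<lambda>n. c (1 - n) * G (of_real (1 - x - of_int (1 - n)))) UNIV"
      unfolding shift_series_def by (rule infsum_reindex_bij_betw[OF bij, symmetric])
    also have "\<dots> = infsum (\<lambda>n. - (c n * G (of_real (x - of_int n)))) UNIV"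
    proof (rule infsum_cong)
      fix n :: int
      have "1 - x - of_int (1 - n) = - (x - of_int n)" by simp
      then have "G (of_real (1 - x - of_int (1 - n))) = (-1) ^ N * G (of_real (x - of_int n))"
        by (simp only: sym)
      moreover have "c (1 - n) = chi * c n" using chi2 by (auto simp: c_def)
      moreover have "chi * (-1) ^ N = -1" unfolding chi_def by (simp flip: power_add mult_2)
      ultimately show "c (1 - n) * G (of_real (1 - x - of_int (1 - n))) = - (c n * G (of_real (x - of_int n)))"
        by (metis (no_types, opaque_lifting) mult.assoc mult.commute mult_minus1)
    qed
    also have "\<dots> = - ?f x" unfolding shift_series_def by (rule infsum_uminus)
    finally show ?thesis .
  qed
  define z where "z k = ?f (1 / 2 + real_of_int k / real (N + 1))" for k :: int
  have zper: "z (k + (int N + 1)) = chi * z k" for k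
  proof -
    have "1 / 2 + real_of_int (k + (int N + 1)) / real (N + 1) = (1 / 2 + real_of_int k / real (N + 1)) + 1"
    proof -
      have e: "real_of_int (k + (int N + 1)) = real_of_int k + real (N + 1)" by simp
      show ?thesis unfolding e add_divide_distrib by simp
    qed
    then show ?thesis unfolding z_def by (simp only: per)
  qed
  have zneg: "z (- k) = - z k" for k
  proof -
    have "1 / 2 + real_of_int (- k) / real (N + 1) = 1 - (1 / 2 + real_of_int k / real (N + 1))"
      by simp
    then show ?thesis unfolding z_def by (simp only: reflect)
  qed
  have z0: "z 0 = 0" using zneg[of 0] by simp
  have small: "z k = 0" if "1 \<le> k" "k \<le> int (N div 2)" for k
    using zero[of "nat k"] that by (simp add: z_def)
  have range: "z k = 0" if k: "0 \<le> k" "k \<le> int N" for k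
  proof -
    \<comment> \<open>a translation by one period followed by the reflection\<close>
    have swap: "z k = - chi * z (int N + 1 - k)"
      using zper[of "- (int N + 1 - k)"] zneg[of "int N + 1 - k"] by simp
    consider "k = 0" | "1 \<le> k" "k \<le> int (N div 2)" | "1 \<le> int N + 1 - k" "int N + 1 - k \<le> int (N div 2)"
      | "odd N" "int N + 1 - k = k"
    proof -
      have "2 * int (N div 2) = int N \<or> (odd N \<and> 2 * int (N div 2) = int N - 1)"
        by (cases "even N") (auto elim!: evenE oddE)
      then show ?thesis using that k by linarith
    qed
    then show ?thesis
    proof cases
      case 3
      then show ?thesis using small[OF 3] swap by simp
    next
      case 4
      then have "chi = 1" by (simp add: chi_def)
      then show ?thesis using swap 4(2) by simp
    qed (use z0 small in auto)
  qed
  have zperj: "z (k + int j * (int N + 1)) = chi ^ j * z k" for k j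
  proof (induction j)
    case (Suc j)
    have "k + int (Suc j) * (int N + 1) = (k + int j * (int N + 1)) + (int N + 1)" by (simp add: algebra_simps)
    then show ?case by (simp only: zper Suc power_Suc mult.assoc)
  qed simp
  have all: "z k = 0" for k
  proof -
    define r where "r = k mod (int N + 1)"
    have r: "0 \<le> r" "r \<le> int N" unfolding r_def using pos_mod_bound[of "int N + 1" k] by auto
    define j where "j = k div (int N + 1)"
    have kj: "k = r + j * (int N + 1)" by (simp only: r_def j_def mod_div_mult_eq)
    show ?thesis
    proof (cases "j \<ge> 0")
      case True
      then show ?thesis using zperj[of r "nat j"] range[OF r] kj by simp
    next
      case False
      have "z r = chi ^ nat (- j) * z k"
        using zperj[of k "nat (- j)"] False kj by simp
      then show ?thesis using range[OF r] chi0 by simp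
    qed
  qed
  obtain k :: int where "x = 1 / 2 + of_int k * (1 / real (N + 1))" using x by (auto simp: comb_def)
  then show ?thesis using all[of k] by (simp add: z_def)
qed

text \<open>
The coefficients are chosen so that \<open>u^N p (1 / u) = (-1)^N p u\<close>, that is, so that the generator with
denominator \<open>(1 + u)^N\<close> has the parity of \<open>N\<close>.
\<close>

definition sym_poly :: "nat \<Rightarrow> nat \<Rightarrow> complex poly" where
  "sym_poly N i = monom 1 i + smult ((-1) ^ N) (monom 1 (N - i))"

lemma gen_sym_poly:
  assumes \<alpha>: "\<alpha> > 0" and i: "i \<le> N"
  shows "rational_gen \<alpha> (sym_poly N i) ([:1, 1:] ^ N) (of_real (- x)) = (-1) ^ N * rational_gen \<alpha> (sym_poly N i) ([:1, 1:] ^ N) (of_real x)"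
proof -
  \<comment> \<open>the reflection of x replaces u by its inverse\<close>
  define u where "u = complex_of_real (exp (\<alpha> * x))"
  have u: "exp (complex_of_real \<alpha> * of_real x) = u" "exp (complex_of_real \<alpha> * of_real (- x)) = 1 / u"
    by (simp_all add: u_def exp_of_real exp_minus inverse_eq_divide flip: of_real_mult)
  have u0: "u \<noteq> 0" "1 + u \<noteq> 0"
  proof -
    show "u \<noteq> 0" by (simp add: u_def)
    have "1 + exp (\<alpha> * x) > 0" by (simp add: add_pos_pos)
    then show "1 + u \<noteq> 0" unfolding u_def by (metis less_numeral_extra(3) of_real_1 of_real_add of_real_eq_0_iff)
  qed
  have v: "1 + 1 / u = (1 + u) / u" using u0 by (simp add: field_simps)
  have P: "poly (sym_poly N i) w = w ^ i + (-1) ^ N * w ^ (N - i)" for w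
    by (simp add: sym_poly_def poly_monom)
  have "poly (sym_poly N i) (1 / u) * u ^ N = (-1) ^ N * poly (sym_poly N i) u"
  proof -
    have "u ^ N = u ^ i * u ^ (N - i)" using i by (simp flip: power_add)
    moreover have "((-1) ^ N * (-1) ^ N :: complex) = 1" by (simp flip: power_add mult_2)
    ultimately show ?thesis using u0(1)
      by (simp add: P power_one_over distrib_left distrib_right mult.assoc[symmetric])
  qed
  then have "poly (sym_poly N i) (1 / u) / (1 + 1 / u) ^ N = (-1) ^ N * (poly (sym_poly N i) u / (1 + u) ^ N)"
    unfolding v power_divide using u0 by simp
  then have ratio: "poly (sym_poly N i) (1 / u) / poly ([:1, 1:] ^ N) (1 / u) = (-1) ^ N * (poly (sym_poly N i) u / poly ([:1, 1:] ^ N) u)"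
    by (simp add: poly_power)
  have e: "exp (- of_real \<alpha> * of_real (- x) ^ 2 / 2) = exp (- of_real \<alpha> * complex_of_real x ^ 2 / 2)"
    by simp
  show ?thesis
    by (simp only: rational_gen_def u e ratio mult.left_commute)
qed

text \<open>
The \<open>N div 2 + 1\<close> polynomials \<open>sym_poly N i\<close>, \<open>i \<le> N div 2\<close>, face only \<open>N div 2\<close> conditions.  They are linearly
independent: the coefficient of \<open>u^i\<close> singles out the \<open>i\<close>th one.
\<close>

lemma exists_symmetric_numerator:
  fixes N :: nat and c :: "int \<Rightarrow> complex"
  assumes \<alpha>: "\<alpha> > 0" and c: "\<And>n. cmod (c n) \<le> 1"
  obtains P where "P \<noteq> 0" "degree P \<le> N"
    "\<And>x::real. rational_gen \<alpha> P ([:1, 1:] ^ N) (of_real (- x)) = (-1) ^ N * rational_gen \<alpha> P ([:1, 1:] ^ N) (of_real x)"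
    "\<And>k. 1 \<le> k \<Longrightarrow> k \<le> N div 2 \<Longrightarrow> shift_series (rational_gen \<alpha> P ([:1, 1:] ^ N)) c (t k) = 0"
proof -
  let ?Q = "[:1, 1:] ^ N :: complex poly"
  define m where "m = N div 2"
  define A where "A k i = shift_series (rational_gen \<alpha> (sym_poly N i) ?Q) c (t (Suc k))" for k i
  obtain x where x: "\<exists>i\<in>{..m}. x i \<noteq> 0" "\<forall>k<m. (\<Sum>i\<le>m. A k i * x i) = 0"
    using underdetermined_system[of "{..m}" m A] by auto
  define P where "P = (\<Sum>i\<le>m. smult (x i) (sym_poly N i))"
  have mN: "m \<le> N" "m \<le> N - m" unfolding m_def by auto
  have gen_P: "rational_gen \<alpha> P ?Q z = (\<Sum>i\<le>m. x i * rational_gen \<alpha> (sym_poly N i) ?Q z)" for z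
    by (simp add: rational_gen_def P_def poly_sum sum_divide_distrib sum_distrib_left mult_ac)
  have series: "shift_series (rational_gen \<alpha> P ?Q) c y = (\<Sum>i\<le>m. x i * shift_series (rational_gen \<alpha> (sym_poly N i) ?Q) c y)" for y
  proof -
    have "((\<lambda>n. \<Sum>i\<le>m. x i * (c n * rational_gen \<alpha> (sym_poly N i) ?Q (of_real (y - of_int n)))) has_sum
       (\<Sum>i\<le>m. x i * shift_series (rational_gen \<alpha> (sym_poly N i) ?Q) c y)) UNIV"
    proof (rule has_sum_finite_sum)
      fix i
      interpret gauss_rational_const \<alpha> "rational_gen \<alpha> (sym_poly N i) ?Q" "sym_poly N i" ?Q 1 N "\<lambda>_. -1" 2 "nat \<lceil>ln 4 / \<alpha>\<rceil>"
        by (rule gen_binomial_locale[OF \<alpha>])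
      obtain CG where "decaying_generator (rational_gen \<alpha> (sym_poly N i) ?Q) CG" using generator_decays by blast
      then have "(\<lambda>n. c n * rational_gen \<alpha> (sym_poly N i) ?Q (of_real (y - of_int n))) summable_on UNIV"
        by (rule decaying_generator.series_summable[OF _ c])
      then have "((\<lambda>n. c n * rational_gen \<alpha> (sym_poly N i) ?Q (of_real (y - of_int n))) has_sum shift_series (rational_gen \<alpha> (sym_poly N i) ?Q) c y) UNIV"
        unfolding shift_series_def by (rule has_sum_infsum)
      then show "((\<lambda>n. x i * (c n * rational_gen \<alpha> (sym_poly N i) ?Q (of_real (y - of_int n)))) has_sum
          x i * shift_series (rational_gen \<alpha> (sym_poly N i) ?Q) c y) UNIV"
        by (rule has_sum_cmult_right)
    qed simp
    moreover have "(\<Sum>i\<le>m. x i * (c n * rational_gen \<alpha> (sym_poly N i) ?Q (of_real (y - of_int n)))) = c n * rational_gen \<alpha> P ?Q (of_real (y - of_int n))" for n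
      unfolding gen_P sum_distrib_left by (intro sum.cong refl) (simp only: mult_ac)
    ultimately show ?thesis unfolding shift_series_def by (simp add: infsumI)
  qed
  show ?thesis
  proof (rule that)
    obtain i where i: "i \<le> m" "x i \<noteq> 0" using x(1) by auto
    have "coeff P i = (\<Sum>j\<le>m. if j = i then x i * (if N - i = i then 1 + (-1) ^ N else 1) else 0)"
      unfolding P_def coeff_sum
    proof (rule sum.cong[OF refl])
      fix j assume j: "j \<in> {..m}"
      have "N - j = i \<longleftrightarrow> j = i \<and> N - i = i" using j i mN by auto
      then show "coeff (smult (x j) (sym_poly N j)) i = (if j = i then x i * (if N - i = i then 1 + (-1) ^ N else 1) else 0)"
        by (auto simp: sym_poly_def)
    qed
    also have "\<dots> = x i * (if N - i = i then 1 + (-1) ^ N else 1)" using i by (simp add: sum.delta)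
    also have "\<dots> \<noteq> 0"
    proof (cases "N - i = i")
      case True
      \<comment> \<open>for even N the middle monomial occurs twice in the last polynomial\<close>
      then have "N = i + i" using i mN by linarith
      then have "even N" by simp
      then show ?thesis using i by simp
    qed (use i in simp)
    finally show "P \<noteq> 0" by auto
    show "degree P \<le> N"
      unfolding P_def
    proof (rule degree_sum_le)
      fix j assume "j \<in> {..m}"
      then have "j \<le> N" using mN by simp
      then show "degree (smult (x j) (sym_poly N j)) \<le> N"
        unfolding sym_poly_def
        by (intro order_trans[OF degree_smult_le] degree_add_le order_trans[OF degree_monom_le]) auto
    qed simp
    show "rational_gen \<alpha> P ?Q (of_real (- y)) = (-1) ^ N * rational_gen \<alpha> P ?Q (of_real y)" for y :: real
      unfolding gen_P sum_distrib_left
      by (intro sum.cong refl) (use mN in \<open>simp only: atMost_iff gen_sym_poly[OF \<alpha> order_trans[OF _ mN(1)]] mult.left_commute\<close>)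
    show "shift_series (rational_gen \<alpha> P ?Q) c (t k) = 0" if "1 \<le> k" "k \<le> N div 2" for k
    proof -
      have "(\<Sum>i\<le>m. A (k - 1) i * x i) = 0" using x(2) that by (auto simp: m_def)
      then show ?thesis using that by (simp add: series A_def mult.commute)
    qed
  qed
qed

text \<open>
If \<open>-1\<close> were a zero of the numerator found above, cancelling powers of \<open>1 + u\<close> would lower the degree
of the denominator, contradicting \<open>vanishing_gen_binomial\<close>.  Hence the fraction is reduced, the shifts
are stable, and the series vanishing on the comb is not zero.
\<close>

theorem critical_density_not_uniqueness:
  assumes \<alpha>: "\<alpha> > 0" and N: "N \<ge> 1"
  shows "\<exists>G\<in>gen_class \<alpha>. stable_shifts G \<and> denom_degree \<alpha> G = N \<and>
     (\<exists>\<Lambda>. separated \<Lambda> \<and> lower_density \<Lambda> = real (denom_degree \<alpha> G) + 1 \<and> \<not> uniqueness_set \<Lambda> \<infinity> G)"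
proof -
  let ?Q = "[:1, 1:] ^ N :: complex poly"
  let ?\<Lambda> = "comb (1 / real (N + 1)) (1 / 2)"
  define c where "c n = (if even n then 1 else - ((-1) ^ N) :: complex)" for n :: int
  have c: "\<And>n. cmod (c n) \<le> 1" "c 0 = 1" by (auto simp: c_def norm_power)
  obtain P where P0: "P \<noteq> 0" and dP: "degree P \<le> N"
    and sym: "\<And>x::real. rational_gen \<alpha> P ?Q (of_real (- x)) = (-1) ^ N * rational_gen \<alpha> P ?Q (of_real x)"
    and zero: "\<And>k. 1 \<le> k \<Longrightarrow> k \<le> N div 2 \<Longrightarrow> shift_series (rational_gen \<alpha> P ?Q) c (1 / 2 + real k / real (N + 1)) = 0"
    using exists_symmetric_numerator[of \<alpha> c N "\<lambda>k. 1 / 2 + real k / real (N + 1)", OF \<alpha> c(1)] by metis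
  have vanish: "shift_series (rational_gen \<alpha> P ?Q) c x = 0" if "x \<in> ?\<Lambda>" for x
    using symmetric_series_zeros[of "rational_gen \<alpha> P ?Q" N x] sym zero that unfolding c_def[abs_def] by blast
  have Pm1: "poly P (-1) \<noteq> 0"
  proof
    assume root: "poly P (-1) = 0"
    \<comment> \<open>the power of 1 + u that the fraction can be reduced by\<close>
    define j where "j = order (-1) P"
    obtain P1 where P1: "P = [:1, 1:] ^ j * P1" "\<not> [:1, 1:] dvd P1"
      using order_decomp[OF P0, of "-1"] unfolding j_def by auto
    have P1m: "poly P1 (-1) \<noteq> 0" using P1(2) by (simp add: poly_eq_0_iff_dvd)
    have j: "1 \<le> j" "j \<le> degree P"
      using root P0 order_root[of P "-1"] order_degree[OF P0, of "-1"] by (auto simp: j_def)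
    have P10: "P1 \<noteq> 0" using P1m by auto
    have deg: "degree P = j + degree P1"
      unfolding P1(1) using P10 by (subst degree_mult_eq) (auto simp: degree_power_eq)
    have eq: "rational_gen \<alpha> P ?Q (of_real x) = rational_gen \<alpha> P1 ([:1, 1:] ^ (N - j)) (of_real x)" for x
    proof -
      define u where "u = exp (complex_of_real \<alpha> * of_real x)"
      have "u = of_real (exp (\<alpha> * x))" by (simp add: u_def exp_of_real flip: of_real_mult)
      moreover have "1 + exp (\<alpha> * x) > 0" by (simp add: add_pos_pos)
      ultimately have u: "1 + u \<noteq> 0"
        by (metis less_numeral_extra(3) of_real_1 of_real_add of_real_eq_0_iff)
      have "(1 + u) ^ N = (1 + u) ^ j * (1 + u) ^ (N - j)" using j dP by (simp flip: power_add)
      then have "poly P u / poly ?Q u = poly P1 u / poly ([:1, 1:] ^ (N - j)) u"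
        using u by (simp add: P1(1) poly_power)
      then show ?thesis by (simp only: rational_gen_def u_def)
    qed
    show False
    proof (rule vanishing_gen_binomial[OF \<alpha>, of "N - j" N P1 c])
      show "N - j < N" using j N by simp
      show "degree P1 = 0" if "N - j = 0" using that deg dP by simp
      show "shift_series (rational_gen \<alpha> P1 ([:1, 1:] ^ (N - j))) c x = 0" if "x \<in> comb (1 / real (N + 1)) (1 / 2)" for x
        using vanish[OF that] shift_series_cong[of "rational_gen \<alpha> P ?Q" "rational_gen \<alpha> P1 ([:1, 1:] ^ (N - j))" c, OF eq] by simp
    qed (use P1m c in auto)
  qed
  have stable: "stable_shifts (rational_gen \<alpha> P ?Q)" by (rule stable_gen_binomial[OF \<alpha> N Pm1])
  have rep: "represents \<alpha> (rational_gen \<alpha> P ?Q) P ?Q"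
    unfolding represents_def
  proof (intro conjI allI impI)
    show "\<not> (\<exists>w. poly P w = 0 \<and> poly ?Q w = 0)"
    proof
      assume "\<exists>w. poly P w = 0 \<and> poly ?Q w = 0"
      then obtain w where w: "poly P w = 0" "(1 + w) ^ N = 0" by (auto simp: poly_power)
      then have "w = -1" by (simp add: add_eq_0_iff)
      then show False using w Pm1 by simp
    qed
    show "poly ?Q (of_real x) \<noteq> 0" if "0 \<le> x" for x :: real
    proof -
      have "1 + x \<noteq> 0" using that by simp
      then have "1 + complex_of_real x \<noteq> 0" by (metis of_real_1 of_real_add of_real_eq_0_iff)
      then show ?thesis by (simp add: poly_power)
    qed
  qed (use P0 in \<open>auto simp: rational_gen_def\<close>)
  have deg: "denom_degree \<alpha> (rational_gen \<alpha> P ?Q) = N"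
    using denom_degree_eq[OF \<alpha> rep] by (simp add: degree_power_eq)
  obtain x where x: "shift_series (rational_gen \<alpha> P ?Q) c x \<noteq> 0"
    using stable_shifts_nontrivial[where c = c, OF stable c] by blast
  have "lp_norm \<infinity> c \<le> 1" by (rule lp_norm_infinity_le) (use c in simp)
  then have "c \<in> lp_space \<infinity>" by (auto simp: lp_space_def less_top[symmetric] top_unique)
  then have "\<not> uniqueness_set ?\<Lambda> \<infinity> (rational_gen \<alpha> P ?Q)"
    using x vanish by (auto simp: uniqueness_set_def shift_space_def)
  moreover have "separated ?\<Lambda>" by (rule separated_comb) simp
  moreover have "lower_density ?\<Lambda> = real N + 1"
    using lower_density_comb[of "N + 1" "1 / 2"] by simp
  ultimately show ?thesis
    using rep stable deg by (intro bexI[of _ "rational_gen \<alpha> P ?Q"]) (auto simp: gen_class_def)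
qed

theorem theorem1p11:
  fixes \<alpha> :: real
  assumes "\<alpha> > 0"
  shows "(\<forall>G\<in>gen_class \<alpha>. stable_shifts G \<longrightarrow>
            (\<forall>\<Lambda>. separated \<Lambda> \<and> lower_density \<Lambda> > real (denom_degree \<alpha> G) + 1 \<longrightarrow>
               (\<forall>p::ennreal. 1 \<le> p \<longrightarrow> sampling_set \<Lambda> p G)))
       \<and> (\<forall>N::nat. N \<ge> 1 \<longrightarrow>
            (\<exists>G\<in>gen_class \<alpha>. stable_shifts G \<and> denom_degree \<alpha> G = N \<and>
               (\<exists>\<Lambda>. separated \<Lambda> \<and> lower_density \<Lambda> = real (denom_degree \<alpha> G) + 1 \<and>
                  \<not> uniqueness_set \<Lambda> \<infinity> G)))"
proof (intro conjI ballI allI impI)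
  fix G \<Lambda> and p :: ennreal
  assume G: "G \<in> gen_class \<alpha>" and stable: "stable_shifts G"
    and \<Lambda>: "separated \<Lambda> \<and> lower_density \<Lambda> > real (denom_degree \<alpha> G) + 1" and p: "1 \<le> p"
  obtain P Q where rep: "represents \<alpha> G P Q" using G by (auto simp: gen_class_def)
  have "denom_degree \<alpha> G = degree Q" by (rule denom_degree_eq[OF assms rep])
  then show "sampling_set \<Lambda> p G"
    using \<Lambda> by (intro sampling_above_critical_density[OF assms rep stable _ _ p]) auto
next
  fix N :: nat assume "N \<ge> 1"
  then show "\<exists>G\<in>gen_class \<alpha>. stable_shifts G \<and> denom_degree \<alpha> G = N \<and>
               (\<exists>\<Lambda>. separated \<Lambda> \<and> lower_density \<Lambda> = real (denom_degree \<alpha> G) + 1 \<and>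
                  \<not> uniqueness_set \<Lambda> \<infinity> G)"
    by (rule critical_density_not_uniqueness[OF assms])
qed

end
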